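(* Let $S\subseteq \mathbf{R}_+$ be finite or countable, $\mu$ a probability on $S$, $\psi$ a positive function on $S$, $c>0$ a constant, and $\kappa(x,y)=c\,\psi(x)\psi(y)$. Let $\mathcal V=(S,\mu,(x_1,\ldots,x_n)_{n\ge 1})$ be a vertex space on which $\kappa$ is graphical, and let $G^{\mathcal V}(n,\kappa)$ be the associated inhomogeneous random graph (definitions in the context). Assume that: (1) either $\sup_{x\in S}\psi(x)<\infty$; or, for some monotone increasing unbounded function $\psi_0$ and positive constants $A_1\le A_2$, one has $A_1\psi_0(x)\le\psi(x)\le A_2\psi_0(x)$ for all large $x$, and $\sum_{x\in S}e^{a\psi(x)}\mu(x)<\infty$ for some $a>0$; (2) for any $\varepsilon>0$ and $q>0$, $$\mathbf P\left\{\left|\frac{\#\{i:x_i=k\}}{n}-\mu(k)\right|\le\varepsilon e^{q\psi(k)}\mu(k)\ \text{ for all } k\in S\right\}\to 1\quad\text{as } n\to\infty .$$ Set $c^{cr}:=\left(\sum_{x\in S}\psi^2(x)\mu(x)\right)^{-1}$ and $$\alpha(c)=\sup\Big\{z\ge 1:\ \sum_{x\in S}\psi(x)\,\mathbf E z^{\Phi(x)}\,\mu(x)<\infty\Big\}.$$ Let $\mathcal L$ denote the set of all connected components of $G^{\mathcal V}(n,\kappa)$. Then $$\frac{\max_{L\in\mathcal L}\sum_{x_i\in L}\psi(x_i)}{\log n}\ \stackrel{P}{\longrightarrow}\ \frac{1}{\log\alpha(c)}\quad\text{as } n\to\infty,$$ where $\alpha(c)>1$ if $c<c^{cr}$ and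 $\alpha(c)=1$ if $c\ge c^{cr}$.
   Context: Vertex space: $S\subseteq\mathbf R_+$ is regarded as a separable metric space with Borel probability measure $\mu$ (write $\mu(x)=\mu(\{x\})$). For each $n$, $x_1,\ldots,x_n$ (which may depend on $n$) is a deterministic or random sequence of points of $S$ such that for every $\mu$-continuity set $A\subseteq S$, $\#\{i:x_i\in A\}/n\to\mu(A)$ in probability as $n\to\infty$. Random graph: given $x_1,\ldots,x_n$, the graph $G^{\mathcal V}(n,\kappa)$ has vertices $x_1,\ldots,x_n$ (the $i$-th vertex has type $x_i$; there are $n$ vertices, several may have the same type), and any two vertices $x_i,x_j$ are joined by an edge, independently of the other pairs, with probability $p_{x_i,x_j}(n)=\min\{c\,\psi(x_i)\psi(x_j)/n,\,1\}$. The sum $\sum_{x_i\in L}\psi(x_i)$ runs over all vertices of the component $L$. The kernel $\kappa$ is graphical on $\mathcal V$ if (i) $\kappa$ is continuous a.e. on $S\times S$; (ii) $\kappa\in L^1(S\times S,\mu\times\mu)$; (iii) $\frac1n\mathbf E\,e(G^{\mathcal V}(n,\kappa))\to\frac12\int_{S^2}\kappa(x,y)\,d\mu(x)d\mu(y)$, where $e(G)$ is the number of edges of $G$. Branching process: $B_\kappa(x)$ is the multi-type Galton–Watson process with type space $S$ starting with one particle of type $x\in S$, in which at every step each particle of type $u\in S$ is replaced, independently, by offspring whose number of type $y$ is $\mathrm{Po}(\kappa(u,y)\mu(y))$, independently for $y\in S$. $\Phi(x)\in(0,\infty]$ is the sum of $\psi(v)$ over (the types $v$ of) all particles ever produced by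 $B_\kappa(x)$, including the initial one; thus $\Phi(x)\stackrel{d}{=}\psi(x)+\sum_{y\in S}\sum_{i=1}^{N_x(y)}\Phi_i(y)$ with independent $N_x(y)\sim\mathrm{Po}(c\psi(x)\psi(y)\mu(y))$ and independent copies $\Phi_i(y)$ of $\Phi(y)$. For $z>1$, $z^\infty=\infty$, and $1^\infty=1$. Convention: $1/\log 1=+\infty$; convergence in probability to $+\infty$ means that for every $M$ the probability of exceeding $M$ tends to $1$. *)

theory Defs
  imports "HOL-Probability.Probability"
begin

text \<open>
  The sample space \<open>M n\<close> may change with \<open>n\<close>. Convergence to \<open>\<infinity>\<close> means that the probability of
  exceeding any fixed bound tends to \<open>1\<close>.
\<close>

definition conv_in_prob :: "(nat \<Rightarrow> 'w measure) \<Rightarrow> (nat \<Rightarrow> 'w \<Rightarrow> real) \<Rightarrow> ereal \<Rightarrow> bool" where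
  "conv_in_prob M X L \<longleftrightarrow>
     (case L of
        ereal l \<Rightarrow>
          \<forall>\<epsilon>>0. (\<lambda>n. measure (M n) {\<omega> \<in> space (M n). \<bar>X n \<omega> - l\<bar> > \<epsilon>}) \<longlonglongrightarrow> 0
      | PInfty \<Rightarrow>
          \<forall>b. (\<lambda>n. measure (M n) {\<omega> \<in> space (M n). X n \<omega> > b}) \<longlonglongrightarrow> 1
      | MInfty \<Rightarrow>
          \<forall>b. (\<lambda>n. measure (M n) {\<omega> \<in> space (M n). X n \<omega> < b}) \<longlonglongrightarrow> 1)"


section \<open>Vertex spaces\<close>

text \<open>
  \<open>x n i \<omega>\<close> is the type of vertex \<open>i \<in> {1..n}\<close>. The points \<open>x n 1, \<dots>, x n n\<close> may have an
  arbitrary joint law (deterministic ones are the constant functions), and nothing is assumed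
  about the relation between different \<open>n\<close>. Boundaries are taken in the subspace \<open>S\<close>.
\<close>

definition vertex_space ::
  "real set \<Rightarrow> real measure \<Rightarrow> (nat \<Rightarrow> 'w measure) \<Rightarrow> (nat \<Rightarrow> nat \<Rightarrow> 'w \<Rightarrow> real) \<Rightarrow> bool" where
  "vertex_space S \<mu> M x \<longleftrightarrow>
     prob_space \<mu> \<and> sets \<mu> = sets (restrict_space borel S) \<and>
     (\<forall>n. prob_space (M n)) \<and>
     (\<forall>n. \<forall>i\<in>{1..n}. x n i \<in> measurable (M n) \<mu>) \<and>
     (\<forall>A\<in>sets \<mu>. measure \<mu> ((top_of_set S) frontier_of A) = 0 \<longrightarrow>
        conv_in_prob M (\<lambda>n \<omega>. card {i\<in>{1..n}. x n i \<omega> \<in> A} / n) (ereal (measure \<mu> A)))"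


section \<open>The inhomogeneous random graph\<close>

text \<open>Graphs on \<open>{1..n}\<close> are represented by their edge sets.\<close>

definition vertex_pairs :: "nat \<Rightarrow> nat set set" where
  "vertex_pairs n = {{i, j} | i j. i \<in> {1..n} \<and> j \<in> {1..n} \<and> i \<noteq> j}"

definition edge_prob :: "(real \<Rightarrow> real \<Rightarrow> real) \<Rightarrow> nat \<Rightarrow> real \<Rightarrow> real \<Rightarrow> real" where
  "edge_prob \<kappa> n u v = min (\<kappa> u v / n) 1"

text \<open>
  \<open>G n\<close> is a version of the random graph on the probability space carrying \<open>x n 1, \<dots>, x n n\<close>:
  given the types, the edges are present independently with probabilities \<open>edge_prob\<close>. As the
  type space is countable, elementary conditioning on \<open>x n 1 = t 1, \<dots>, x n n = t n\<close> determines
  the joint law of types and graph.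
\<close>

definition inhom_random_graph ::
  "real set \<Rightarrow> (real \<Rightarrow> real \<Rightarrow> real) \<Rightarrow> (nat \<Rightarrow> 'w measure) \<Rightarrow> (nat \<Rightarrow> nat \<Rightarrow> 'w \<Rightarrow> real) \<Rightarrow>
   (nat \<Rightarrow> 'w \<Rightarrow> nat set set) \<Rightarrow> bool" where
  "inhom_random_graph S \<kappa> M x G \<longleftrightarrow>
     (\<forall>n. G n \<in> measurable (M n) (count_space (Pow (vertex_pairs n)))) \<and>
     (\<forall>n. \<forall>t \<in> {1..n} \<rightarrow> S. \<forall>H. H \<subseteq> vertex_pairs n \<longrightarrow>
        measure (M n) {\<omega> \<in> space (M n). (\<forall>i\<in>{1..n}. x n i \<omega> = t i) \<and> G n \<omega> = H} =
        measure (M n) {\<omega> \<in> space (M n). \<forall>i\<in>{1..n}. x n i \<omega> = t i} *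
        (\<Prod>(i, j) \<in> {(i, j). i \<in> {1..n} \<and> j \<in> {1..n} \<and> i < j}.
           if {i, j} \<in> H then edge_prob \<kappa> n (t i) (t j) else 1 - edge_prob \<kappa> n (t i) (t j)))"

definition graphical ::
  "real set \<Rightarrow> real measure \<Rightarrow> (real \<Rightarrow> real \<Rightarrow> real) \<Rightarrow> (nat \<Rightarrow> 'w measure) \<Rightarrow>
   (nat \<Rightarrow> 'w \<Rightarrow> nat set set) \<Rightarrow> bool" where
  "graphical S \<mu> \<kappa> M G \<longleftrightarrow>
     (AE z in \<mu> \<Otimes>\<^sub>M \<mu>. continuous (at z within S \<times> S) (\<lambda>(u, v). \<kappa> u v)) \<and>
     integrable (\<mu> \<Otimes>\<^sub>M \<mu>) (\<lambda>(u, v). \<kappa> u v) \<and>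
     (\<lambda>n. (\<integral>\<omega>. real (card (G n \<omega>)) \<partial>M n) / n)
        \<longlonglongrightarrow> (\<integral>(u, v). \<kappa> u v \<partial>(\<mu> \<Otimes>\<^sub>M \<mu>)) / 2"

definition components :: "'v set \<Rightarrow> 'v set set \<Rightarrow> 'v set set" where
  "components V E = (\<lambda>v. {w \<in> V. (v, w) \<in> {(a, b). {a, b} \<in> E}\<^sup>*}) ` V"


section \<open>The branching process\<close>

text \<open>
  Particles carry Ulam--Harris labels: the label \<open>[(y\<^sub>1, i\<^sub>1), \<dots>, (y\<^sub>m, i\<^sub>m)]\<close> stands for the
  \<open>i\<^sub>m\<close>-th child of type \<open>y\<^sub>m\<close> (counting from \<open>0\<close>) of the particle
  \<open>[(y\<^sub>1, i\<^sub>1), \<dots>, (y\<^sub>m\<^sub>-\<^sub>1, i\<^sub>m\<^sub>-\<^sub>1)]\<close>, and \<open>[]\<close> is the root.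
  A sample point \<open>N\<close> prescribes the number \<open>N (p, y)\<close> of children of type \<open>y\<close>
  that the label \<open>p\<close> has if it is produced.
\<close>

type_synonym particle = "(real \<times> nat) list"

definition particle_type :: "real \<Rightarrow> particle \<Rightarrow> real" where
  "particle_type x p = (if p = [] then x else fst (last p))"

text \<open>\<open>poisson_pmf\<close> is only specified for positive rates.\<close>

definition Po :: "real \<Rightarrow> nat pmf" where
  "Po r = (if r = 0 then return_pmf 0 else poisson_pmf r)"

definition branching_space ::
  "real set \<Rightarrow> real measure \<Rightarrow> (real \<Rightarrow> real \<Rightarrow> real) \<Rightarrow> real \<Rightarrow> (particle \<times> real \<Rightarrow> nat) measure" where
  "branching_space S \<mu> \<kappa> x =
     (\<Pi>\<^sub>M (p, y) \<in> lists (S \<times> UNIV) \<times> S.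
        measure_pmf (Po (\<kappa> (particle_type x p) y * measure \<mu> {y})))"

definition produced :: "real set \<Rightarrow> (particle \<times> real \<Rightarrow> nat) \<Rightarrow> particle set" where
  "produced S N =
     {p \<in> lists (S \<times> UNIV). \<forall>m<length p. snd (p ! m) < N (take m p, fst (p ! m))}"

definition total_weight ::
  "real set \<Rightarrow> (real \<Rightarrow> real) \<Rightarrow> real \<Rightarrow> (particle \<times> real \<Rightarrow> nat) \<Rightarrow> ennreal" where
  "total_weight S \<psi> x N = (\<Sum>\<^sub>\<infinity>p\<in>produced S N. ennreal (\<psi> (particle_type x p)))"

text \<open>For \<open>z \<ge> 1\<close>, with \<open>1\<^sup>\<infinity> = 1\<close>, and \<open>z\<^sup>\<infinity> = \<infinity>\<close> if \<open>z > 1\<close>.\<close>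

definition pow_ennreal :: "real \<Rightarrow> ennreal \<Rightarrow> ennreal" where
  "pow_ennreal z t =
     (if z = 1 then 1 else if t = \<infinity> then \<infinity> else ennreal (z powr enn2real t))"

definition rank1_kernel :: "real \<Rightarrow> (real \<Rightarrow> real) \<Rightarrow> real \<Rightarrow> real \<Rightarrow> real" where
  "rank1_kernel c \<psi> u v = c * \<psi> u * \<psi> v"

definition alpha :: "real set \<Rightarrow> real measure \<Rightarrow> (real \<Rightarrow> real) \<Rightarrow> real \<Rightarrow> ereal" where
  "alpha S \<mu> \<psi> c =
     Sup (ereal ` {z. z \<ge> 1 \<and>
       (\<Sum>\<^sub>\<infinity>x\<in>S. ennreal (\<psi> x) *
          (\<integral>\<^sup>+N. pow_ennreal z (total_weight S \<psi> x N) \<partial>branching_space S \<mu> (rank1_kernel c \<psi>) x) *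
          ennreal (measure \<mu> {x})) < \<infinity>})"

definition c_cr :: "real set \<Rightarrow> real measure \<Rightarrow> (real \<Rightarrow> real) \<Rightarrow> real" where
  "c_cr S \<mu> \<psi> = inverse (\<Sum>\<^sub>\<infinity>x\<in>S. (\<psi> x)\<^sup>2 * measure \<mu> {x})"

text \<open>\<open>1 / log a\<close> for \<open>a \<in> [1, \<infinity>]\<close>, with \<open>1 / log 1 = \<infinity>\<close>.\<close>

definition recip_log :: "ereal \<Rightarrow> ereal" where
  "recip_log a =
     (if a = 1 then \<infinity> else if a = \<infinity> then 0 else ereal (1 / ln (real_of_ereal a)))"

end

theory Submission
  imports Defs "HOL-Real_Asymp.Real_Asymp"
begin

text \<open>
  Given the types, revealing the edges at one vertex of a cluster leaves an independent random graph
  on the remaining vertices. By induction, the generating function of the cluster weight is bounded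
  by every supersolution of the recursion of the branching process with the empirical type
  distribution. For \<open>z < \<alpha>(c)\<close> such a supersolution is obtained from the branching process with
  distribution \<open>\<mu>\<close>, and a first moment bound gives the upper estimate.

  For \<open>z > \<alpha>(c)\<close> the generating function of the branching process, restricted to finitely many types
  and generations, is arbitrarily large, so the cluster weight exceeds some bounded level \<open>j\<close> with
  probability at least a large multiple of \<open>z\<^sup>-\<^sup>j\<close>. As a vertex has two neighbours of the same type with
  positive probability, the tail is supermultiplicative, and levels of order \<open>log n\<close> are exceeded
  with probability at least \<open>n\<close> to a power above \<open>-1\<close>. Exploring and removing clusters one after the
  other then meets a heavy one with probability tending to 1.
\<close>

section \<open>Independent random subsets\<close>

text \<open>Once the types are fixed, every probability is a finite sum, the expectation
  \<open>bern\<close> over independent edge sets; measures return only when the types are averaged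
  out. The recurring obstacle is depletion: an explored vertex is lost for the rest of the
  exploration. For the upper estimate this is harmless, since a supersolution with values at least 1
  remains one on every smaller vertex set. For the lower estimate each exploration has to stay
  bounded, hence the limits on types, generations, children and weight, and the vertices already
  lost are accounted for by the slack in \<open>many\<close>. The lower estimate uses that the
  generating function becomes arbitrarily large: a renewal at two neighbours costs a factor
  \<open>b\<close>, so a level \<open>j\<close> is wanted whose probability exceeds
  \<open>z^(-j)\<close> by the factor \<open>1 / b\<close>. Renewals then cost nothing in the
  exponential rate. In the upper estimate the relative error \<open>e^(q \<psi>)\<close> allowed in
  the type frequencies may be unbounded over the types; lowering the base of the power gains a
  factor exponential in \<psi> and absorbs it.\<close>

definition bern :: "'e set \<Rightarrow> ('e \<Rightarrow> real) \<Rightarrow> ('e set \<Rightarrow> real) \<Rightarrow> real" where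
  "bern F P f = (\<Sum>H\<in>Pow F. (\<Prod>e\<in>H. P e) * (\<Prod>e\<in>F - H. 1 - P e) * f H)"

lemma bern_cong:
  assumes "\<And>e. e \<in> F \<Longrightarrow> P e = Q e" "\<And>H. H \<subseteq> F \<Longrightarrow> f H = g H"
  shows "bern F P f = bern F Q g"
proof -
  have "(\<Prod>e\<in>H. P e) * (\<Prod>e\<in>F - H. 1 - P e) * f H = (\<Prod>e\<in>H. Q e) * (\<Prod>e\<in>F - H. 1 - Q e) * g H"
    if "H \<subseteq> F" for H
  proof -
    have "(\<Prod>e\<in>H. P e) = (\<Prod>e\<in>H. Q e)" "(\<Prod>e\<in>F - H. 1 - P e) = (\<Prod>e\<in>F - H. 1 - Q e)"
      using assms(1) that by (auto intro!: prod.cong)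
    then show ?thesis
      using assms(2)[OF that] by simp
  qed
  then show ?thesis
    unfolding bern_def by (intro sum.cong) auto
qed

text \<open>Expanding the product of the factors \<open>P e * h e + (1 - P e)\<close> produces one
  summand for every subset of \<open>F\<close>. With \<open>h\<close> constantly 1 it says that the
  weights in \<open>bern\<close> sum to 1.\<close>

lemma bern_prod:
  assumes "finite F"
  shows "bern F P (\<lambda>H. \<Prod>e\<in>H. h e) = (\<Prod>e\<in>F. 1 + P e * (h e - 1))"
proof -
  have "(\<Prod>e\<in>F. 1 + P e * (h e - 1)) = (\<Prod>e\<in>F. P e * h e + (1 - P e))"
    by (intro prod.cong) (auto simp: algebra_simps)
  also have "\<dots> = bern F P (\<lambda>H. \<Prod>e\<in>H. h e)"
    unfolding bern_def prod_add[OF assms]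
    by (intro sum.cong) (auto simp: prod.distrib)
  finally show ?thesis ..
qed

lemma bern_const: "finite F \<Longrightarrow> bern F P (\<lambda>_. a) = a"
proof -
  assume "finite F"
  then have "bern F P (\<lambda>_. 1) = 1"
    using bern_prod[of F P "\<lambda>_. 1"] by simp
  then show ?thesis
    unfolding bern_def by (simp add: sum_distrib_right[symmetric])
qed

lemma bern_cmult: "bern F P (\<lambda>H. a * f H) = a * bern F P f"
  unfolding bern_def by (simp add: sum_distrib_left mult.left_commute)

lemma bern_add: "bern F P (\<lambda>H. f H + g H) = bern F P f + bern F P g"
  unfolding bern_def by (simp add: sum.distrib distrib_left)

lemma bern_diff: "bern F P (\<lambda>H. f H - g H) = bern F P f - bern F P g"
  unfolding bern_def by (simp add: sum_subtractf right_diff_distrib)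

lemma bern_sum: "bern F P (\<lambda>H. \<Sum>i\<in>I. f i H) = (\<Sum>i\<in>I. bern F P (f i))"
  unfolding bern_def by (simp add: sum_distrib_left) (rule sum.swap)

lemma bern_mono:
  assumes "\<And>e. e \<in> F \<Longrightarrow> 0 \<le> P e \<and> P e \<le> 1" "\<And>H. H \<subseteq> F \<Longrightarrow> f H \<le> g H"
  shows "bern F P f \<le> bern F P g"
  unfolding bern_def
  by (intro sum_mono mult_left_mono mult_nonneg_nonneg prod_nonneg) (use assms in auto)

lemma bern_nonneg:
  assumes "\<And>e. e \<in> F \<Longrightarrow> 0 \<le> P e \<and> P e \<le> 1" "\<And>H. H \<subseteq> F \<Longrightarrow> 0 \<le> f H"
  shows "0 \<le> bern F P f"
  using bern_mono[of F P "\<lambda>_. 0" f] assms by (simp add: bern_def)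

lemma bern_Un:
  assumes "finite F1" "finite F2" "F1 \<inter> F2 = {}"
  shows "bern (F1 \<union> F2) P f = bern F1 P (\<lambda>H1. bern F2 P (\<lambda>H2. f (H1 \<union> H2)))"
proof -
  have "bern (F1 \<union> F2) P f =
    (\<Sum>(H1, H2)\<in>Pow F1 \<times> Pow F2. (\<Prod>e\<in>H1. P e) * (\<Prod>e\<in>F1 - H1. 1 - P e) *
       ((\<Prod>e\<in>H2. P e) * (\<Prod>e\<in>F2 - H2. 1 - P e) * f (H1 \<union> H2)))"
    unfolding bern_def
  proof (rule sum.reindex_bij_witness[where i = "\<lambda>(H1, H2). H1 \<union> H2" and j = "\<lambda>H. (H \<inter> F1, H \<inter> F2)"],
      goal_cases)
    case (5 H)
    then have H: "H \<subseteq> F1 \<union> F2" by auto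
    have fin: "finite H" using finite_subset[OF H] assms by auto
    have 1: "(\<Prod>e\<in>H. P e) = (\<Prod>e\<in>H \<inter> F1. P e) * (\<Prod>e\<in>H \<inter> F2. P e)"
      using H fin assms by (subst prod.union_disjoint[symmetric]) (auto intro!: prod.cong)
    have 2: "(\<Prod>e\<in>F1 \<union> F2 - H. 1 - P e) = (\<Prod>e\<in>F1 - H \<inter> F1. 1 - P e) * (\<Prod>e\<in>F2 - H \<inter> F2. 1 - P e)"
      using assms by (subst prod.union_disjoint[symmetric]) (auto intro!: prod.cong)
    have "H \<inter> F1 \<union> H \<inter> F2 = H" using H by auto
    then show ?case by (simp only: prod.case 1 2) (simp add: mult_ac)
  qed (use assms in auto)
  also have "\<dots> = bern F1 P (\<lambda>H1. bern F2 P (\<lambda>H2. f (H1 \<union> H2)))"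
    unfolding bern_def by (simp add: sum.cartesian_product[symmetric] sum_distrib_left)
  finally show ?thesis .
qed

lemma bern_marginal:
  assumes "finite F" "F' \<subseteq> F"
  shows "bern F P (\<lambda>H. f (H \<inter> F')) = bern F' P f"
proof -
  have "bern F P (\<lambda>H. f (H \<inter> F')) = bern (F' \<union> (F - F')) P (\<lambda>H. f (H \<inter> F'))"
    using assms by (simp add: Un_absorb1)
  also have "\<dots> = bern F' P (\<lambda>H1. bern (F - F') P (\<lambda>H2. f ((H1 \<union> H2) \<inter> F')))"
    using assms by (intro bern_Un) (auto intro: finite_subset)
  also have "\<dots> = bern F' P (\<lambda>H1. bern (F - F') P (\<lambda>H2. f H1))"
    by (intro bern_cong refl arg_cong[where f = f]) auto
  finally show ?thesis
    using assms by (simp add: bern_const)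
qed

lemma bern_image:
  assumes "inj_on g F"
  shows "bern (g ` F) P f = bern F (P \<circ> g) (\<lambda>H. f (g ` H))"
proof -
  have "bern (g ` F) P f =
      (\<Sum>H\<in>Pow F. (\<Prod>e\<in>g ` H. P e) * (\<Prod>e\<in>g ` F - g ` H. 1 - P e) * f (g ` H))"
    unfolding bern_def image_Pow_surj[OF refl, symmetric]
    by (subst sum.reindex) (auto simp: inj_on_image_Pow[OF assms])
  also have "\<dots> = bern F (P \<circ> g) (\<lambda>H. f (g ` H))"
    unfolding bern_def
  proof (intro sum.cong refl)
    fix H assume H: "H \<in> Pow F"
    have "g ` F - g ` H = g ` (F - H)"
      using inj_on_image_set_diff[OF assms, of F H] H by auto
    moreover have "inj_on g H" "inj_on g (F - H)"
      using assms H by (auto intro: inj_on_subset)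
    ultimately show "(\<Prod>e\<in>g ` H. P e) * (\<Prod>e\<in>g ` F - g ` H. 1 - P e) * f (g ` H) =
      (\<Prod>e\<in>H. (P \<circ> g) e) * (\<Prod>e\<in>F - H. 1 - (P \<circ> g) e) * f (g ` H)"
      by (simp add: prod.reindex)
  qed
  finally show ?thesis .
qed


section \<open>Exploring a random graph\<close>

definition pairs :: "'v set \<Rightarrow> 'v set set" where
  "pairs V = {{i, j} | i j. i \<in> V \<and> j \<in> V \<and> i \<noteq> j}"

text \<open>A set of seeds, not a single vertex, because after the edges at one vertex are revealed
  its neighbours join the seeds that are still open.\<close>

definition reach :: "'v set set \<Rightarrow> 'v set \<Rightarrow> 'v set" where
  "reach H A = {(x, y). {x, y} \<in> H}\<^sup>* `` A"

lemma finite_pairs: "finite V \<Longrightarrow> finite (pairs V)"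
  by (rule finite_subset[of _ "Pow V"]) (auto simp: pairs_def)

lemma pairs_mono: "V \<subseteq> V' \<Longrightarrow> pairs V \<subseteq> pairs V'"
  unfolding pairs_def by blast

lemma reach_empty [simp]: "reach H {} = {}"
  by (simp add: reach_def)

lemma subset_reach: "A \<subseteq> reach H A"
  by (auto simp: reach_def)

lemma reach_edge: "y \<in> reach H A \<Longrightarrow> {y, z} \<in> H \<Longrightarrow> z \<in> reach H A"
  by (auto simp: reach_def intro: rtrancl_into_rtrancl)

lemma reach_least:
  assumes "A \<subseteq> Q" "\<And>y z. y \<in> Q \<Longrightarrow> {y, z} \<in> H \<Longrightarrow> z \<in> Q"
  shows "reach H A \<subseteq> Q"
proof -
  have "y \<in> Q" if "(x, y) \<in> {(x, y). {x, y} \<in> H}\<^sup>*" "x \<in> A" for x y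
    using that by (induction rule: rtrancl_induct) (use assms in auto)
  then show ?thesis
    by (auto simp: reach_def)
qed

lemma reach_mono: "H \<subseteq> H' \<Longrightarrow> A \<subseteq> A' \<Longrightarrow> reach H A \<subseteq> reach H' A'"
  by (rule reach_least) (auto intro: subset_reach[THEN subsetD] reach_edge[OF _ subsetD])

lemma reach_subset:
  assumes "H \<subseteq> pairs V" "A \<subseteq> V"
  shows "reach H A \<subseteq> V"
proof (rule reach_least)
  fix y z assume "{y, z} \<in> H"
  then obtain i j where "{y, z} = {i, j}" "i \<in> V" "j \<in> V"
    using assms by (auto simp: pairs_def)
  then show "z \<in> V"
    by (auto simp: doubleton_eq_iff)
qed fact

lemma reach_sing_eq:
  assumes "u \<in> reach H {v}"
  shows "reach H {u} = reach H {v}"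
proof -
  let ?R = "{(x, y). {x, y} \<in> H}"
  have "sym (?R\<^sup>*)"
    by (intro sym_rtrancl) (auto simp: sym_def insert_commute)
  moreover have "(v, u) \<in> ?R\<^sup>*"
    using assms by (auto simp: reach_def)
  ultimately have "(u, v) \<in> ?R\<^sup>*"
    by (auto dest: symD)
  with \<open>(v, u) \<in> ?R\<^sup>*\<close> show ?thesis
    by (auto simp: reach_def intro: rtrancl_trans)
qed

lemma pairs_remove:
  assumes "a \<in> V"
  shows "pairs V = (\<lambda>j. {a, j}) ` (V - {a}) \<union> pairs (V - {a})"
    and "(\<lambda>j. {a, j}) ` (V - {a}) \<inter> pairs (V - {a}) = {}"
proof -
  show "pairs V = (\<lambda>j. {a, j}) ` (V - {a}) \<union> pairs (V - {a})"
  proof (intro equalityI subsetI)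
    fix e assume "e \<in> pairs V"
    then obtain i j where e: "e = {i, j}" "i \<in> V" "j \<in> V" "i \<noteq> j"
      by (auto simp: pairs_def)
    then consider "i = a" | "j = a" | "i \<noteq> a" "j \<noteq> a" by blast
    then show "e \<in> (\<lambda>j. {a, j}) ` (V - {a}) \<union> pairs (V - {a})"
      using e by cases (auto simp: pairs_def insert_commute)
  qed (use assms in \<open>auto simp: pairs_def\<close>)
qed (auto simp: pairs_def)

lemma reach_remove:
  assumes H: "H \<subseteq> pairs (V - {a})" and a: "a \<in> A"
  shows "reach ((\<lambda>j. {a, j}) ` N \<union> H) A = insert a (reach H (A - {a} \<union> N))" (is "?L = ?R")
proof
  have notin: "a \<notin> e" if "e \<in> H" for e
    using H that by (auto simp: pairs_def)
  show "?L \<subseteq> ?R"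
  proof (rule reach_least)
    show "A \<subseteq> ?R"
      using subset_reach[of "A - {a} \<union> N" H] by auto
    fix y z assume y: "y \<in> ?R" and "{y, z} \<in> (\<lambda>j. {a, j}) ` N \<union> H"
    then consider j where "j \<in> N" "{y, z} = {a, j}" | "{y, z} \<in> H" by auto
    then show "z \<in> ?R"
    proof cases
      case 1
      then show ?thesis
        using subset_reach[of "A - {a} \<union> N" H] by (auto simp: doubleton_eq_iff)
    next
      case 2
      then have "y \<noteq> a" using notin by auto
      then show ?thesis using 2 y reach_edge by fastforce
    qed
  qed
  have "N \<subseteq> ?L"
    using reach_edge[of a "(\<lambda>j. {a, j}) ` N \<union> H" A] subset_reach[of A] a by blast
  then have "reach H (A - {a} \<union> N) \<subseteq> ?L"
    by (intro reach_least) (auto intro: subset_reach[THEN subsetD] reach_edge)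
  then show "?R \<subseteq> ?L"
    using a subset_reach[of A] by blast
qed

text \<open>
  Reveal the edges at one vertex \<open>a\<close> of \<open>A\<close>. The second argument of \<open>f\<close> is the graph induced
  outside the explored part.
\<close>

lemma bern_explore:
  assumes "finite V" "a \<in> A" "A \<subseteq> V"
  shows "bern (pairs V) P (\<lambda>H. f (reach H A) {e\<in>H. e \<inter> reach H A = {}}) =
    bern (V - {a}) (\<lambda>j. P {a, j}) (\<lambda>N. bern (pairs (V - {a})) P
      (\<lambda>H. f (insert a (reach H (A - {a} \<union> N))) {e\<in>H. e \<inter> reach H (A - {a} \<union> N) = {}}))"
    (is "?lhs = ?rhs")
proof -
  have a: "a \<in> V" using assms by auto
  let ?s = "\<lambda>j. {a, j}"
  have inj: "inj_on ?s (V - {a})"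
    by (auto simp: inj_on_def doubleton_eq_iff)
  have "?lhs = bern (?s ` (V - {a})) P (\<lambda>H1. bern (pairs (V - {a})) P (\<lambda>H2.
      f (reach (H1 \<union> H2) A) {e\<in>H1 \<union> H2. e \<inter> reach (H1 \<union> H2) A = {}}))"
    unfolding pairs_remove(1)[OF a]
    by (rule bern_Un) (use assms pairs_remove(2)[OF a] in \<open>auto intro: finite_pairs\<close>)
  also have "\<dots> = bern (V - {a}) (P \<circ> ?s) (\<lambda>N. bern (pairs (V - {a})) P (\<lambda>H2.
      f (reach (?s ` N \<union> H2) A) {e\<in>?s ` N \<union> H2. e \<inter> reach (?s ` N \<union> H2) A = {}}))"
    by (rule bern_image[OF inj])
  also have "\<dots> = ?rhs"
  proof (intro bern_cong)
    fix N H assume H: "H \<subseteq> pairs (V - {a})"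
    have notin: "a \<notin> e" if "e \<in> H" for e
      using H that by (auto simp: pairs_def)
    show "f (reach (?s ` N \<union> H) A) {e \<in> ?s ` N \<union> H. e \<inter> reach (?s ` N \<union> H) A = {}} =
      f (insert a (reach H (A - {a} \<union> N))) {e \<in> H. e \<inter> reach H (A - {a} \<union> N) = {}}"
      unfolding reach_remove[OF H \<open>a \<in> A\<close>]
      by (intro arg_cong2[where f = f]) (use notin in auto)
  qed auto
  finally show ?thesis .
qed

lemma bern_explore_sum:
  assumes "finite V" "a \<in> A" "A \<subseteq> V"
  shows "bern (pairs V) P (\<lambda>H. f (sum w (reach H A))) =
    bern (V - {a}) (\<lambda>j. P {a, j}) (\<lambda>N. bern (pairs (V - {a})) P
      (\<lambda>H. f (w a + sum w (reach H (A - {a} \<union> N)))))"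
  unfolding bern_explore[OF assms, of P "\<lambda>C _. f (sum w C)"]
proof (intro bern_cong refl)
  fix N H assume "N \<subseteq> V - {a}" "H \<subseteq> pairs (V - {a})"
  then have "reach H (A - {a} \<union> N) \<subseteq> V - {a}"
    using assms by (intro reach_subset) auto
  then have "finite (reach H (A - {a} \<union> N))" "a \<notin> reach H (A - {a} \<union> N)"
    using assms by (auto intro: finite_subset)
  then show "f (sum w (insert a (reach H (A - {a} \<union> N)))) = f (w a + sum w (reach H (A - {a} \<union> N)))"
    by simp
qed

text \<open>Revealing the edges at \<open>a\<close> yields the factor \<open>z powr w a\<close> and
  replaces \<open>a\<close> by its neighbours, over which the product formula averages. Two
  consequences of \<open>h \<ge> 1\<close> close the induction over the vertex set: the
  supersolution inequality survives the removal of vertices, and a vertex that is both an old seed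
  and a new neighbour may be counted twice.\<close>

lemma bern_powr_reach_le:
  assumes "finite V" "A \<subseteq> V" "z > 0"
    and "\<And>e. e \<in> pairs V \<Longrightarrow> 0 \<le> P e \<and> P e \<le> 1"
    and "\<And>a. a \<in> V \<Longrightarrow> h a \<ge> 1"
    and "\<And>a. a \<in> V \<Longrightarrow> z powr w a * (\<Prod>j\<in>V - {a}. 1 + P {a, j} * (h j - 1)) \<le> h a"
  shows "bern (pairs V) P (\<lambda>H. z powr sum w (reach H A)) \<le> (\<Prod>a\<in>A. h a)"
  using assms
proof (induction V arbitrary: A rule: finite_psubset_induct)
  case (psubset V)
  show ?case
  proof (cases "A = {}")
    case True
    then show ?thesis
      using psubset by (simp add: bern_const finite_pairs)
  next
    case False
    then obtain a where a: "a \<in> A" by auto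
    then have aV: "a \<in> V" using psubset by auto
    have P: "0 \<le> P {a, j} \<and> P {a, j} \<le> 1" if "j \<in> V - {a}" for j
      using psubset.prems(3)[of "{a, j}"] that aV by (auto simp: pairs_def)
    have fin: "finite A" using psubset by (auto intro: finite_subset)
    have 1: "bern (pairs (V - {a})) P (\<lambda>H. z powr sum w (reach H (A - {a} \<union> N))) \<le> (\<Prod>i\<in>A - {a}. h i) * (\<Prod>i\<in>N. h i)"
      if N: "N \<subseteq> V - {a}" for N
    proof -
      have "bern (pairs (V - {a})) P (\<lambda>H. z powr sum w (reach H (A - {a} \<union> N))) \<le> (\<Prod>i\<in>A - {a} \<union> N. h i)"
      proof (rule psubset.IH)
        fix b assume b: "b \<in> V - {a}"
        have ba: "0 \<le> P {b, j} \<and> P {b, j} \<le> 1" if "j \<in> V - {b}" for j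
          using psubset.prems(3)[of "{b, j}"] that b by (auto simp: pairs_def)
        have "(\<Prod>j\<in>V - {a} - {b}. 1 + P {b, j} * (h j - 1)) \<le> (\<Prod>j\<in>V - {b}. 1 + P {b, j} * (h j - 1))"
          using ba psubset.prems(4) psubset.hyps
          by (intro prod_mono2) (auto intro!: add_nonneg_nonneg mult_nonneg_nonneg)
        with psubset.prems(5)[of b] b
        show "z powr w b * (\<Prod>j\<in>V - {a} - {b}. 1 + P {b, j} * (h j - 1)) \<le> h b"
          by (meson DiffD1 mult_left_mono order_trans powr_ge_zero)
      qed (use psubset aV N pairs_mono[of "V - {a}" V] in auto)
      also have "\<dots> \<le> (\<Prod>i\<in>A - {a}. h i) * (\<Prod>i\<in>N. h i)"
      proof -
        have fN: "finite N" using N psubset by (auto intro: finite_subset)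
        have "(\<Prod>i\<in>A - {a} \<union> N. h i) = (\<Prod>i\<in>A - {a}. h i) * (\<Prod>i\<in>N - (A - {a}). h i)"
          using fin fN by (subst prod.union_disjoint[symmetric]) (auto intro!: prod.cong)
        also have "\<dots> \<le> (\<Prod>i\<in>A - {a}. h i) * (\<Prod>i\<in>N. h i)"
        proof (intro mult_left_mono prod_mono2 prod_nonneg)
          fix i assume "i \<in> N - (N - (A - {a}))" then show "1 \<le> h i"
            using N psubset.prems(4)[of i] by auto
        next
          fix i assume "i \<in> N - (A - {a})" then show "0 \<le> h i"
            using N psubset.prems(4)[of i] by auto
        next
          fix i assume "i \<in> A - {a}" then show "0 \<le> h i"
            using psubset.prems(1) psubset.prems(4)[of i] by auto
        qed (use fN in auto)
        finally show ?thesis .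
      qed
      finally show ?thesis .
    qed
    have "bern (pairs V) P (\<lambda>H. z powr sum w (reach H A)) =
      bern (V - {a}) (\<lambda>j. P {a, j}) (\<lambda>N. bern (pairs (V - {a})) P
      (\<lambda>H. z powr w a * z powr sum w (reach H (A - {a} \<union> N))))"
      using bern_explore_sum[OF psubset.hyps a psubset.prems(1), of P "\<lambda>x. z powr x" w] psubset.prems(2)
      by (simp add: powr_add)
    also have "\<dots> \<le> bern (V - {a}) (\<lambda>j. P {a, j}) (\<lambda>N. z powr w a * ((\<Prod>i\<in>A - {a}. h i) * (\<Prod>i\<in>N. h i)))"
      unfolding bern_cmult[of "pairs (V - {a})"]
      by (intro bern_mono mult_left_mono 1 P) auto
    also have "\<dots> = (z powr w a * (\<Prod>i\<in>V - {a}. 1 + P {a, i} * (h i - 1))) * (\<Prod>i\<in>A - {a}. h i)"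
      unfolding bern_cmult using psubset.hyps by (simp add: bern_prod mult_ac)
    also have "\<dots> \<le> h a * (\<Prod>i\<in>A - {a}. h i)"
    proof (intro mult_right_mono psubset.prems(5) aV prod_nonneg)
      fix i assume "i \<in> A - {a}" then show "0 \<le> h i"
        using psubset.prems(1) psubset.prems(4)[of i] by auto
    qed
    also have "\<dots> = (\<Prod>a\<in>A. h a)"
      using a fin by (simp add: prod.remove)
    finally show ?thesis .
  qed
qed

text \<open>Markov's inequality for a weighted count: in a cluster of weight above \<open>x\<close>
  each vertex \<open>u\<close> contributes the share \<open>w u / x\<close>, and these shares sum to
  at least 1. Compared with a union bound over the vertices this gains a factor
  \<open>1 / x\<close>, the only decaying factor left when \<open>z powr x\<close> is the number of
  vertices.\<close>

lemma bern_exists_heavy_le: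
  assumes "finite V" "z > 1" "x > 0"
    and P: "\<And>e. e \<in> pairs V \<Longrightarrow> 0 \<le> P e \<and> P e \<le> 1"
    and w: "\<And>a. a \<in> V \<Longrightarrow> w a \<ge> 0"
    and h: "\<And>a. a \<in> V \<Longrightarrow> h a \<ge> 1"
    and super: "\<And>a. a \<in> V \<Longrightarrow> z powr w a * (\<Prod>j\<in>V - {a}. 1 + P {a, j} * (h j - 1)) \<le> h a"
  shows "bern (pairs V) P (\<lambda>H. of_bool (\<exists>v\<in>V. x < sum w (reach H {v})))
    \<le> (\<Sum>v\<in>V. w v * (h v - 1)) / (x * (z powr x - 1))"
proof -
  have zx: "z powr x > 1" using assms by (simp add: gr_one_powr)
  let ?f = "\<lambda>H. \<Sum>v\<in>V. w v / (x * (z powr x - 1)) * (z powr sum w (reach H {v}) - 1)"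
  have "of_bool (\<exists>v\<in>V. x < sum w (reach H {v})) \<le> ?f H" if H: "H \<subseteq> pairs V" for H
  proof -
    have wr: "0 \<le> sum w (reach H {v})" if "v \<in> V" for v
      using reach_subset[OF H, of "{v}"] that w by (intro sum_nonneg) auto
    have nonneg: "0 \<le> w v / (x * (z powr x - 1)) * (z powr sum w (reach H {v}) - 1)" if "v \<in> V" for v
      using w[OF that] zx assms(2,3) wr[OF that]
      by (intro mult_nonneg_nonneg divide_nonneg_nonneg) (auto intro: ge_one_powr_ge_zero)
    show ?thesis
    proof (cases "\<exists>v\<in>V. x < sum w (reach H {v})")
      case True
      then obtain v where v: "v \<in> V" "x < sum w (reach H {v})" by auto
      define L where "L = reach H {v}"
      have LV: "L \<subseteq> V" unfolding L_def using H v by (intro reach_subset) auto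
      have "1 \<le> (\<Sum>u\<in>L. w u / x)"
        using v assms(3) by (simp add: sum_divide_distrib[symmetric] L_def)
      also have "\<dots> \<le> (\<Sum>u\<in>L. w u / (x * (z powr x - 1)) * (z powr sum w (reach H {u}) - 1))"
      proof (rule sum_mono)
        fix u assume u: "u \<in> L"
        then have "reach H {u} = L" using reach_sing_eq unfolding L_def by metis
        then have "z powr sum w (reach H {u}) - 1 \<ge> z powr x - 1"
          using v assms(2) by (simp add: L_def)
        then have "w u / (x * (z powr x - 1)) * (z powr x - 1) \<le> w u / (x * (z powr x - 1)) * (z powr sum w (reach H {u}) - 1)"
          using w[of u] u LV assms zx by (intro mult_left_mono divide_nonneg_nonneg mult_nonneg_nonneg) (auto simp: less_imp_le)
        then show "w u / x \<le> w u / (x * (z powr x - 1)) * (z powr sum w (reach H {u}) - 1)"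
          using zx by simp
      qed
      also have "\<dots> \<le> ?f H"
        using LV nonneg assms(1) by (intro sum_mono2) auto
      finally show ?thesis using True by simp
    next
      case False
      then show ?thesis using nonneg by (simp add: sum_nonneg)
    qed
  qed
  then have "bern (pairs V) P (\<lambda>H. of_bool (\<exists>v\<in>V. x < sum w (reach H {v}))) \<le> bern (pairs V) P ?f"
    using P by (intro bern_mono) auto
  also have "\<dots> = (\<Sum>v\<in>V. w v / (x * (z powr x - 1)) * (bern (pairs V) P (\<lambda>H. z powr sum w (reach H {v})) - 1))"
    unfolding bern_sum bern_cmult bern_diff bern_const[OF finite_pairs[OF assms(1)]] ..
  also have "\<dots> \<le> (\<Sum>v\<in>V. w v / (x * (z powr x - 1)) * (h v - 1))"
  proof (intro sum_mono mult_left_mono divide_nonneg_nonneg diff_right_mono)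
    fix v assume "v \<in> V"
    then show "bern (pairs V) P (\<lambda>H. z powr sum w (reach H {v})) \<le> h v"
      using bern_powr_reach_le[of V "{v}" z P h w] assms by simp
  qed (use zx assms in \<open>auto intro!: mult_nonneg_nonneg simp: less_imp_le\<close>)
  also have "\<dots> = (\<Sum>v\<in>V. w v * (h v - 1)) / (x * (z powr x - 1))"
    by (simp add: sum_divide_distrib)
  finally show ?thesis .
qed

section \<open>Reaching a given weight: monotonicity, concatenation of explorations, removal of
  light clusters\<close>

definition prob_heavy :: "('v set \<Rightarrow> real) \<Rightarrow> ('v \<Rightarrow> real) \<Rightarrow> 'v set \<Rightarrow> 'v set \<Rightarrow> real \<Rightarrow> real" where
  "prob_heavy P w V A y = bern (pairs V) P (\<lambda>H. of_bool (y \<le> sum w (reach H A)))"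

definition all_light :: "('v \<Rightarrow> real) \<Rightarrow> real \<Rightarrow> 'v set \<Rightarrow> 'v set set \<Rightarrow> bool" where
  "all_light w x V H \<longleftrightarrow> (\<forall>v\<in>V. sum w (reach H {v}) < x)"

lemma prob_heavy_explore:
  assumes "finite V" "a \<in> A" "A \<subseteq> V"
  shows "prob_heavy P w V A y =
    bern (V - {a}) (\<lambda>j. P {a, j}) (\<lambda>N. prob_heavy P w (V - {a}) (A - {a} \<union> N) (y - w a))"
  unfolding prob_heavy_def
  using bern_explore_sum[OF assms, of P "\<lambda>x. of_bool (y \<le> x)" w] by (simp add: algebra_simps)

context
  fixes P :: "'v set \<Rightarrow> real" and w :: "'v \<Rightarrow> real" and U :: "'v set"
  assumes P: "\<And>e. e \<in> pairs U \<Longrightarrow> 0 \<le> P e \<and> P e \<le> 1"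
    and w: "\<And>v. v \<in> U \<Longrightarrow> 0 \<le> w v"
    and fin: "finite U"
begin

lemma P_edge: "a \<in> U \<Longrightarrow> j \<in> U \<Longrightarrow> a \<noteq> j \<Longrightarrow> 0 \<le> P {a, j} \<and> P {a, j} \<le> 1"
  by (rule P) (auto simp: pairs_def)

lemma P_pairs: "V \<subseteq> U \<Longrightarrow> e \<in> pairs V \<Longrightarrow> 0 \<le> P e \<and> P e \<le> 1"
  using P pairs_mono by blast

lemma prob_heavy_bounds:
  assumes "V \<subseteq> U"
  shows "0 \<le> prob_heavy P w V A y" "prob_heavy P w V A y \<le> 1"
proof -
  show "0 \<le> prob_heavy P w V A y"
    unfolding prob_heavy_def using P_pairs[OF assms] by (intro bern_nonneg) auto
  have "prob_heavy P w V A y \<le> bern (pairs V) P (\<lambda>_. 1)"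
    unfolding prob_heavy_def using P_pairs[OF assms] by (intro bern_mono) auto
  then show "prob_heavy P w V A y \<le> 1"
    using bern_const[of "pairs V" P 1] finite_pairs[of V] finite_subset[OF assms fin] by auto
qed

lemma sum_reach_mono:
  assumes "V \<subseteq> U" "A' \<subseteq> V" "A \<subseteq> A'" "H' \<subseteq> pairs V" "H \<subseteq> H'"
  shows "sum w (reach H A) \<le> sum w (reach H' A')"
proof (rule sum_mono2)
  have "reach H' A' \<subseteq> V" using assms by (intro reach_subset)
  then have "reach H' A' \<subseteq> U" using assms by auto
  then show "finite (reach H' A')" "\<And>b. b \<in> reach H' A' - reach H A \<Longrightarrow> 0 \<le> w b"
    using w fin by (auto intro: finite_subset)
  show "reach H A \<subseteq> reach H' A'" using assms by (intro reach_mono) auto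
qed

lemma prob_heavy_mono:
  assumes "V \<subseteq> U" "A' \<subseteq> V" "A \<subseteq> A'" "y' \<le> y"
  shows "prob_heavy P w V A y \<le> prob_heavy P w V A' y'"
  unfolding prob_heavy_def
proof (intro bern_mono P_pairs)
  fix H assume "H \<subseteq> pairs V"
  then have "sum w (reach H A) \<le> sum w (reach H A')"
    using assms by (intro sum_reach_mono) auto
  then show "of_bool (y \<le> sum w (reach H A)) \<le> (of_bool (y' \<le> sum w (reach H A')) :: real)"
    using assms by auto
qed (use assms in auto)

lemma prob_heavy_nonpos:
  assumes "V \<subseteq> U" "A \<subseteq> V" "y \<le> 0"
  shows "prob_heavy P w V A y = 1"
proof -
  have "finite (pairs V)" using finite_pairs finite_subset[OF assms(1) fin] by auto
  moreover have "y \<le> sum w (reach H A)" if "H \<subseteq> pairs V" for H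
    using reach_subset[OF that assms(2)] w assms by (intro order_trans[OF assms(3)] sum_nonneg) auto
  then have "prob_heavy P w V A y = bern (pairs V) P (\<lambda>_. 1)"
    unfolding prob_heavy_def by (intro bern_cong) auto
  ultimately show ?thesis by (simp add: bern_const)
qed

text \<open>
  The exploration from \<open>A\<close> is stopped as soon as the weight \<open>j\<close> is collected; it has then used
  few vertices, and the exploration from \<open>u\<close> can start afresh among the remaining ones.
\<close>

lemma prob_heavy_two_seeds:
  fixes j y w0 :: real
  assumes "V \<subseteq> U" "u \<in> V" "A \<subseteq> V - {u}" "\<beta> \<ge> 0" "w0 \<ge> 0"
    and "\<And>v. v \<in> V \<Longrightarrow> w0 \<le> w v"
    and "\<And>V'. V' \<subseteq> V \<Longrightarrow> u \<in> V' \<Longrightarrow> card (V - V') * w0 \<le> max 0 (j + w0) \<Longrightarrow>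
           \<beta> \<le> prob_heavy P w V' {u} y"
  shows "prob_heavy P w (V - {u}) A j * \<beta> \<le> prob_heavy P w V (insert u A) (j + y)"
proof -
  have "finite V" using assms fin by (auto intro: finite_subset)
  then show ?thesis
    using assms
  proof (induction V arbitrary: A j rule: finite_psubset_induct)
    case (psubset V)
    note prems = psubset.prems
    show ?case
    proof (cases "j \<le> 0")
      case True
      have "prob_heavy P w (V - {u}) A j * \<beta> \<le> 1 * \<beta>"
        using prems prob_heavy_bounds(2)[of "V - {u}" A j] by (intro mult_right_mono) auto
      also have "\<dots> \<le> prob_heavy P w V {u} y"
        using prems(7)[of V] prems(2) by simp
      also have "\<dots> \<le> prob_heavy P w V (insert u A) (j + y)"
        using prems True by (intro prob_heavy_mono) auto
      finally show ?thesis .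
    next
      case False
      show ?thesis
      proof (cases "A = {}")
        case True
        have "prob_heavy P w (V - {u}) A j = bern (pairs (V - {u})) P (\<lambda>_. 0)"
          unfolding prob_heavy_def using True False by (intro bern_cong) auto
        then have "prob_heavy P w (V - {u}) A j = 0"
          using psubset by (simp add: bern_const finite_pairs)
        then show ?thesis
          using prob_heavy_bounds(1)[OF prems(1)] by simp
      next
        case nonempty: False
        then obtain a where a: "a \<in> A" by auto
        have aV: "a \<in> V" "a \<noteq> u" using a prems by auto
        let ?V = "V - {a}" and ?W = "V - {u} - {a}"
        define g where "g N = prob_heavy P w ?W (A - {a} \<union> N) (j - w a) * \<beta>" for N
        have edge: "0 \<le> P {a, i} \<and> P {a, i} \<le> 1" if "i \<in> ?V" for i
          using that aV prems by (intro P_edge) auto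
        \<comment> \<open>An edge from \<open>a\<close> to \<open>u\<close> is ignored:
          \<open>u\<close> is a seed anyway, and the exploration on the left-hand side takes place
          without \<open>u\<close>.\<close>
        have step: "g (N \<inter> ?W) \<le> prob_heavy P w ?V (insert u A - {a} \<union> N) (j + y - w a)"
          if N: "N \<subseteq> ?V" for N
        proof -
          have eq: "?W = ?V - {u}" by auto
          have eq2: "insert u A - {a} \<union> N = insert u (A - {a} \<union> N \<inter> ?W)" if "u \<in> N \<or> u \<notin> N"
            using N aV prems(3) by auto
          have "g (N \<inter> ?W) \<le> prob_heavy P w ?V (insert u (A - {a} \<union> N \<inter> ?W)) ((j - w a) + y)"
            unfolding g_def eq
          proof (rule psubset.IH)
            \<comment> \<open>A vertex is explored only while weight is still missing, and each
              weighs at least \<open>w0\<close>; so all explored vertices but the last account for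
              less than \<open>j\<close>, whence \<open>j + w0\<close>. The maximum with 0 admits
              \<open>V' = V\<close> when the remaining level is below \<open>- w0\<close>.\<close>
            fix V' assume V': "V' \<subseteq> ?V" "u \<in> V'" "card (?V - V') * w0 \<le> max 0 (j - w a + w0)"
            have "V - V' = insert a (?V - V')" using V' aV by auto
            moreover have "a \<notin> ?V - V'" "finite (?V - V')" using psubset by auto
            ultimately have "card (V - V') = Suc (card (?V - V'))" by simp
            then have "card (V - V') * w0 \<le> max 0 (j + w0)"
              using V'(3) prems(6)[OF aV(1)] prems(5) False by (auto simp: algebra_simps max_def split: if_splits)
            then show "\<beta> \<le> prob_heavy P w V' {u} y"
              using V' by (intro prems(7)) auto
          qed (use prems N aV in auto)
          then show ?thesis using eq2 by (simp add: algebra_simps)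
        qed
        have "prob_heavy P w (V - {u}) A j * \<beta> = bern ?W (\<lambda>j. P {a, j}) g"
          using psubset.hyps a prems
          by (subst prob_heavy_explore[of _ a]) (auto simp: g_def[abs_def] bern_cmult[symmetric] mult.commute)
        also have "\<dots> = bern ?V (\<lambda>j. P {a, j}) (\<lambda>N. g (N \<inter> ?W))"
          using psubset.hyps by (intro bern_marginal[symmetric]) auto
        also have "\<dots> \<le> bern ?V (\<lambda>j. P {a, j}) (\<lambda>N. prob_heavy P w ?V (insert u A - {a} \<union> N) (j + y - w a))"
          by (intro bern_mono step edge)
        also have "\<dots> = prob_heavy P w V (insert u A) (j + y)"
          using psubset.hyps a prems
          by (subst prob_heavy_explore[of _ a]) auto
        finally show ?thesis .
      qed
    qed
  qed
qed

text \<open>Exploring the cluster of \<open>A\<close> reveals nothing about the edges among the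
  other vertices, so a bound on the probability that the rest is light, uniform over the possible
  remainders, factors out. The weight bound \<open>s\<close> drops by \<open>w a\<close> at every
  explored vertex and thereby restricts which remainders \<open>V'\<close> can occur.\<close>

lemma bern_light_peel:
  assumes "V \<subseteq> U" "A \<subseteq> V" "\<beta> \<ge> 0"
    and "\<And>V'. V' \<subseteq> V \<Longrightarrow> sum w (V - V') < s \<Longrightarrow> bern (pairs V') P (\<lambda>H. of_bool (all_light w x V' H)) \<le> \<beta>"
  shows "bern (pairs V) P (\<lambda>H. of_bool (sum w (reach H A) < s \<and>
           all_light w x (V - reach H A) {e\<in>H. e \<inter> reach H A = {}}))
         \<le> \<beta> * bern (pairs V) P (\<lambda>H. of_bool (sum w (reach H A) < s))"
proof -
  have "finite V" using assms fin by (auto intro: finite_subset)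
  then show ?thesis
    using assms
  proof (induction V arbitrary: A s rule: finite_psubset_induct)
    case (psubset V)
    note prems = psubset.prems
    show ?case
    proof (cases "A = {}")
      case True
      have "bern (pairs V) P (\<lambda>H. of_bool (0 < s \<and> all_light w x V H)) \<le> \<beta> * of_bool (0 < s)"
        using prems(4)[of V] psubset.hyps
        by (cases "0 < s") (auto simp: bern_const finite_pairs)
      then show ?thesis
        using True psubset.hyps by (simp add: bern_const finite_pairs)
    next
      case False
      then obtain a where a: "a \<in> A" by auto
      then have aV: "a \<in> V" using prems by auto
      let ?V = "V - {a}"
      have edge: "0 \<le> P {a, i} \<and> P {a, i} \<le> 1" if "i \<in> ?V" for i
        using that aV prems by (intro P_edge) auto
      have "bern (pairs V) P (\<lambda>H. of_bool (sum w (reach H A) < s \<and>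
             all_light w x (V - reach H A) {e\<in>H. e \<inter> reach H A = {}})) =
           bern ?V (\<lambda>j. P {a, j}) (\<lambda>N. bern (pairs ?V) P (\<lambda>H.
             of_bool (sum w (reach H (A - {a} \<union> N)) < s - w a \<and>
             all_light w x (?V - reach H (A - {a} \<union> N)) {e\<in>H. e \<inter> reach H (A - {a} \<union> N) = {}})))"
        unfolding bern_explore[OF psubset.hyps a prems(2), of P "\<lambda>C H. of_bool (sum w C < s \<and> all_light w x (V - C) H)"]
      proof (intro bern_cong refl)
        fix N H assume N: "N \<subseteq> ?V" and H: "H \<subseteq> pairs ?V"
        let ?R = "reach H (A - {a} \<union> N)"
        have "?R \<subseteq> ?V" using N H prems by (intro reach_subset) auto
        then have "sum w (insert a ?R) = w a + sum w ?R"
          using psubset.hyps by (subst sum.insert) (auto intro: finite_subset)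
        moreover have "V - insert a ?R = ?V - ?R" by auto
        ultimately show "of_bool (sum w (insert a ?R) < s \<and> all_light w x (V - insert a ?R) {e\<in>H. e \<inter> ?R = {}}) =
          (of_bool (sum w ?R < s - w a \<and> all_light w x (?V - ?R) {e\<in>H. e \<inter> ?R = {}}) :: real)"
          by (simp add: algebra_simps)
      qed
      also have "\<dots> \<le> bern ?V (\<lambda>j. P {a, j}) (\<lambda>N. \<beta> * bern (pairs ?V) P (\<lambda>H.
             of_bool (sum w (reach H (A - {a} \<union> N)) < s - w a)))"
      proof (intro bern_mono edge psubset.IH)
        fix N V' assume V': "V' \<subseteq> ?V" "sum w (?V - V') < s - w a"
        have "V - V' = insert a (?V - V')" using V' aV by auto
        then have "sum w (V - V') = w a + sum w (?V - V')"
          using psubset.hyps by (simp add: sum.insert_remove)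
        then show "bern (pairs V') P (\<lambda>H. of_bool (all_light w x V' H)) \<le> \<beta>"
          using V' by (intro prems(4)) auto
      qed (use prems aV in auto)
      also have "\<dots> = \<beta> * bern (pairs V) P (\<lambda>H. of_bool (sum w (reach H A) < s))"
        unfolding bern_cmult bern_explore_sum[OF psubset.hyps a prems(2), of P "\<lambda>x. of_bool (x < s)" w]
        by (simp add: algebra_simps)
      finally show ?thesis .
    qed
  qed
qed

lemma bern_light_step:
  assumes "V \<subseteq> U" "v \<in> V" "\<beta> \<ge> 0"
    and "\<And>V'. V' \<subseteq> V \<Longrightarrow> sum w (V - V') < x \<Longrightarrow> bern (pairs V') P (\<lambda>H. of_bool (all_light w x V' H)) \<le> \<beta>"
  shows "bern (pairs V) P (\<lambda>H. of_bool (all_light w x V H)) \<le> \<beta> * (1 - prob_heavy P w V {v} x)"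
proof -
  have fV: "finite V" using assms fin by (auto intro: finite_subset)
  have "bern (pairs V) P (\<lambda>H. of_bool (all_light w x V H)) \<le> bern (pairs V) P (\<lambda>H. of_bool (sum w (reach H {v}) < x \<and>
           all_light w x (V - reach H {v}) {e\<in>H. e \<inter> reach H {v} = {}}))"
  proof (intro bern_mono P_pairs[OF assms(1)])
    fix H assume H: "H \<subseteq> pairs V"
    have "sum w (reach {e\<in>H. e \<inter> reach H {v} = {}} {u}) \<le> sum w (reach H {u})" if "u \<in> V" for u
      using H that assms by (intro sum_reach_mono[of V]) auto
    then show "of_bool (all_light w x V H) \<le> (of_bool (sum w (reach H {v}) < x \<and>
           all_light w x (V - reach H {v}) {e\<in>H. e \<inter> reach H {v} = {}}) :: real)"
      using assms(2) by (force simp: all_light_def)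
  qed
  also have "\<dots> \<le> \<beta> * bern (pairs V) P (\<lambda>H. of_bool (sum w (reach H {v}) < x))"
    using assms by (intro bern_light_peel) auto
  also have "bern (pairs V) P (\<lambda>H. of_bool (sum w (reach H {v}) < x)) =
      bern (pairs V) P (\<lambda>H. 1 - of_bool (x \<le> sum w (reach H {v})))"
    by (intro bern_cong) auto
  also have "\<dots> = 1 - prob_heavy P w V {v} x"
    using fV by (simp add: bern_diff bern_const finite_pairs prob_heavy_def)
  finally show ?thesis .
qed

text \<open>Each round explores the cluster of a suitable vertex. If it is light, less than
  \<open>x\<close> of weight is removed, so every remainder met within \<open>r\<close> rounds is
  covered by the assumption, and each round fails with probability at most \<open>1 - q\<close>
  whatever happened before.\<close>

lemma bern_light_iterate:
  assumes "V \<subseteq> U" "0 \<le> q" "q \<le> 1" "0 \<le> x"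
    and "\<And>V'. V' \<subseteq> V \<Longrightarrow> sum w (V - V') \<le> real r * x \<Longrightarrow> \<exists>v\<in>V'. q \<le> prob_heavy P w V' {v} x"
  shows "bern (pairs V) P (\<lambda>H. of_bool (all_light w x V H)) \<le> (1 - q) ^ r"
  using assms
proof (induction r arbitrary: V)
  case 0
  have "bern (pairs V) P (\<lambda>H. of_bool (all_light w x V H)) \<le> bern (pairs V) P (\<lambda>_. 1)"
    using 0 by (intro bern_mono P_pairs[of V]) auto
  then show ?case
    using finite_subset[OF 0(1) fin] by (simp add: bern_const finite_pairs)
next
  case (Suc r)
  obtain v where v: "v \<in> V" "q \<le> prob_heavy P w V {v} x"
    using Suc.prems(5)[of V] Suc.prems(4) by auto
  have fV: "finite V" using Suc.prems fin by (auto intro: finite_subset)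
  have "bern (pairs V) P (\<lambda>H. of_bool (all_light w x V H)) \<le> (1 - q) ^ r * (1 - prob_heavy P w V {v} x)"
  proof (intro bern_light_step Suc.prems v)
    fix V' assume V': "V' \<subseteq> V" "sum w (V - V') < x"
    show "bern (pairs V') P (\<lambda>H. of_bool (all_light w x V' H)) \<le> (1 - q) ^ r"
    proof (intro Suc.IH Suc.prems(2-4))
      fix V'' assume V'': "V'' \<subseteq> V'" "sum w (V' - V'') \<le> real r * x"
      have "V - V'' = (V - V') \<union> (V' - V'')" "finite V'"
        using V' V'' fV by (auto intro: finite_subset)
      moreover have "sum w ((V - V') \<union> (V' - V'')) = sum w (V - V') + sum w (V' - V'')"
        using fV \<open>finite V'\<close> by (intro sum.union_disjoint) auto
      ultimately have "sum w (V - V'') = sum w (V - V') + sum w (V' - V'')"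
        by simp
      then have "sum w (V - V'') \<le> real (Suc r) * x"
        using V' V'' by (simp add: algebra_simps)
      then show "\<exists>v\<in>V''. q \<le> prob_heavy P w V'' {v} x"
        using Suc.prems(5)[of V''] V' V'' by auto
    qed (use V' Suc.prems in auto)
  qed (use Suc.prems in auto)
  also have "\<dots> \<le> (1 - q) ^ r * (1 - q)"
    using v Suc.prems by (intro mult_left_mono) auto
  finally show ?case by (simp add: mult.commute)
qed

end

section \<open>Graphs with finitely many vertex types\<close>

text \<open>An edge is an unordered set, so its endpoints are recovered as minimum and maximum, the
  order \<open>i < j\<close> of \<open>inhom_random_graph\<close>; the kernel being symmetric, the
  value does not depend on that order.\<close>

definition eprob :: "real \<Rightarrow> (real \<Rightarrow> real) \<Rightarrow> nat \<Rightarrow> (nat \<Rightarrow> real) \<Rightarrow> nat set \<Rightarrow> real" where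
  "eprob c \<psi> n t e = edge_prob (rank1_kernel c \<psi>) n (t (Min e)) (t (Max e))"

lemma eprob_pair: "eprob c \<psi> n t {i, j} = min (c * \<psi> (t i) * \<psi> (t j) / n) 1"
  by (cases "i \<le> j") (auto simp: eprob_def edge_prob_def rank1_kernel_def max_def min_def mult_ac)

lemma eprob_bounds:
  assumes "c > 0" "\<And>i. i \<in> V \<Longrightarrow> \<psi> (t i) > 0" "e \<in> pairs V"
  shows "0 \<le> eprob c \<psi> n t e \<and> eprob c \<psi> n t e \<le> 1"
proof -
  obtain i j where "e = {i, j}" "i \<in> V" "j \<in> V" using assms(3) by (auto simp: pairs_def)
  then show ?thesis using assms(1) assms(2)[of i] assms(2)[of j] by (simp add: eprob_pair)
qed

text \<open>
  \<open>gen_fun\<close> is the generating function at \<open>z\<close> of the total weight of the first \<open>d\<close> generations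
  of the branching process restricted to types in \<open>T\<close>; \<open>m y\<close> stands for \<open>\<mu>(y)\<close>.
\<close>

primrec gen_fun ::
  "(real \<Rightarrow> real) \<Rightarrow> (real \<Rightarrow> real) \<Rightarrow> real \<Rightarrow> real \<Rightarrow> real set \<Rightarrow> nat \<Rightarrow> real \<Rightarrow> real" where
  "gen_fun \<psi> m c z T 0 u = 1"
| "gen_fun \<psi> m c z T (Suc d) u =
     z powr \<psi> u * exp (c * \<psi> u * (\<Sum>y\<in>T. \<psi> y * m y * (gen_fun \<psi> m c z T d y - 1)))"

lemma gen_fun_ge_1:
  assumes "z \<ge> 1" "c > 0" "\<And>y. y \<in> T \<Longrightarrow> \<psi> y > 0" "\<And>y. y \<in> T \<Longrightarrow> m y \<ge> 0" "\<psi> u > 0"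
  shows "gen_fun \<psi> m c z T d u \<ge> 1"
  using assms(5)
proof (induction d arbitrary: u)
  case (Suc d)
  have "1 * 1 \<le> z powr \<psi> u * exp (c * \<psi> u * (\<Sum>y\<in>T. \<psi> y * m y * (gen_fun \<psi> m c z T d y - 1)))"
    using assms Suc
    by (intro mult_mono) (auto intro!: ge_one_powr_ge_zero mult_nonneg_nonneg sum_nonneg simp: less_imp_le)
  then show ?case by simp
qed simp

locale finite_types =
  fixes \<psi> m :: "real \<Rightarrow> real" and c :: real and T :: "real set"
  assumes finite_T: "finite T" and c_pos: "c > 0"
    and \<psi>_pos: "\<And>y. y \<in> T \<Longrightarrow> \<psi> y > 0" and m_nonneg: "\<And>y. y \<in> T \<Longrightarrow> m y \<ge> 0"
begin

text \<open>The slack \<open>s\<close> is a budget of vertices that may still be removed while each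
  type keeps its proportion above \<open>m k - \<eta>\<close>. Counts are bounded from below only,
  as additional vertices make clusters larger.\<close>

definition many :: "real \<Rightarrow> real \<Rightarrow> nat \<Rightarrow> nat set \<Rightarrow> (nat \<Rightarrow> real) \<Rightarrow> bool" where
  "many \<eta> s n V t \<longleftrightarrow> V \<subseteq> {1..n} \<and> t ` V \<subseteq> T \<and>
     (\<forall>k\<in>T. real n * (m k - \<eta>) + s \<le> card {i\<in>V. t i = k})"

lemma many_finite: "many \<eta> s n V t \<Longrightarrow> finite V"
  by (auto simp: many_def intro: finite_subset)

lemma many_type: "many \<eta> s n V t \<Longrightarrow> i \<in> V \<Longrightarrow> t i \<in> T"
  by (auto simp: many_def)

text \<open>The removed vertices are paid for from the slack or by enlarging \<eta>; in the worst
  case they all have the same type.\<close>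

lemma many_Diff:
  assumes "many \<eta> s n V t" "V' \<subseteq> V" "real (card (V - V')) \<le> r" "real n * \<eta> + s' + r \<le> real n * \<eta>' + s"
  shows "many \<eta>' s' n V' t"
  unfolding many_def
proof (intro conjI ballI)
  fix k assume k: "k \<in> T"
  have fin: "finite V" using assms(1) by (rule many_finite)
  have "card {i\<in>V. t i = k} \<le> card ({i\<in>V'. t i = k} \<union> (V - V'))"
    using fin assms(2) by (intro card_mono) (auto intro: finite_subset)
  also have "\<dots> \<le> card {i\<in>V'. t i = k} + card (V - V')"
    by (rule card_Un_le)
  finally have "real (card {i\<in>V. t i = k}) \<le> real (card {i\<in>V'. t i = k}) + r"
    using assms(3) by linarith
  moreover have "real n * (m k - \<eta>) + s \<le> card {i\<in>V. t i = k}"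
    using assms(1) k by (auto simp: many_def)
  ultimately show "real n * (m k - \<eta>') + s' \<le> card {i\<in>V'. t i = k}"
    using assms(4) by (simp add: right_diff_distrib)
qed (use assms in \<open>auto simp: many_def\<close>)

lemma many_edge_bounds:
  "many \<eta> s n V t \<Longrightarrow> e \<in> pairs V \<Longrightarrow> 0 \<le> eprob c \<psi> n t e \<and> eprob c \<psi> n t e \<le> 1"
  by (rule eprob_bounds[OF c_pos]) (auto intro: \<psi>_pos many_type)

lemma bounded_on_types:
  obtains B where "B \<ge> 1" "\<And>y. y \<in> T \<Longrightarrow> f y \<le> (B :: real)"
proof -
  have "bdd_above (f ` T)" using finite_T by simp
  then obtain B where "\<forall>y\<in>T. f y \<le> B"
    by (auto simp: bdd_above_def)
  then have "\<And>y. y \<in> T \<Longrightarrow> f y \<le> max 1 B" by force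
  then show ?thesis using that[of "max 1 B"] by auto
qed

lemma one_plus_ge_exp: "0 \<le> x \<Longrightarrow> x \<le> 1 \<Longrightarrow> exp (x - x\<^sup>2) \<le> 1 + (x :: real)"
  using ln_one_plus_pos_lower_bound[of x] ln_ge_iff[of "1 + x" "x - x\<^sup>2"] by auto

text \<open>
  The factor \<open>of_bool (card N \<le> R)\<close> costs at most \<open>2\<^sup>-\<^sup>R\<close> times the expectation of the product
  with \<open>2 h\<close> in place of \<open>h\<close>.
\<close>

lemma offspring_lower_bound:
  assumes h: "\<And>y. y \<in> T \<Longrightarrow> h y \<ge> 1" and eps: "\<epsilon> > 0"
  shows "\<exists>\<eta>>0. \<exists>R n0. \<forall>n\<ge>n0. \<forall>V t k. many \<eta> 0 n V t \<longrightarrow> k \<in> T \<longrightarrow>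
    (1 - \<epsilon>) * exp (c * \<psi> k * (\<Sum>y\<in>T. \<psi> y * m y * (h y - 1))) \<le>
    bern V (\<lambda>j. min (c * \<psi> k * \<psi> (t j) / n) 1) (\<lambda>N. of_bool (card N \<le> R) * (\<Prod>j\<in>N. h (t j)))"
proof -
  obtain B1 where B1: "B1 \<ge> 1" "\<And>y. y \<in> T \<Longrightarrow> \<psi> y \<le> B1" using bounded_on_types[where f = \<psi>] by blast
  obtain B2 where B2: "B2 \<ge> 1" "\<And>y. y \<in> T \<Longrightarrow> h y \<le> B2" using bounded_on_types[where f = h] by blast
  \<comment> \<open>\<open>D / n\<close> bounds \<open>p j * (h (t j) - 1)\<close> for every vertex
    \<open>j\<close>. The loss \<epsilon> is spent in three equal parts: on type counts that are
    short by \<eta>, on the square in \<open>1 + x \<ge> exp (x - x^2)\<close>, and on the event of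
    more than \<open>R\<close> neighbours.\<close>
  define D where "D = c * B1 * B1 * B2"
  have D: "D > 0" using c_pos B1 B2 by (simp add: D_def)
  have cB: "c * B1 * B1 \<le> D" using B2 c_pos B1 by (simp add: D_def)
  define \<eta> where "\<eta> = \<epsilon> / (3 * D * (real (card T) + 1))"
  have \<eta>: "\<eta> > 0" using eps D by (simp add: \<eta>_def)
  obtain R :: nat where R: "(1/2) ^ R < \<epsilon> / 3 / exp (2 * D)"
    using real_arch_pow_inv[of "\<epsilon> / 3 / exp (2 * D)" "1/2"] eps by auto
  then have R': "(1/2) ^ R * exp (2 * D) \<le> \<epsilon> / 3"
    by (simp only: pos_less_divide_eq[OF exp_gt_zero] less_imp_le)
  obtain n0 :: nat where n0: "real n0 \<ge> D + 3 * D\<^sup>2 / \<epsilon> + 1"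
    using real_arch_simple by blast
  show ?thesis
  proof (rule exI[of _ \<eta>], intro conjI \<eta>, rule exI[of _ R], rule exI[of _ n0], intro allI impI)
    fix n V t k assume n: "n \<ge> n0" and V: "many \<eta> 0 n V t" and k: "k \<in> T"
    have "real n \<ge> real n0" using n by simp
    moreover have "3 * D\<^sup>2 / \<epsilon> \<ge> 0" using D eps by simp
    ultimately have nD: "real n \<ge> D" "real n \<ge> 1" "real n \<ge> 3 * D\<^sup>2 / \<epsilon>"
      using n0 D by linarith+
    define L where "L = c * \<psi> k * (\<Sum>y\<in>T. \<psi> y * m y * (h y - 1))"
    define p where "p j = c * \<psi> k * \<psi> (t j) / n" for j
    have fin: "finite V" using V by (rule many_finite)
    have tT: "t j \<in> T" if "j \<in> V" for j using many_type[OF V that] .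
    have cardV: "card V \<le> n" using V card_mono[of "{1..n}" V] by (auto simp: many_def)
    have p: "0 \<le> p j" "p j \<le> c * B1 * B1 / n" if "j \<in> V" for j
    proof -
      show "0 \<le> p j" using \<psi>_pos[OF k] \<psi>_pos[OF tT[OF that]] c_pos by (simp add: p_def)
      have "c * \<psi> k * \<psi> (t j) \<le> c * B1 * B1"
        using \<psi>_pos[OF k] \<psi>_pos[OF tT[OF that]] c_pos B1 k tT[OF that] by (intro mult_mono) auto
      then show "p j \<le> c * B1 * B1 / n" unfolding p_def by (intro divide_right_mono) auto
    qed
    have pD: "p j \<le> 1" if "j \<in> V" for j
    proof -
      have "p j \<le> D / n" using p(2)[OF that] divide_right_mono[OF cB, of "real n"] by simp
      also have "\<dots> \<le> 1" using nD by simp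
      finally show ?thesis .
    qed
    have minp: "min (c * \<psi> k * \<psi> (t j) / n) 1 = p j" if "j \<in> V" for j
      using pD[OF that] by (simp add: p_def)
    define x where "x j = p j * (h (t j) - 1)" for j
    have x: "0 \<le> x j" "x j \<le> D / n" "p j * (2 * h (t j) - 1) \<le> 2 * D / n" if "j \<in> V" for j
    proof -
      show "0 \<le> x j" using p[OF that] h[OF tT[OF that]] by (simp add: x_def)
      have "x j \<le> c * B1 * B1 / n * B2"
        unfolding x_def using p[OF that] h[OF tT[OF that]] B2(2)[OF tT[OF that]] c_pos B1
        by (intro mult_mono) auto
      then show "x j \<le> D / n" by (simp add: D_def)
      have "p j * (2 * h (t j) - 1) \<le> c * B1 * B1 / n * (2 * B2)"
        using p[OF that] h[OF tT[OF that]] B2(2)[OF tT[OF that]] c_pos B1 by (intro mult_mono) auto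
      then show "p j * (2 * h (t j) - 1) \<le> 2 * D / n" by (simp add: D_def mult_ac)
    qed
    have "(\<Sum>j\<in>V. x j) = (\<Sum>y\<in>T. \<Sum>j\<in>{j\<in>V. t j = y}. x j)"
      using V finite_T fin by (intro sum.group[symmetric]) (auto simp: many_def)
    also have "\<dots> = (\<Sum>y\<in>T. real (card {j\<in>V. t j = y}) * (c * \<psi> k * \<psi> y / n * (h y - 1)))"
      by (intro sum.cong) (auto simp: x_def p_def)
    also have "\<dots> \<ge> (\<Sum>y\<in>T. (real n * (m y - \<eta>)) * (c * \<psi> k * \<psi> y / n * (h y - 1)))"
      using V h \<psi>_pos k c_pos
      by (intro sum_mono mult_right_mono) (auto simp: many_def less_imp_le)
    also have "(\<Sum>y\<in>T. (real n * (m y - \<eta>)) * (c * \<psi> k * \<psi> y / n * (h y - 1)))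
       = L - (\<Sum>y\<in>T. \<eta> * (c * \<psi> k * \<psi> y * (h y - 1)))"
      unfolding L_def sum_distrib_left sum_subtractf[symmetric]
      using nD by (intro sum.cong) (auto simp: field_simps)
    also have "\<dots> \<ge> L - (\<Sum>y\<in>T. \<eta> * D)"
    proof (intro diff_left_mono sum_mono mult_left_mono)
      fix y assume y: "y \<in> T"
      show "c * \<psi> k * \<psi> y * (h y - 1) \<le> D"
        unfolding D_def using y k B1 B2(2)[OF y] \<psi>_pos[OF y] \<psi>_pos[OF k] c_pos h[OF y]
        by (intro mult_mono) auto
    qed (use \<eta> in auto)
    finally have sumx: "L - \<eta> * D * card T \<le> (\<Sum>j\<in>V. x j)" by (simp add: mult_ac)
    have "(\<Sum>j\<in>V. (x j)\<^sup>2) \<le> (\<Sum>j\<in>V. (D / n)\<^sup>2)"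
      using x by (intro sum_mono power_mono) auto
    also have "\<dots> \<le> real n * (D / n)\<^sup>2"
      using cardV by (simp add: mult_right_mono)
    also have "\<dots> = D\<^sup>2 / n" using nD by (simp add: power2_eq_square)
    also have "\<dots> \<le> \<epsilon> / 3"
      using nD eps by (simp add: field_simps)
    finally have sumx2: "(\<Sum>j\<in>V. (x j)\<^sup>2) \<le> \<epsilon> / 3" .
    have "\<eta> * D = \<epsilon> / (3 * (real (card T) + 1))"
      using D by (simp add: \<eta>_def)
    then have "\<eta> * D * card T = \<epsilon> / 3 * (card T / (real (card T) + 1))"
      by simp
    also have "\<dots> \<le> \<epsilon> / 3 * 1" using eps by (intro mult_left_mono) auto
    finally have "\<eta> * D * card T \<le> \<epsilon> / 3" by simp
    with sumx sumx2 have "L - 2 * \<epsilon> / 3 \<le> (\<Sum>j\<in>V. x j - (x j)\<^sup>2)"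
      by (simp add: sum_subtractf)
    then have "exp (L - 2 * \<epsilon> / 3) \<le> exp (\<Sum>j\<in>V. x j - (x j)\<^sup>2)" by simp
    also have "\<dots> = (\<Prod>j\<in>V. exp (x j - (x j)\<^sup>2))" by (rule exp_sum[OF fin])
    also have "\<dots> \<le> (\<Prod>j\<in>V. 1 + x j)"
    proof (intro prod_mono conjI one_plus_ge_exp)
      fix j assume j: "j \<in> V"
      have "D / n \<le> 1" using nD by simp
      then show "x j \<le> 1" using x(2)[OF j] by linarith
    qed (use x in auto)
    finally have main: "exp (L - 2 * \<epsilon> / 3) \<le> (\<Prod>j\<in>V. 1 + x j)" .
    have L0: "L \<ge> 0"
      unfolding L_def using h \<psi>_pos k c_pos m_nonneg
      by (intro mult_nonneg_nonneg sum_nonneg) (auto simp: less_imp_le)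
    have "(1 - 2 * \<epsilon> / 3) * exp L \<le> exp (- (2 * \<epsilon> / 3)) * exp L"
      using exp_ge_add_one_self[of "- (2 * \<epsilon> / 3)"] by (intro mult_right_mono) auto
    also have "\<dots> = exp (L - 2 * \<epsilon> / 3)" by (simp add: exp_add[symmetric])
    finally have main2: "(1 - 2 * \<epsilon> / 3) * exp L \<le> (\<Prod>j\<in>V. 1 + x j)" using main by linarith
    have "(\<Prod>j\<in>V. 1 + p j * (2 * h (t j) - 1)) \<le> (\<Prod>j\<in>V. exp (2 * D / n))"
    proof (intro prod_mono conjI)
      fix j assume j: "j \<in> V"
      show "0 \<le> 1 + p j * (2 * h (t j) - 1)" using p[OF j] h[OF tT[OF j]] by simp
      show "1 + p j * (2 * h (t j) - 1) \<le> exp (2 * D / n)"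
        using x(3)[OF j] exp_ge_add_one_self[of "2 * D / n"] by linarith
    qed
    also have "\<dots> = exp (2 * D / n * card V)" by (simp add: exp_of_nat_mult[symmetric] mult.commute)
    also have "\<dots> \<le> exp (2 * D)"
      using cardV D nD by (simp add: field_simps)
    finally have tail: "(\<Prod>j\<in>V. 1 + p j * (2 * h (t j) - 1)) \<le> exp (2 * D)" .
    have pb: "0 \<le> p e \<and> p e \<le> 1" if "e \<in> V" for e using p[OF that] pD[OF that] by auto
    \<comment> \<open>\<open>exp L \<ge> 1\<close> turns the additive error
      \<open>\<epsilon> / 3\<close> into a relative one.\<close>
    have "(1 - \<epsilon>) * exp L \<le> (1 - 2 * \<epsilon> / 3) * exp L - \<epsilon> / 3"
      using L0 eps mult_left_mono[of 1 "exp L" "\<epsilon> / 3"] by (simp add: algebra_simps)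
    also have "\<dots> \<le> (\<Prod>j\<in>V. 1 + x j) - (1/2) ^ R * exp (2 * D)"
      using main2 R' by linarith
    also have "\<dots> \<le> (\<Prod>j\<in>V. 1 + x j) - (1/2) ^ R * (\<Prod>j\<in>V. 1 + p j * (2 * h (t j) - 1))"
      using tail by (intro diff_left_mono mult_left_mono) auto
    also have "\<dots> = bern V p (\<lambda>N. (\<Prod>j\<in>N. h (t j)) - (1/2) ^ R * (\<Prod>j\<in>N. 2 * h (t j)))"
      unfolding bern_diff bern_cmult bern_prod[OF fin] by (simp add: x_def)
    also have "\<dots> \<le> bern V p (\<lambda>N. of_bool (card N \<le> R) * (\<Prod>j\<in>N. h (t j)))"
    proof (intro bern_mono pb)
      fix N assume N: "N \<subseteq> V"
      have nonneg: "0 \<le> (\<Prod>j\<in>N. h (t j))"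
        using h tT N by (intro prod_nonneg) (auto intro: order_trans[OF zero_le_one])
      show "(\<Prod>j\<in>N. h (t j)) - (1/2) ^ R * (\<Prod>j\<in>N. 2 * h (t j)) \<le> of_bool (card N \<le> R) * (\<Prod>j\<in>N. h (t j))"
      proof (cases "card N \<le> R")
        case False
        then have "(1::real) \<le> (1/2) ^ R * 2 ^ card N"
          using power_increasing[of R "card N" "2::real"] by (simp add: field_simps)
        then have "1 * (\<Prod>j\<in>N. h (t j)) \<le> (1/2) ^ R * 2 ^ card N * (\<Prod>j\<in>N. h (t j))"
          using nonneg by (rule mult_right_mono)
        then show ?thesis using False by (simp add: prod.distrib mult_ac)
      qed (use nonneg in \<open>auto simp: prod.distrib\<close>)
    qed
    also have "\<dots> = bern V (\<lambda>j. min (c * \<psi> k * \<psi> (t j) / n) 1) (\<lambda>N. of_bool (card N \<le> R) * (\<Prod>j\<in>N. h (t j)))"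
      by (intro bern_cong) (auto simp: minp)
    finally show "(1 - \<epsilon>) * exp (c * \<psi> k * (\<Sum>y\<in>T. \<psi> y * m y * (h y - 1))) \<le>
      bern V (\<lambda>j. min (c * \<psi> k * \<psi> (t j) / n) 1) (\<lambda>N. of_bool (card N \<le> R) * (\<Prod>j\<in>N. h (t j)))"
      by (simp add: L_def)
  qed
qed

text \<open>The cap confines the expectation to weights below a bound that does not depend on
  \<open>n\<close>; this yields later a level \<open>j\<close> from a fixed finite range.\<close>

definition capped :: "real \<Rightarrow> nat \<Rightarrow> (nat \<Rightarrow> real) \<Rightarrow> nat set \<Rightarrow> nat set \<Rightarrow> real \<Rightarrow> real" where
  "capped z n t V A K =
     bern (pairs V) (eprob c \<psi> n t) (\<lambda>H. z powr min K (\<Sum>i\<in>reach H A. \<psi> (t i)))"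

lemma capped_nonneg: "many \<eta> s n V t \<Longrightarrow> 0 \<le> capped z n t V A K"
  unfolding capped_def by (intro bern_nonneg many_edge_bounds) auto

lemma capped_mono:
  assumes "many \<eta> s n V t" "z \<ge> 1" "K \<le> K'"
  shows "capped z n t V A K \<le> capped z n t V A K'"
  unfolding capped_def using assms by (intro bern_mono many_edge_bounds[OF assms(1)] powr_mono) auto

abbreviation (input) g where "g z \<equiv> gen_fun \<psi> m c z T"

lemma g_ge_1: "z \<ge> 1 \<Longrightarrow> y \<in> T \<Longrightarrow> g z d y \<ge> 1"
  by (rule gen_fun_ge_1) (auto simp: c_pos \<psi>_pos m_nonneg)

text \<open>
  Exploring one vertex of \<open>D\<close> moves it from \<open>D\<close> to its neighbours, which join \<open>A\<close>: the vertices
  in \<open>D\<close> have one more generation left than those in \<open>A\<close>.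
\<close>

lemma capped_lower_step:
  assumes z: "z > 1"
    and P: "\<And>\<epsilon> R. 0 < \<epsilon> \<Longrightarrow> \<epsilon> < 1 \<Longrightarrow> \<exists>K\<ge>0. \<exists>\<eta>>0. \<exists>n0. \<forall>n\<ge>n0. \<forall>V t A.
      many \<eta> 0 n V t \<longrightarrow> A \<subseteq> V \<longrightarrow> card A \<le> R \<longrightarrow>
      (1 - \<epsilon>) * (\<Prod>a\<in>A. g z d (t a)) \<le> capped z n t V A K"
    and \<epsilon>: "0 < \<epsilon>" "\<epsilon> < 1"
  shows "\<exists>K\<ge>0. \<exists>\<eta>>0. \<exists>n0. \<forall>n\<ge>n0. \<forall>V t A D. many \<eta> 0 n V t \<longrightarrow> A \<subseteq> V \<longrightarrow> D \<subseteq> V \<longrightarrow>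
      A \<inter> D = {} \<longrightarrow> card A \<le> R \<longrightarrow> card D \<le> l \<longrightarrow>
      (1 - \<epsilon>) * ((\<Prod>a\<in>D. g z (Suc d) (t a)) * (\<Prod>a\<in>A. g z d (t a))) \<le> capped z n t V (A \<union> D) K"
  using \<epsilon>
proof (induction l arbitrary: \<epsilon> R)
  case 0
  obtain K \<eta> n0 where *: "K \<ge> 0" "\<eta> > 0" and K: "\<forall>n\<ge>n0. \<forall>V t A.
      many \<eta> 0 n V t \<longrightarrow> A \<subseteq> V \<longrightarrow> card A \<le> R \<longrightarrow>
      (1 - \<epsilon>) * (\<Prod>a\<in>A. g z d (t a)) \<le> capped z n t V A K"
    using P[OF 0, of R] by blast
  show ?case
  proof (rule exI[of _ K], intro conjI *, rule exI[of _ \<eta>], intro conjI *, rule exI[of _ n0], intro allI impI)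
    fix n V t A D assume a: "n \<ge> n0" "many \<eta> 0 n V t" "A \<subseteq> V" "D \<subseteq> V" "card A \<le> R" "card D \<le> 0"
    then have "D = {}" using many_finite[OF a(2)] finite_subset[of D V] by auto
    then show "(1 - \<epsilon>) * ((\<Prod>a\<in>D. g z (Suc d) (t a)) * (\<Prod>a\<in>A. g z d (t a))) \<le> capped z n t V (A \<union> D) K"
      using K a by auto
  qed
next
  case (Suc l)
  \<comment> \<open>Half of the loss is spent on the offspring of one vertex, half on the induction
    hypothesis: \<open>(1 - \<epsilon> / 2)^2 \<ge> 1 - \<epsilon>\<close>.\<close>
  have \<epsilon>2: "0 < \<epsilon> / 2" "\<epsilon> / 2 < 1" using Suc.prems by auto
  obtain \<eta>1 R1 n1 where \<eta>1: "\<eta>1 > 0" and off: "\<forall>n\<ge>n1. \<forall>V t k. many \<eta>1 0 n V t \<longrightarrow> k \<in> T \<longrightarrow>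
    (1 - \<epsilon> / 2) * exp (c * \<psi> k * (\<Sum>y\<in>T. \<psi> y * m y * (g z d y - 1))) \<le>
    bern V (\<lambda>j. min (c * \<psi> k * \<psi> (t j) / n) 1) (\<lambda>N. of_bool (card N \<le> R1) * (\<Prod>j\<in>N. g z d (t j)))"
    using offspring_lower_bound[of "g z d" "\<epsilon> / 2", OF g_ge_1[OF less_imp_le[OF z]] \<epsilon>2(1)] by blast
  obtain K2 \<eta>2 n2 where K2: "K2 \<ge> 0" and \<eta>2: "\<eta>2 > 0" and IH: "\<forall>n\<ge>n2. \<forall>V t A D. many \<eta>2 0 n V t \<longrightarrow>
      A \<subseteq> V \<longrightarrow> D \<subseteq> V \<longrightarrow> A \<inter> D = {} \<longrightarrow> card A \<le> R + R1 \<longrightarrow> card D \<le> l \<longrightarrow>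
      (1 - \<epsilon> / 2) * ((\<Prod>a\<in>D. g z (Suc d) (t a)) * (\<Prod>a\<in>A. g z d (t a))) \<le> capped z n t V (A \<union> D) K2"
    using Suc.IH[OF \<epsilon>2, of "R + R1"] by blast
  obtain B where B: "B \<ge> 1" "\<And>y. y \<in> T \<Longrightarrow> \<psi> y \<le> B" using bounded_on_types[where f = \<psi>] by blast
  \<comment> \<open>\<open>B\<close> bounds the weight of the vertex explored now, so that
    \<open>\<psi> (t a) + min K2 X \<le> min K (\<psi> (t a) + X)\<close>.\<close>
  define K where "K = K2 + B"
  \<comment> \<open>Halving leaves a surplus of \<open>n * \<eta>\<close> vertices of each type,
    which for large \<open>n\<close> covers the at most \<open>R + l + 1\<close> seeds that are
    taken out.\<close>
  define \<eta> where "\<eta> = min \<eta>1 \<eta>2 / 2"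
  have \<eta>: "\<eta> > 0" using \<eta>1 \<eta>2 by (simp add: \<eta>_def)
  obtain n3 :: nat where n3: "real n3 \<ge> (real R + real l + 1) / \<eta>" using real_arch_simple by blast
  have K: "K \<ge> 0" using K2 B by (simp add: K_def)
  show ?case
  proof (rule exI[of _ K], intro conjI K, rule exI[of _ \<eta>], intro conjI \<eta>,
      rule exI[of _ "max n1 (max n2 n3)"], intro allI impI)
    fix n V t A D assume a: "max n1 (max n2 n3) \<le> n" and V: "many \<eta> 0 n V t"
      and AV: "A \<subseteq> V" and DV: "D \<subseteq> V" and disj: "A \<inter> D = {}" and cA: "card A \<le> R" and cD: "card D \<le> Suc l"
    have n: "n1 \<le> n" "n2 \<le> n" "n3 \<le> n" using a by auto
    have "real n3 \<le> real n" using n by simp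
    then have "(real R + real l + 1) / \<eta> \<le> real n" using n3 by linarith
    then have nbig: "real R + real l + 1 \<le> real n * \<eta>" using \<eta> by (simp add: field_simps)
    have fin: "finite V" using V by (rule many_finite)
    have many': "many \<eta>1 0 n V' t" "many \<eta>2 0 n V' t" if "V' \<subseteq> V" "card (V - V') \<le> R + Suc l" for V'
    proof -
      have "2 * \<eta> \<le> \<eta>1" "2 * \<eta> \<le> \<eta>2" by (auto simp: \<eta>_def)
      then have "real n * (2 * \<eta>) \<le> real n * \<eta>1" "real n * (2 * \<eta>) \<le> real n * \<eta>2"
        by (auto intro: mult_left_mono)
      then show "many \<eta>1 0 n V' t" "many \<eta>2 0 n V' t"
        using that nbig by (auto intro!: many_Diff[OF V that(1), of "real R + real l + 1"])
    qed
    show "(1 - \<epsilon>) * ((\<Prod>a\<in>D. g z (Suc d) (t a)) * (\<Prod>a\<in>A. g z d (t a))) \<le> capped z n t V (A \<union> D) K"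
    proof (cases "D = {}")
      case True
      have pr: "0 \<le> (\<Prod>a\<in>A. g z d (t a))"
        using z AV many_type[OF V] by (intro prod_nonneg) (force intro: order_trans[OF zero_le_one g_ge_1])
      have "(1 - \<epsilon>) * (\<Prod>a\<in>A. g z d (t a)) \<le> (1 - \<epsilon> / 2) * (\<Prod>a\<in>A. g z d (t a))"
        using pr Suc.prems by (intro mult_right_mono) auto
      also have "\<dots> \<le> capped z n t V A K2"
        using IH[rule_format, OF n(2) many'(2)[of V], of A "{}"] AV cA by simp
      also have "\<dots> \<le> capped z n t V A K"
        using z B by (intro capped_mono[OF V]) (auto simp: K_def)
      finally show ?thesis using True by simp
    next
      case False
      then obtain a where aD: "a \<in> D" by auto
      then have aV: "a \<in> V" and aA: "a \<notin> A" using DV disj by auto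
      \<comment> \<open>New neighbours are counted only in \<open>?W\<close>, away from all present
        seeds, so that the products over old and new seeds multiply.\<close>
      let ?V = "V - {a}" and ?W = "V - (A \<union> D)" and ?D = "D - {a}"
      have finD: "finite D" "finite A" using DV AV fin by (auto intro: finite_subset)
      have cD': "card ?D \<le> l" using aD finD cD by simp
      have W: "many \<eta>1 0 n ?W t"
      proof (rule many')
        have "V - ?W = A \<union> D" using AV DV by auto
        then show "card (V - ?W) \<le> R + Suc l" using card_Un_le[of A D] cA cD by simp
      qed auto
      have V1: "many \<eta>2 0 n ?V t"
      proof (rule many')
        have "V - ?V = {a}" using aV by auto
        then show "card (V - ?V) \<le> R + Suc l" by simp
      qed auto
      have ta: "t a \<in> T" using many_type[OF V aV] .
      define C where "C = (1 - \<epsilon> / 2) * ((\<Prod>a\<in>?D. g z (Suc d) (t a)) * (\<Prod>a\<in>A. g z d (t a)))"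
      have pr: "0 \<le> (\<Prod>a\<in>X. g z d' (t a))" if "X \<subseteq> V" for X d'
        using z that many_type[OF V] by (intro prod_nonneg) (force intro: order_trans[OF zero_le_one g_ge_1])
      have C0: "0 \<le> C" unfolding C_def using pr[of "D - {a}" "Suc d"] pr[of A d] AV DV Suc.prems
        by (intro mult_nonneg_nonneg) auto
      define F where "F N = of_bool (card N \<le> R1) * (\<Prod>j\<in>N. g z d (t j)) * C" for N
      have edge: "0 \<le> eprob c \<psi> n t {a, j} \<and> eprob c \<psi> n t {a, j} \<le> 1" if "j \<in> ?V" for j
        using that aV by (intro many_edge_bounds[OF V]) (auto simp: pairs_def)
      have step: "F (N \<inter> ?W) \<le> capped z n t ?V (A \<union> D - {a} \<union> N) K2" if N: "N \<subseteq> ?V" for N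
      proof (cases "card (N \<inter> ?W) \<le> R1")
        case True
        have eq: "A \<union> D - {a} \<union> N = (A \<union> (N \<inter> ?W)) \<union> ?D" using N aA by auto
        have finN: "finite (N \<inter> ?W)" using N fin by (auto intro: finite_subset)
        have "F (N \<inter> ?W) = (1 - \<epsilon> / 2) * ((\<Prod>a\<in>?D. g z (Suc d) (t a)) * (\<Prod>a\<in>A \<union> (N \<inter> ?W). g z d (t a)))"
          using True finD finN by (subst prod.union_disjoint) (auto simp: F_def C_def)
        also have "\<dots> \<le> capped z n t ?V ((A \<union> (N \<inter> ?W)) \<union> ?D) K2"
        proof (rule IH[rule_format, OF n(2) V1])
          show "card (A \<union> (N \<inter> ?W)) \<le> R + R1"
            using card_Un_le[of A "N \<inter> ?W"] cA True by linarith
        qed (use AV DV N disj aA cD' in auto)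
        finally show ?thesis unfolding eq .
      next
        case False
        then show ?thesis using capped_nonneg[OF V1] by (simp add: F_def)
      qed
      have "(1 - \<epsilon>) * ((\<Prod>a\<in>D. g z (Suc d) (t a)) * (\<Prod>a\<in>A. g z d (t a))) \<le>
        ((1 - \<epsilon> / 2) * (1 - \<epsilon> / 2)) * ((\<Prod>a\<in>D. g z (Suc d) (t a)) * (\<Prod>a\<in>A. g z d (t a)))"
        using pr[OF DV, of "Suc d"] pr[OF AV, of d] by (intro mult_right_mono) (auto simp: algebra_simps)
      also have "\<dots> = z powr \<psi> (t a) * ((1 - \<epsilon> / 2) *
          exp (c * \<psi> (t a) * (\<Sum>y\<in>T. \<psi> y * m y * (g z d y - 1))) * C)"
        unfolding prod.remove[OF finD(1) aD] by (simp add: C_def mult_ac)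
      also have "\<dots> \<le> z powr \<psi> (t a) * (bern ?W (\<lambda>j. min (c * \<psi> (t a) * \<psi> (t j) / n) 1)
          (\<lambda>N. of_bool (card N \<le> R1) * (\<Prod>j\<in>N. g z d (t j))) * C)"
        using off[rule_format, OF n(1) W ta] C0 by (intro mult_left_mono mult_right_mono) auto
      also have "\<dots> = z powr \<psi> (t a) * bern ?W (\<lambda>j. eprob c \<psi> n t {a, j}) F"
        unfolding F_def eprob_pair by (simp add: bern_cmult mult.commute[of _ C])
      also have "\<dots> = z powr \<psi> (t a) * bern ?V (\<lambda>j. eprob c \<psi> n t {a, j}) (\<lambda>N. F (N \<inter> ?W))"
        using fin aD by (subst bern_marginal) auto
      also have "\<dots> \<le> z powr \<psi> (t a) * bern ?V (\<lambda>j. eprob c \<psi> n t {a, j})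
          (\<lambda>N. capped z n t ?V (A \<union> D - {a} \<union> N) K2)"
        by (intro mult_left_mono bern_mono edge step) auto
      also have "\<dots> = bern ?V (\<lambda>j. eprob c \<psi> n t {a, j}) (\<lambda>N. bern (pairs ?V) (eprob c \<psi> n t)
          (\<lambda>H. z powr (\<psi> (t a) + min K2 (\<Sum>i\<in>reach H (A \<union> D - {a} \<union> N). \<psi> (t i)))))"
        unfolding capped_def bern_cmult[symmetric] powr_add ..
      also have "\<dots> \<le> bern ?V (\<lambda>j. eprob c \<psi> n t {a, j}) (\<lambda>N. bern (pairs ?V) (eprob c \<psi> n t)
          (\<lambda>H. z powr (min K (\<psi> (t a) + (\<Sum>i\<in>reach H (A \<union> D - {a} \<union> N). \<psi> (t i))))))"
        using z B(2)[OF ta] by (intro bern_mono edge many_edge_bounds[OF V1] powr_mono) (auto simp: K_def)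
      also have "\<dots> = capped z n t V (A \<union> D) K"
        unfolding capped_def using aD AV DV
        by (subst bern_explore_sum[OF fin, of a _ _ "\<lambda>x. z powr min K x"]) auto
      finally show ?thesis .
    qed
  qed
qed

text \<open>One generation more is obtained by letting all of \<open>A\<close> play the part of
  \<open>D\<close> in the preceding step, without any other seeds. Sets of seeds are required
  although single vertices matter in the end, because exploring one vertex opens several.\<close>

lemma capped_lower:
  assumes z: "z > 1" and \<epsilon>: "0 < \<epsilon>" "\<epsilon> < 1"
  shows "\<exists>K\<ge>0. \<exists>\<eta>>0. \<exists>n0. \<forall>n\<ge>n0. \<forall>V t A. many \<eta> 0 n V t \<longrightarrow> A \<subseteq> V \<longrightarrow> card A \<le> R \<longrightarrow>
      (1 - \<epsilon>) * (\<Prod>a\<in>A. g z d (t a)) \<le> capped z n t V A K"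
  using \<epsilon>
proof (induction d arbitrary: \<epsilon> R)
  case 0
  show ?case
  proof (rule exI[of _ 0], intro conjI, simp, rule exI[of _ 1], intro conjI, simp, rule exI[of _ 0],
      intro allI impI)
    fix n V t A assume V: "many 1 0 n V t" and A: "A \<subseteq> V"
    have "capped z n t V A 0 = bern (pairs V) (eprob c \<psi> n t) (\<lambda>H. 1)"
      unfolding capped_def
    proof (intro bern_cong refl)
      fix H assume "H \<subseteq> pairs V"
      then have "(\<Sum>i\<in>reach H A. \<psi> (t i)) \<ge> 0"
        using reach_subset[of H V A] A many_type[OF V] \<psi>_pos by (intro sum_nonneg) (auto intro!: less_imp_le)
      then show "z powr min 0 (\<Sum>i\<in>reach H A. \<psi> (t i)) = 1" using z by (simp add: min_def)
    qed
    then show "(1 - \<epsilon>) * (\<Prod>a\<in>A. g z 0 (t a)) \<le> capped z n t V A 0"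
      using 0 many_finite[OF V] by (simp add: bern_const finite_pairs)
  qed
next
  case (Suc d)
  obtain K \<eta> n0 where *: "K \<ge> 0" "\<eta> > 0" and K: "\<forall>n\<ge>n0. \<forall>V t A D. many \<eta> 0 n V t \<longrightarrow> A \<subseteq> V \<longrightarrow> D \<subseteq> V \<longrightarrow>
      A \<inter> D = {} \<longrightarrow> card A \<le> (0::nat) \<longrightarrow> card D \<le> R \<longrightarrow>
      (1 - \<epsilon>) * ((\<Prod>a\<in>D. g z (Suc d) (t a)) * (\<Prod>a\<in>A. g z d (t a))) \<le> capped z n t V (A \<union> D) K"
    using capped_lower_step[OF z Suc.IH Suc.prems, of 0 R] by blast
  show ?case
    by (rule exI[of _ K], intro conjI *, rule exI[of _ \<eta>], intro conjI *, rule exI[of _ n0], intro allI impI)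
      (use K[rule_format, where A = "{}"] in auto)
qed

end

section \<open>From the generating function to the tail of the cluster weight\<close>

lemma powr_cap_le:
  assumes z: "1 < (z::real)"
  shows "z powr min (real K) X \<le> z * (1 + (\<Sum>j=1..K. z ^ j * of_bool (real j \<le> X)))"
proof -
  \<comment> \<open>With \<open>j\<close> the integer part of the capped weight, the power is at
    most \<open>z ^ (j + 1)\<close>, hence the leading factor \<open>z\<close>; and
    \<open>z ^ j\<close> is one of the summands unless \<open>j = 0\<close>, which the 1
    covers.\<close>
  define j where "j = min K (nat \<lfloor>X\<rfloor>)"
  have sum: "(\<Sum>i\<in>{j} \<inter> {1..K}. z ^ i * of_bool (real i \<le> X)) \<le> (\<Sum>i=1..K. z ^ i * of_bool (real i \<le> X))"
    using z by (intro sum_mono2) auto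
  have "z ^ j \<le> 1 + (\<Sum>i=1..K. z ^ i * of_bool (real i \<le> X))"
  proof (cases "j = 0")
    case True
    then show ?thesis using z by (simp add: sum_nonneg)
  next
    case False
    then have "real j \<le> X" "j \<in> {1..K}" unfolding j_def by (auto simp: le_nat_floor min_def) linarith+
    then show ?thesis using sum by simp
  qed
  moreover have "min (real K) X \<le> real (Suc j)" unfolding j_def by linarith
  then have "z powr min (real K) X \<le> z powr real (Suc j)" using z by (intro powr_mono) auto
  moreover have "z powr real (Suc j) = z * z ^ j" using z powr_realpow[of z "Suc j"] by simp
  ultimately show ?thesis using z by (smt (verit) mult_left_mono)
qed

text \<open>If every tail probability stayed below \<open>z'^(-j) / b\<close>, the layers of the
  capped expectation would be dominated by a geometric series of ratio \<open>z / z' < 1\<close>, so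
  the threshold does not depend on \<open>K\<close>. The factor \<open>1 / b\<close> is the reserve
  from which \<open>heavy_chain\<close> pays for a renewal.\<close>

lemma heavy_if_capped_large:
  assumes "finite V" and P: "\<And>e. e \<in> pairs V \<Longrightarrow> 0 \<le> P e \<and> P e \<le> 1"
    and z: "1 < z" "z < z'" and b: "b > 0"
    and large: "z * (1 + 1 / (b * (1 - z / z'))) < bern (pairs V) P (\<lambda>H. z powr min (real K) (sum w (reach H A)))"
  shows "\<exists>j\<in>{1..K}. inverse (z' ^ j) / b \<le> prob_heavy P w V A (real j)"
proof (rule ccontr)
  assume "\<not> ?thesis"
  then have light: "prob_heavy P w V A (real j) \<le> inverse (z' ^ j) / b" if "j \<in> {1..K}" for j
    using that by (auto intro!: less_imp_le simp: not_le)
  let ?r = "z / z'"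
  have r: "0 < ?r" "?r < 1" using z by auto
  have "bern (pairs V) P (\<lambda>H. z powr min (real K) (sum w (reach H A))) \<le>
    bern (pairs V) P (\<lambda>H. z * (1 + (\<Sum>j=1..K. z ^ j * of_bool (real j \<le> sum w (reach H A)))))"
    using powr_cap_le[OF z(1)] P by (intro bern_mono) auto
  also have "\<dots> = z * (1 + (\<Sum>j=1..K. z ^ j * prob_heavy P w V A (real j)))"
    unfolding bern_cmult bern_add bern_const[OF finite_pairs[OF assms(1)]] bern_sum prob_heavy_def ..
  also have "\<dots> \<le> z * (1 + (\<Sum>j=1..K. ?r ^ j / b))"
  proof -
    have "z ^ j * prob_heavy P w V A (real j) \<le> ?r ^ j / b" if "j \<in> {1..K}" for j
    proof -
      have "z ^ j * prob_heavy P w V A (real j) \<le> z ^ j * (inverse (z' ^ j) / b)"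
        using z by (intro mult_left_mono light that) auto
      then show ?thesis by (simp add: power_divide field_simps)
    qed
    then show ?thesis using z by (intro mult_left_mono add_left_mono sum_mono) auto
  qed
  also have "\<dots> = z * (1 + (\<Sum>j=1..K. ?r ^ j) / b)"
    by (simp add: sum_divide_distrib)
  also have "\<dots> \<le> z * (1 + (1 / (1 - ?r)) / b)"
  proof -
    have "(\<Sum>j=1..K. ?r ^ j) \<le> (\<Sum>j<Suc K. ?r ^ j)"
      using r by (intro sum_mono2) auto
    also have "\<dots> \<le> (\<Sum>j. ?r ^ j)"
      using r by (intro sum_le_suminf) auto
    also have "\<dots> = 1 / (1 - ?r)"
      using r by (intro suminf_geometric) auto
    finally show ?thesis
      using z b by (intro mult_left_mono add_left_mono divide_right_mono) auto
  qed
  finally show False using large by (simp add: mult.commute)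
qed

context finite_types
begin

text \<open>The vertices of type \<open>k\<close> other than \<open>v\<close> contain two disjoint
  blocks of at least \<open>n * m k / 8\<close> vertices. Having a neighbour in one block is
  independent of having one in the other, which gives the square.\<close>

lemma two_neighbours:
  assumes k: "k \<in> T" "m k > 0"
  shows "\<exists>\<eta>>0. \<exists>n0. \<forall>n\<ge>n0. \<forall>V t v. many \<eta> 0 n V t \<longrightarrow> v \<in> V \<longrightarrow> t v = k \<longrightarrow>
    (1 - exp (- (c * \<psi> k * \<psi> k * m k / 8)))\<^sup>2 \<le> bern (V - {v}) (\<lambda>j. eprob c \<psi> n t {v, j})
          (\<lambda>N. of_bool (\<exists>u1\<in>N. \<exists>u2\<in>N. u1 \<noteq> u2 \<and> t u1 = k \<and> t u2 = k))"
proof -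
  define \<eta> where "\<eta> = m k / 2"
  define l where "l = c * \<psi> k * \<psi> k * m k / 8"
  define b where "b = (1 - exp (- l))\<^sup>2"
  have \<eta>: "\<eta> > 0" using k by (simp add: \<eta>_def)
  have l: "l > 0" using k \<psi>_pos[OF k(1)] c_pos by (simp add: l_def)
  \<comment> \<open>Two blocks fit because
    \<open>2 * s \<le> n * m k / 4 + 2 \<le> n * m k / 2 - 1\<close>, which amounts to
    \<open>n * m k \<ge> 12\<close>; the 1 accounts for \<open>v\<close> itself. The term
    \<open>c * \<psi> k * \<psi> k\<close> keeps the edge probability from being cut off at
    1.\<close>
  obtain n0 :: nat where n0: "real n0 \<ge> 12 / m k + c * \<psi> k * \<psi> k + 1" using real_arch_simple by blast
  show ?thesis
  proof (rule exI[of _ \<eta>], intro conjI \<eta>, rule exI[of _ n0], intro allI impI)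
    fix n V t v assume "n \<ge> n0" and V: "many \<eta> 0 n V t" and v: "v \<in> V" "t v = k"
    then have "real n \<ge> real n0" by simp
    moreover have "0 \<le> 12 / m k" "0 \<le> c * \<psi> k * \<psi> k" using k \<psi>_pos[OF k(1)] c_pos by auto
    ultimately have n: "real n \<ge> 12 / m k" "real n \<ge> c * \<psi> k * \<psi> k" "real n \<ge> 1" using n0 by linarith+
    have nm: "12 \<le> real n * m k" using n k by (simp add: field_simps)
    define s where "s = nat \<lceil>real n * m k / 8\<rceil>"
    have s: "real n * m k / 8 \<le> real s" "real s \<le> real n * m k / 8 + 1"
      using nm unfolding s_def by linarith+
    define X where "X = {i\<in>V - {v}. t i = k}"
    have fin: "finite V" using V by (rule many_finite)
    have "{i\<in>V. t i = k} = insert v X" using v by (auto simp: X_def)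
    then have "card {i\<in>V. t i = k} = Suc (card X)" using fin by (simp add: X_def)
    moreover have "real n * (m k - \<eta>) \<le> card {i\<in>V. t i = k}" using V k by (auto simp: many_def)
    ultimately have "real n * m k / 2 - 1 \<le> card X" by (simp add: \<eta>_def)
    then have cX: "2 * s \<le> card X" using s nm by linarith
    then obtain T1 where T1: "T1 \<subseteq> X" "card T1 = s" using obtain_subset_with_card_n[of s X] by auto
    have finX: "finite X" using fin by (simp add: X_def)
    have "card (X - T1) = card X - s" using T1 finX by (simp add: card_Diff_subset finite_subset)
    then obtain T2 where T2: "T2 \<subseteq> X - T1" "card T2 = s"
      using obtain_subset_with_card_n[of s "X - T1"] cX by (metis add_le_imp_le_diff mult_2)
    have finT: "finite T1" "finite T2" using T1 T2 finX by (auto intro: finite_subset)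
    define p where "p = c * \<psi> k * \<psi> k / n"
    have p: "0 \<le> p" "p \<le> 1" using n k \<psi>_pos[OF k(1)] c_pos by (auto simp: p_def)
    have pX: "eprob c \<psi> n t {v, j} = p" if "j \<in> X" for j
      using that v p by (simp add: eprob_pair X_def p_def)
    have ps: "l \<le> p * real s"
    proof -
      have "l = p * (real n * m k / 8)" using n by (simp add: p_def l_def)
      also have "\<dots> \<le> p * real s" using s p by (intro mult_left_mono)
      finally show ?thesis .
    qed
    have hit: "1 - exp (- l) \<le> bern T' (\<lambda>j. eprob c \<psi> n t {v, j}) (\<lambda>N. of_bool (N \<noteq> {}))"
      if T': "T' \<subseteq> X" "card T' = s" for T'
    proof -
      have fT: "finite T'" using T' finX finite_subset by auto
      have "(\<Prod>j\<in>T'. 1 - eprob c \<psi> n t {v, j}) = (\<Prod>j\<in>T'. 1 - p)"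
        using T' pX by (intro prod.cong) auto
      also have "\<dots> = (1 - p) ^ s" using T' by simp
      also have "(1 - p) ^ s \<le> exp (- p) ^ s"
        using p exp_ge_add_one_self[of "- p"] by (intro power_mono) auto
      also have "\<dots> = exp (- (p * real s))" by (simp add: exp_of_nat_mult[symmetric] mult.commute)
      also have "\<dots> \<le> exp (- l)" using ps by simp
      finally have miss: "(\<Prod>j\<in>T'. 1 - eprob c \<psi> n t {v, j}) \<le> exp (- l)" .
      have "bern T' (\<lambda>j. eprob c \<psi> n t {v, j}) (\<lambda>N. of_bool (N \<noteq> {})) =
        bern T' (\<lambda>j. eprob c \<psi> n t {v, j}) (\<lambda>N. 1 - (\<Prod>j\<in>N. 0))"
        using fT by (intro bern_cong) (auto dest: finite_subset simp: card_eq_0_iff)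
      also have "\<dots> = 1 - (\<Prod>j\<in>T'. 1 - eprob c \<psi> n t {v, j})"
        unfolding bern_diff bern_const[OF fT] bern_prod[OF fT] by simp
      finally show ?thesis using miss by simp
    qed
    have edge: "0 \<le> eprob c \<psi> n t {v, j} \<and> eprob c \<psi> n t {v, j} \<le> 1" if "j \<in> V - {v}" for j
      using that v by (intro many_edge_bounds[OF V]) (auto simp: pairs_def)
    let ?Q = "\<lambda>j. eprob c \<psi> n t {v, j}"
    have "b \<le> bern T1 ?Q (\<lambda>N. of_bool (N \<noteq> {})) * bern T2 ?Q (\<lambda>N. of_bool (N \<noteq> {}))"
      unfolding b_def power2_eq_square using T1 T2 l by (intro mult_mono hit order_trans[OF _ hit[OF T1]]) auto
    also have "\<dots> = bern T1 ?Q (\<lambda>N1. bern T2 ?Q (\<lambda>N2. of_bool (N1 \<noteq> {}) * of_bool (N2 \<noteq> {})))"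
      unfolding bern_cmult mult.commute[of _ "bern T2 ?Q (\<lambda>N. of_bool (N \<noteq> {}))"] ..
    also have "\<dots> = bern T1 ?Q (\<lambda>N1. bern T2 ?Q (\<lambda>N2. of_bool ((N1 \<union> N2) \<inter> T1 \<noteq> {} \<and> (N1 \<union> N2) \<inter> T2 \<noteq> {})))"
    proof (intro bern_cong refl)
      fix N1 N2 assume "N1 \<subseteq> T1" "N2 \<subseteq> T2"
      then have "(N1 \<union> N2) \<inter> T1 = N1" "(N1 \<union> N2) \<inter> T2 = N2" using T2 by auto
      then show "of_bool (N1 \<noteq> {}) * of_bool (N2 \<noteq> {}) =
        (of_bool ((N1 \<union> N2) \<inter> T1 \<noteq> {} \<and> (N1 \<union> N2) \<inter> T2 \<noteq> {}) :: real)" by simp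
    qed
    also have "\<dots> = bern (T1 \<union> T2) ?Q (\<lambda>N. of_bool (N \<inter> T1 \<noteq> {} \<and> N \<inter> T2 \<noteq> {}))"
      using finT T2 by (intro bern_Un[symmetric]) auto
    also have "\<dots> = bern (V - {v}) ?Q (\<lambda>N. of_bool ((N \<inter> (T1 \<union> T2)) \<inter> T1 \<noteq> {} \<and> (N \<inter> (T1 \<union> T2)) \<inter> T2 \<noteq> {}))"
      using T1 T2 fin by (intro bern_marginal[symmetric]) (auto simp: X_def)
    also have "\<dots> \<le> bern (V - {v}) ?Q (\<lambda>N. of_bool (\<exists>u1\<in>N. \<exists>u2\<in>N. u1 \<noteq> u2 \<and> t u1 = k \<and> t u2 = k))"
    proof (intro bern_mono edge)
      fix N
      have "\<exists>u1\<in>N. \<exists>u2\<in>N. u1 \<noteq> u2 \<and> t u1 = k \<and> t u2 = k" if hit: "N \<inter> T1 \<noteq> {}" "N \<inter> T2 \<noteq> {}"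
      proof -
        obtain u1 u2 where "u1 \<in> N" "u1 \<in> T1" "u2 \<in> N" "u2 \<in> T2" using hit by auto
        moreover have "u1 \<noteq> u2" "t u1 = k" "t u2 = k" using calculation T1 T2 by (auto simp: X_def)
        ultimately show ?thesis by blast
      qed
      then show "of_bool ((N \<inter> (T1 \<union> T2)) \<inter> T1 \<noteq> {} \<and> (N \<inter> (T1 \<union> T2)) \<inter> T2 \<noteq> {}) \<le>
        (of_bool (\<exists>u1\<in>N. \<exists>u2\<in>N. u1 \<noteq> u2 \<and> t u1 = k \<and> t u2 = k) :: real)"
        by auto
    qed
    finally show "(1 - exp (- (c * \<psi> k * \<psi> k * m k / 8)))\<^sup>2 \<le> bern (V - {v}) ?Q (\<lambda>N. of_bool (\<exists>u1\<in>N. \<exists>u2\<in>N. u1 \<noteq> u2 \<and> t u1 = k \<and> t u2 = k))"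
      by (simp only: b_def l_def)
  qed
qed

text \<open>
  If two neighbours \<open>u\<^sub>1, u\<^sub>2\<close> of \<open>v\<close> have type \<open>k\<close>, the part reached from \<open>u\<^sub>1\<close> can supply weight
  \<open>j\<close> and the part reached from \<open>u\<^sub>2\<close> the remaining \<open>i - j\<close>. So the tail is supermultiplicative,
  and its exponential rate is determined by a single \<open>j\<close>.
\<close>

lemma heavy_chain:
  fixes b w0 z :: real
  assumes k: "k \<in> T" and z: "z > 1" and b: "b > 0" and w0: "w0 > 0" "\<And>y. y \<in> T \<Longrightarrow> w0 \<le> \<psi> y"
    and two: "\<And>V t v. many \<eta> 0 n V t \<Longrightarrow> v \<in> V \<Longrightarrow> t v = k \<Longrightarrow>
       b \<le> bern (V - {v}) (\<lambda>j. eprob c \<psi> n t {v, j})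
          (\<lambda>N. of_bool (\<exists>u1\<in>N. \<exists>u2\<in>N. u1 \<noteq> u2 \<and> t u1 = k \<and> t u2 = k))"
    and seed: "\<And>V t v. many \<eta> 0 n V t \<Longrightarrow> v \<in> V \<Longrightarrow> t v = k \<Longrightarrow>
       \<exists>j\<in>{1..K}. inverse (z ^ j) / b \<le> prob_heavy (eprob c \<psi> n t) (\<lambda>i. \<psi> (t i)) V {v} (real j)"
    and C: "C = 2 + K / w0"
    and V: "many \<eta> (real (i + 1) * C) n V t" and v: "v \<in> V" "t v = k"
  shows "inverse (z ^ (i + K)) \<le> prob_heavy (eprob c \<psi> n t) (\<lambda>i. \<psi> (t i)) V {v} (real i)"
  using V v
proof (induction i arbitrary: V v rule: less_induct)
  case (less i)
  note V = less.prems(1)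
  let ?P = "eprob c \<psi> n t" and ?w = "\<lambda>i. \<psi> (t i)"
  let ?p = "prob_heavy ?P ?w"
  have fin: "finite V" using V by (rule many_finite)
  have P: "0 \<le> ?P e \<and> ?P e \<le> 1" if "e \<in> pairs V" for e
    using many_edge_bounds[OF V that] .
  have wT: "w0 \<le> ?w u" "0 \<le> ?w u" if "u \<in> V" for u
    using w0(2)[OF many_type[OF V that]] w0(1) by auto
  have zi: "0 < inverse (z ^ l)" "inverse (z ^ l) \<le> 1" for l
    using z by (auto simp: inverse_le_1_iff)
  \<comment> \<open>A round uses up \<open>v\<close> and at most \<open>K / w0 + 1\<close> further
    vertices for the branch at the first neighbour, together at most \<open>C\<close>. Since
    \<open>j \<ge> 1\<close>, every round lowers \<open>i\<close>, so a slack of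
    \<open>(i + 1) * C\<close> suffices.\<close>
  have C1: "C \<ge> 2" using w0 by (simp add: C)
  show ?case
  proof (cases "i = 0")
    case True
    have "?p V {v} (real i) = 1"
      using prob_heavy_nonpos[of V ?P ?w V "{v}" "real i"] P wT fin less.prems True by simp
    then show ?thesis using zi by simp
  next
    case False
    let ?V = "V - {v}"
    have many0: "many \<eta> 0 n V' t" if "V' \<subseteq> V" "card (V - V') \<le> 2" for V'
      using that C1 mult_mono[of 1 "real (i + 1)" 2 C] by (intro many_Diff[OF V that(1), of 2]) auto
    have pair: "inverse (z ^ (i + K)) / b \<le> ?p ?V {u1, u2} (real i)"
      if u: "u1 \<in> ?V" "u2 \<in> ?V" "u1 \<noteq> u2" "t u1 = k" "t u2 = k" for u1 u2
    proof -
      have "V - (?V - {u2}) = {v, u2}" using less.prems u by auto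
      then have "card (V - (?V - {u2})) \<le> 2" by (simp add: card_insert_if)
      then have "many \<eta> 0 n (?V - {u2}) t" by (intro many0) auto
      from seed[OF this, of u1] obtain j where j: "j \<in> {1..K}"
        "inverse (z ^ j) / b \<le> ?p (?V - {u2}) {u1} (real j)" using u by auto
      \<comment> \<open>The offset \<open>K\<close> keeps the exponent \<open>i + K - j\<close> from
        becoming negative: \<open>j\<close> may overshoot \<open>i\<close>, and then nothing is left
        to be collected from \<open>u2\<close>.\<close>
      have "?p (?V - {u2}) {u1} (real j) * inverse (z ^ (i + K - j)) \<le>
          ?p ?V (insert u2 {u1}) (real j + (real i - real j))"
      proof (rule prob_heavy_two_seeds[of V ?P ?w, OF P wT(2) fin, where ?w0.0 = w0])
        fix V' assume V': "V' \<subseteq> ?V" "u2 \<in> V'" "card (?V - V') * w0 \<le> max 0 (real j + w0)"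
        show "inverse (z ^ (i + K - j)) \<le> ?p V' {u2} (real i - real j)"
        proof (cases "j < i")
          case True
          have "real (card (?V - V')) * w0 \<le> real K + w0"
            using V'(3) j(1) w0 by (simp add: max_def)
          then have "real (card (?V - V')) \<le> real K / w0 + 1"
            using w0 by (simp add: field_simps)
          moreover have "V - V' = insert v (?V - V')" using V' less.prems by auto
          then have "card (V - V') = Suc (card (?V - V'))" using fin by simp
          ultimately have card: "real (card (V - V')) \<le> C" by (simp add: C)
          have "many \<eta> (real (i - j + 1) * C) n V' t"
          proof (rule many_Diff[OF V _ card])
            have "real (i - j + 1) + 1 \<le> real (i + 1)" using j(1) True by auto
            then have "(real (i - j + 1) + 1) * C \<le> real (i + 1) * C"
              using C1 by (intro mult_right_mono) auto
            then show "real n * \<eta> + real (i - j + 1) * C + C \<le> real n * \<eta> + real (i + 1) * C"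
              by (simp add: algebra_simps)
          qed (use V' in auto)
          then have "inverse (z ^ (i - j + K)) \<le> ?p V' {u2} (real (i - j))"
            using less.IH[of "i - j" V' u2] j(1) True V' u by auto
          moreover have "i - j + K = i + K - j" using True by simp
          ultimately show ?thesis using True by (simp add: of_nat_diff)
        next
          case False
          have "?p V' {u2} (real i - real j) = 1"
            using prob_heavy_nonpos[of V ?P ?w V' "{u2}" "real i - real j"] P wT fin V' False by auto
          then show ?thesis using zi by simp
        qed
      qed (use u wT w0 zi in \<open>auto intro: less_imp_le\<close>)
      moreover have "inverse (z ^ j) / b * inverse (z ^ (i + K - j)) \<le> ?p (?V - {u2}) {u1} (real j) * inverse (z ^ (i + K - j))"
        using j(2) zi by (intro mult_right_mono) (auto intro: less_imp_le)
      moreover have "z ^ j * z ^ (i + K - j) = z ^ (i + K)"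
        using j(1) by (simp add: power_add[symmetric])
      then have "inverse (z ^ j) / b * inverse (z ^ (i + K - j)) = inverse (z ^ (i + K)) / b"
        by (simp add: divide_inverse mult_ac flip: inverse_mult_distrib)
      ultimately show ?thesis using b by (simp add: insert_commute)
    qed
    have edge: "0 \<le> ?P {v, j} \<and> ?P {v, j} \<le> 1" if "j \<in> ?V" for j
      using that less.prems by (intro P) (auto simp: pairs_def)
    define E where "E N \<longleftrightarrow> (\<exists>u1\<in>N. \<exists>u2\<in>N. u1 \<noteq> u2 \<and> t u1 = k \<and> t u2 = k)" for N
    \<comment> \<open>The factor \<open>1 / b\<close> gained at the first neighbour pays exactly for
      the probability \<open>b\<close> of two neighbours of type \<open>k\<close>.\<close>
    have "inverse (z ^ (i + K)) = inverse (z ^ (i + K)) / b * b" using b by simp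
    also have "\<dots> \<le> inverse (z ^ (i + K)) / b * bern ?V (\<lambda>j. ?P {v, j}) (\<lambda>N. of_bool (E N))"
      unfolding E_def using zi b less.prems many0[of V]
      by (intro mult_left_mono two) (auto intro: less_imp_le)
    also have "\<dots> = bern ?V (\<lambda>j. ?P {v, j}) (\<lambda>N. inverse (z ^ (i + K)) / b * of_bool (E N))"
      by (rule bern_cmult[symmetric])
    also have "\<dots> \<le> bern ?V (\<lambda>j. ?P {v, j}) (\<lambda>N. ?p ?V ({v} - {v} \<union> N) (real i - ?w v))"
    proof (intro bern_mono edge)
      fix N assume N: "N \<subseteq> ?V"
      show "inverse (z ^ (i + K)) / b * of_bool (E N) \<le> ?p ?V ({v} - {v} \<union> N) (real i - ?w v)"
      proof (cases "E N")
        case True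
        then obtain u1 u2 where u: "u1 \<in> N" "u2 \<in> N" "u1 \<noteq> u2" "t u1 = k" "t u2 = k"
          by (auto simp: E_def)
        have "inverse (z ^ (i + K)) / b \<le> ?p ?V {u1, u2} (real i)"
          using u N by (intro pair) auto
        also have "\<dots> \<le> ?p ?V ({v} - {v} \<union> N) (real i - ?w v)"
          using u N wT less.prems by (intro prob_heavy_mono[of V ?P ?w, OF P wT(2) fin]) auto
        finally show ?thesis using True by simp
      next
        case False
        then show ?thesis
          using prob_heavy_bounds(1)[of V ?P ?w ?V, OF P wT(2) fin] by auto
      qed
    qed
    also have "\<dots> = ?p V {v} (real i)"
      using fin less.prems by (intro prob_heavy_explore[symmetric]) auto
    finally show ?thesis .
  qed
qed

end

section \<open>Existence of a heavy cluster with high probability\<close>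

context finite_types
begin

lemma many_weaken: "many \<eta> 0 n V t \<Longrightarrow> \<eta> \<le> \<eta>' \<Longrightarrow> many \<eta>' 0 n V t"
  by (rule many_Diff[where V = V and r = 0]) (auto intro!: mult_left_mono)

text \<open>About \<open>n powr \<delta>\<close> clusters are explored, with \<delta> midway between
  \<open>\<beta> * ln z'\<close> and 1: few enough to use up only \<open>o(n)\<close> vertices, yet
  so many that successes of probability of order \<open>n powr (- \<beta> * ln z')\<close> are
  expected in diverging number.\<close>

lemma light_unlikely:
  fixes z z' \<beta> :: real
  defines "b \<equiv> (\<lambda>k. (1 - exp (- (c * \<psi> k * \<psi> k * m k / 8)))\<^sup>2)"
  assumes k: "k \<in> T" "m k > 0" and z: "1 < z" "z < z'"
    and large: "z * (1 + 1 / (b k * (1 - z / z'))) < gen_fun \<psi> m c z T d k"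
    and \<beta>: "\<beta> > 0" "\<beta> * ln z' < 1"
  shows "\<exists>\<eta>>0. \<forall>\<epsilon>>0. \<exists>n0. \<forall>n\<ge>n0. \<forall>V t. many \<eta> 0 n V t \<longrightarrow>
    bern (pairs V) (eprob c \<psi> n t) (\<lambda>H. of_bool (all_light (\<lambda>i. \<psi> (t i)) (\<beta> * ln n) V H)) \<le> \<epsilon>"
proof -
  have b: "b k > 0" using k \<psi>_pos[OF k(1)] c_pos by (simp add: b_def)
  have z': "z' > 1" using z by simp
  define L where "L = z * (1 + 1 / (b k * (1 - z / z')))"
  \<comment> \<open>Makes \<open>(1 - e)\<close> times the generating function the midpoint between
    its value and \<open>L\<close>.\<close>
  define e where "e = (gen_fun \<psi> m c z T d k - L) / (2 * gen_fun \<psi> m c z T d k)"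
  have L: "L > 0" "L < gen_fun \<psi> m c z T d k"
  proof -
    have "0 \<le> 1 / (b k * (1 - z / z'))" using b z by simp
    then have "0 < 1 + 1 / (b k * (1 - z / z'))" by linarith
    then show "L > 0" using z by (simp add: L_def)
  qed (use large in \<open>simp add: L_def\<close>)
  have e: "0 < e" "e < 1" using L by (auto simp: e_def field_simps)
  have eL: "L < (1 - e) * gen_fun \<psi> m c z T d k"
  proof -
    have "(1 - e) * gen_fun \<psi> m c z T d k = (gen_fun \<psi> m c z T d k + L) / 2"
      using L by (simp add: e_def field_simps)
    then show ?thesis using L by simp
  qed
  obtain \<eta>1 n1 where \<eta>1: "\<eta>1 > 0" and two: "\<forall>n\<ge>n1. \<forall>V t v. many \<eta>1 0 n V t \<longrightarrow> v \<in> V \<longrightarrow> t v = k \<longrightarrow>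
    b k \<le> bern (V - {v}) (\<lambda>j. eprob c \<psi> n t {v, j})
          (\<lambda>N. of_bool (\<exists>u1\<in>N. \<exists>u2\<in>N. u1 \<noteq> u2 \<and> t u1 = k \<and> t u2 = k))"
    using two_neighbours[OF k] unfolding b_def by blast
  obtain K \<eta>2 n2 where \<eta>2: "\<eta>2 > 0" and cap: "\<forall>n\<ge>n2. \<forall>V t A. many \<eta>2 0 n V t \<longrightarrow> A \<subseteq> V \<longrightarrow> card A \<le> 1 \<longrightarrow>
      (1 - e) * (\<Prod>a\<in>A. gen_fun \<psi> m c z T d (t a)) \<le> capped z n t V A K"
    using capped_lower[OF z(1) e, of 1 d] by blast
  define Kn where "Kn = nat \<lceil>K\<rceil>"
  have Kn: "K \<le> real Kn" unfolding Kn_def by linarith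
  \<comment> \<open>The bound \<open>m k\<close> ensures that a vertex of type \<open>k\<close>,
    from which the next cluster can be explored, is still present after all removals.\<close>
  define \<eta>c where "\<eta>c = min (min \<eta>1 \<eta>2) (m k)"
  define \<eta> where "\<eta> = \<eta>c / 2"
  have \<eta>c: "\<eta>c > 0" "\<eta>c \<le> \<eta>1" "\<eta>c \<le> \<eta>2" "\<eta>c \<le> m k" using \<eta>1 \<eta>2 k by (auto simp: \<eta>c_def)
  have \<eta>: "\<eta> > 0" using \<eta>c by (simp add: \<eta>_def)
  define w0 where "w0 = Min (\<psi> ` T)"
  have "w0 \<in> \<psi> ` T" unfolding w0_def using finite_T k by (intro Min_in) auto
  then have w0: "w0 > 0" "\<And>y. y \<in> T \<Longrightarrow> w0 \<le> \<psi> y"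
    using finite_T \<psi>_pos by (auto simp: w0_def)
  define C where "C = 2 + Kn / w0"
  have C: "C > 0" using w0 by (simp add: C_def add_pos_nonneg)
  have chain: "inverse (z' ^ (i + Kn)) \<le> prob_heavy (eprob c \<psi> n t) (\<lambda>i. \<psi> (t i)) V {v} (real i)"
    if n: "n \<ge> n1" "n \<ge> n2" and V: "many \<eta>c (real (i + 1) * C) n V t" "v \<in> V" "t v = k" for n V t v i
  proof (rule heavy_chain[OF k(1) z' b w0 _ _ C_def V])
    fix V t v assume V: "many \<eta>c 0 n V t" "v \<in> V" "t v = k"
    show "b k \<le> bern (V - {v}) (\<lambda>j. eprob c \<psi> n t {v, j})
          (\<lambda>N. of_bool (\<exists>u1\<in>N. \<exists>u2\<in>N. u1 \<noteq> u2 \<and> t u1 = k \<and> t u2 = k))"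
      using two[rule_format, OF n(1) many_weaken[OF V(1) \<eta>c(2)] V(2,3)] .
    have "L < (1 - e) * (\<Prod>a\<in>{v}. gen_fun \<psi> m c z T d (t a))" using eL V by simp
    also have "\<dots> \<le> capped z n t V {v} K"
      using V by (intro cap[rule_format, OF n(2) many_weaken[OF V(1) \<eta>c(3)]]) auto
    also have "\<dots> \<le> capped z n t V {v} (real Kn)"
      using z Kn by (intro capped_mono[OF V(1)]) auto
    finally have "L < bern (pairs V) (eprob c \<psi> n t) (\<lambda>H. z powr min (real Kn) (\<Sum>i\<in>reach H {v}. \<psi> (t i)))"
      by (simp add: capped_def)
    then show "\<exists>j\<in>{1..Kn}. inverse (z' ^ j) / b k \<le> prob_heavy (eprob c \<psi> n t) (\<lambda>i. \<psi> (t i)) V {v} (real j)"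
      unfolding L_def by (intro heavy_if_capped_large[OF many_finite[OF V(1)] many_edge_bounds[OF V(1)] z b])
  qed
  define \<gamma> where "\<gamma> = \<beta> * ln z'"
  have \<gamma>: "0 < \<gamma>" "\<gamma> < 1" using \<beta> z' by (auto simp: \<gamma>_def)
  define \<delta> where "\<delta> = (1 + \<gamma>) / 2"
  have \<delta>: "0 < \<delta>" "\<delta> < 1" "\<delta> - \<gamma> > 0" using \<gamma> by (auto simp: \<delta>_def)
  \<comment> \<open>Absorbs the rounding of \<open>x\<close> up to the integer \<open>i\<close> and
    the offset \<open>Kn\<close> in the exponent.\<close>
  define D where "D = z' powr (- (real Kn + 1))"
  have D: "D > 0" using z' by (simp add: D_def)
  have ev1: "\<forall>\<^sub>F n :: nat in sequentially.
      (\<beta> * ln n + 2) * C + (n powr \<delta> + 1) * (\<beta> * ln n) / w0 \<le> n * \<eta>"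
  proof -
    have "((\<lambda>n :: nat. ((\<beta> * ln n + 2) * C + (n powr \<delta> + 1) * (\<beta> * ln n) / w0) / n) \<longlongrightarrow> 0) sequentially"
      using \<delta> \<beta> C w0 by real_asymp
    then have "\<forall>\<^sub>F n :: nat in sequentially. ((\<beta> * ln n + 2) * C + (n powr \<delta> + 1) * (\<beta> * ln n) / w0) / n < \<eta>"
      using \<eta> by (rule order_tendstoD(2))
    then show ?thesis
      using eventually_gt_at_top[of 0] by eventually_elim (simp add: field_simps)
  qed
  show ?thesis
  proof (rule exI[of _ \<eta>], intro conjI \<eta> allI impI)
    fix \<epsilon> :: real assume \<epsilon>: "\<epsilon> > 0"
    have ev2: "\<forall>\<^sub>F n :: nat in sequentially. exp (- (D * n powr (\<delta> - \<gamma>))) \<le> \<epsilon>"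
    proof -
      have "((\<lambda>n :: nat. exp (- (D * n powr (\<delta> - \<gamma>)))) \<longlongrightarrow> 0) sequentially"
        using \<delta> D by real_asymp
      then have "\<forall>\<^sub>F n :: nat in sequentially. exp (- (D * n powr (\<delta> - \<gamma>))) < \<epsilon>"
        using \<epsilon> by (rule order_tendstoD(2))
      then show ?thesis by eventually_elim simp
    qed
    have "\<forall>\<^sub>F n in sequentially. \<forall>V t. many \<eta> 0 n V t \<longrightarrow>
      bern (pairs V) (eprob c \<psi> n t) (\<lambda>H. of_bool (all_light (\<lambda>i. \<psi> (t i)) (\<beta> * ln n) V H)) \<le> \<epsilon>"
      using ev1 ev2 eventually_ge_at_top[of n1] eventually_ge_at_top[of n2] eventually_ge_at_top[of 1]
    proof (eventually_elim, intro allI impI)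
      fix n V t assume n1: "(\<beta> * ln n + 2) * C + (n powr \<delta> + 1) * (\<beta> * ln n) / w0 \<le> n * \<eta>"
        and n2: "exp (- (D * n powr (\<delta> - \<gamma>))) \<le> \<epsilon>" and n: "n1 \<le> n" "n2 \<le> n" "1 \<le> n" and V: "many \<eta> 0 n V t"
      let ?P = "eprob c \<psi> n t" and ?w = "\<lambda>i. \<psi> (t i)"
      define x where "x = \<beta> * ln n"
      define i where "i = nat \<lceil>x\<rceil>"
      define r where "r = nat \<lceil>n powr \<delta>\<rceil>"
      define q where "q = inverse (z' ^ (i + Kn))"
      have x0: "x \<ge> 0" using n \<beta> by (simp add: x_def)
      have i: "x \<le> real i" "real i \<le> x + 1" using x0 unfolding i_def by linarith+
      have r: "n powr \<delta> \<le> real r" "real r \<le> n powr \<delta> + 1"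
        using powr_ge_zero[of n \<delta>] unfolding r_def by linarith+
      have q: "0 < q" "q \<le> 1" using z' by (auto simp: q_def inverse_le_1_iff)
      have fin: "finite V" using V by (rule many_finite)
      have wT: "w0 \<le> ?w u" "0 \<le> ?w u" if "u \<in> V" for u
        using w0(2)[OF many_type[OF V that]] w0(1) by auto
      have "bern (pairs V) ?P (\<lambda>H. of_bool (all_light ?w x V H)) \<le> (1 - q) ^ r"
      proof (rule bern_light_iterate[of V ?P ?w, OF many_edge_bounds[OF V] wT(2) fin])
        fix V' assume V': "V' \<subseteq> V" "sum ?w (V - V') \<le> real r * x"
        have "w0 * card (V - V') = (\<Sum>u\<in>V - V'. w0)" by simp
        also have "\<dots> \<le> sum ?w (V - V')" using wT by (intro sum_mono) auto
        also have "\<dots> \<le> real r * x" by (rule V')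
        also have "\<dots> \<le> (n powr \<delta> + 1) * x" using r x0 by (intro mult_right_mono)
        finally have card: "card (V - V') \<le> (n powr \<delta> + 1) * x / w0" using w0 by (simp add: field_simps)
        have "real (i + 1) * C \<le> (x + 2) * C" using i C by (intro mult_right_mono) auto
        then have slack: "n * \<eta> + real (i + 1) * C + (n powr \<delta> + 1) * x / w0 \<le> n * \<eta>c + 0"
          using n1 unfolding x_def[symmetric] \<eta>_def by linarith
        have V1: "many \<eta>c (real (i + 1) * C) n V' t"
          by (rule many_Diff[OF V V'(1) card slack])
        then have "real n * (m k - \<eta>c) + real (i + 1) * C \<le> card {u\<in>V'. t u = k}"
          using k by (auto simp: many_def)
        moreover have "0 \<le> real n * (m k - \<eta>c)" "0 < real (i + 1) * C" using \<eta>c C by auto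
        ultimately have "0 < card {u\<in>V'. t u = k}" by linarith
        then obtain v where v: "v \<in> V'" "t v = k" by (auto simp: card_gt_0_iff)
        have "q \<le> prob_heavy ?P ?w V' {v} (real i)"
          unfolding q_def by (rule chain[OF n(1,2) V1 v])
        also have "\<dots> \<le> prob_heavy ?P ?w V' {v} x"
          using v V' i by (intro prob_heavy_mono[of V ?P ?w, OF many_edge_bounds[OF V] wT(2) fin]) auto
        finally show "\<exists>v\<in>V'. q \<le> prob_heavy ?P ?w V' {v} x" using v by auto
      qed (use q x0 in auto)
      also have "\<dots> \<le> exp (- q) ^ r"
        using q exp_ge_add_one_self[of "- q"] by (intro power_mono) auto
      also have "\<dots> = exp (- (q * real r))" by (simp add: exp_of_nat_mult[symmetric] mult.commute)
      also have "\<dots> \<le> exp (- (D * n powr (\<delta> - \<gamma>)))"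
      proof -
        have "n powr (- \<gamma>) = z' powr (- x)"
          using n z' by (simp add: powr_def \<gamma>_def x_def mult_ac)
        then have "D * n powr (- \<gamma>) = z' powr (- (x + 1 + real Kn))"
          unfolding D_def by (simp add: powr_add[symmetric] algebra_simps)
        also have "\<dots> \<le> z' powr (- real (i + Kn))"
          using z' i by (intro powr_mono) auto
        also have "\<dots> = q"
          using z' by (simp only: q_def powr_minus powr_realpow)
        finally have "D * n powr (- \<gamma>) * n powr \<delta> \<le> q * real r"
          using r q by (intro mult_mono) auto
        moreover have "n powr (\<delta> - \<gamma>) = n powr (- \<gamma>) * n powr \<delta>"
          by (simp add: powr_add[symmetric])
        ultimately show ?thesis by (simp add: mult_ac)
      qed
      also have "\<dots> \<le> \<epsilon>" by (rule n2)
      finally show "bern (pairs V) ?P (\<lambda>H. of_bool (all_light ?w (\<beta> * ln n) V H)) \<le> \<epsilon>"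
        by (simp add: x_def)
    qed
    then show "\<exists>n0. \<forall>n\<ge>n0. \<forall>V t. many \<eta> 0 n V t \<longrightarrow>
      bern (pairs V) (eprob c \<psi> n t) (\<lambda>H. of_bool (all_light (\<lambda>i. \<psi> (t i)) (\<beta> * ln n) V H)) \<le> \<epsilon>"
      by (simp add: eventually_sequentially)
  qed
qed

end

section \<open>The branching process\<close>

lemma prob_space_PiM_pmf: "prob_space (PiM J (\<lambda>j. measure_pmf (p j)))"
  by (intro prob_space_PiM measure_pmf.prob_space_axioms)

lemma sets_PiM_pmf [measurable_cong]:
  "sets (PiM J (\<lambda>j. measure_pmf (p j))) = sets (PiM J (\<lambda>_. count_space UNIV))"
  by (intro sets_PiM_cong) auto

lemma indep_coordinates:
  assumes "J \<noteq> {}"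
  shows "prob_space.indep_vars (PiM J (\<lambda>j. measure_pmf (p j))) (\<lambda>j. measure_pmf (p j)) (\<lambda>j N. N j) J"
proof -
  let ?M = "PiM J (\<lambda>j. measure_pmf (p j))"
  interpret prob_space ?M by (rule prob_space_PiM_pmf)
  have "distr ?M ?M (\<lambda>N. \<lambda>j\<in>J. N j) = distr ?M ?M (\<lambda>N. N)"
    by (intro distr_cong) (auto simp: space_PiM PiE_def extensional_restrict)
  also have "\<dots> = ?M" by (rule distr_id2[OF refl])
  also have "\<dots> = PiM J (\<lambda>j. distr ?M (measure_pmf (p j)) (\<lambda>N. N j))"
    by (intro PiM_cong refl distr_PiM_component[symmetric] measure_pmf.prob_space_axioms)
  finally show ?thesis
    by (subst indep_vars_iff_distr_eq_PiM'[OF assms]) auto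
qed

text \<open>That \<open>f l\<close> depends only on the coordinates in \<open>B l\<close> is
  expressed by overwriting all others with 0. Thus \<open>f l\<close> factors through the
  restriction to its block, and the restrictions to disjoint blocks are independent.\<close>

lemma nn_integral_prod_blocks:
  fixes p :: "'j \<Rightarrow> nat pmf" and J :: "'j set"
  defines "M \<equiv> PiM J (\<lambda>j. measure_pmf (p j))"
  assumes J: "J \<noteq> {}" and L: "finite L" and B: "\<And>l. l \<in> L \<Longrightarrow> B l \<subseteq> J" "disjoint_family_on B L"
    and f: "\<And>l. l \<in> L \<Longrightarrow> f l \<in> borel_measurable M"
    and dep: "\<And>l N. l \<in> L \<Longrightarrow> N \<in> space M \<Longrightarrow> f l (\<lambda>j\<in>J. if j \<in> B l then N j else 0) = f l N"
  shows "(\<integral>\<^sup>+N. (\<Prod>l\<in>L. f l N) \<partial>M) = (\<Prod>l\<in>L. \<integral>\<^sup>+N. f l N \<partial>M)"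
proof -
  interpret prob_space M unfolding M_def by (rule prob_space_PiM_pmf)
  define F where "F l \<omega> = f l (\<lambda>j\<in>J. if j \<in> B l then \<omega> j else 0)" for l \<omega>
  have "indep_vars (\<lambda>l. PiM (B l) (\<lambda>j. measure_pmf (p j))) (\<lambda>l N. restrict N (B l)) L"
    using indep_vars_restrict[OF indep_coordinates[OF J, of p, folded M_def] B] by simp
  then have ind: "indep_vars (\<lambda>_. borel) (\<lambda>l N. F l (restrict N (B l))) L"
  proof (rule indep_vars_compose2)
    fix l assume l: "l \<in> L"
    have "(\<lambda>\<omega>. \<lambda>j\<in>J. if j \<in> B l then \<omega> j else 0) \<in> measurable (PiM (B l) (\<lambda>j. measure_pmf (p j))) M"
      unfolding M_def
    proof (intro measurable_restrict)
      fix j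
      have "(\<lambda>\<omega>. \<omega> j) \<in> measurable (PiM (B l) (\<lambda>j. measure_pmf (p j))) (measure_pmf (p j))" if "j \<in> B l"
        using that by (rule measurable_component_singleton)
      then show "(\<lambda>\<omega>. if j \<in> B l then \<omega> j else 0) \<in> measurable (PiM (B l) (\<lambda>j. measure_pmf (p j))) (measure_pmf (p j))"
        by (cases "j \<in> B l") auto
    qed
    from measurable_compose[OF this f[OF l]]
    show "F l \<in> borel_measurable (PiM (B l) (\<lambda>j. measure_pmf (p j)))"
      by (simp add: F_def[abs_def])
  qed
  have eq: "F l (restrict N (B l)) = f l N" if "l \<in> L" "N \<in> space M" for l N
  proof -
    have "(\<lambda>j\<in>J. if j \<in> B l then restrict N (B l) j else 0) = (\<lambda>j\<in>J. if j \<in> B l then N j else 0)"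
      by (auto simp: fun_eq_iff)
    then show ?thesis using dep[OF that] by (simp add: F_def)
  qed
  have "(\<integral>\<^sup>+N. (\<Prod>l\<in>L. f l N) \<partial>M) = (\<integral>\<^sup>+N. (\<Prod>l\<in>L. F l (restrict N (B l))) \<partial>M)"
    by (intro nn_integral_cong prod.cong refl) (simp add: eq)
  also have "\<dots> = (\<Prod>l\<in>L. \<integral>\<^sup>+N. F l (restrict N (B l)) \<partial>M)"
    by (rule indep_vars_nn_integral[OF L ind]) simp
  also have "\<dots> = (\<Prod>l\<in>L. \<integral>\<^sup>+N. f l N \<partial>M)"
    by (intro prod.cong nn_integral_cong refl) (simp add: eq)
  finally show ?thesis .
qed

lemma nn_integral_pgf_Po:
  assumes "r \<ge> 0" "a \<ge> 0"
  shows "(\<Sum>k. ennreal (pmf (Po r) k) * ennreal a ^ k) = ennreal (exp (r * (a - 1)))"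
proof (cases "r = 0")
  case True
  have "(\<lambda>k. pmf (Po r) k * a ^ k) sums 1"
    using sums_single[of 0 "\<lambda>_. 1 :: real"]
    by (rule sums_cong[THEN iffD1, rotated]) (use True in \<open>auto simp: Po_def\<close>)
  then show ?thesis
    using suminf_ennreal_eq[of "\<lambda>k. pmf (Po r) k * a ^ k" 1] assms True
    by (simp add: ennreal_mult' ennreal_power)
next
  case False
  then have r: "r > 0" using assms by simp
  have "(\<lambda>k. exp (- r) * ((r * a) ^ k /\<^sub>R fact k)) sums (exp (- r) * exp (r * a))"
    by (intro sums_mult exp_converges)
  then have "(\<lambda>k. pmf (Po r) k * a ^ k) sums exp (r * (a - 1))"
    using r by (simp add: Po_def divide_inverse power_mult_distrib mult_ac exp_add[symmetric] right_diff_distrib)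
  then show ?thesis
    using suminf_ennreal_eq[of "\<lambda>k. pmf (Po r) k * a ^ k" "exp (r * (a - 1))"] assms
    by (simp add: ennreal_mult' ennreal_power)
qed

section \<open>Recursive structure of the branching process\<close>

abbreviation label_set :: "real set \<Rightarrow> (particle \<times> real) set" where
  "label_set S \<equiv> lists (S \<times> UNIV) \<times> S"

text \<open>The sample point as seen from the child \<open>a\<close> of the root. The restriction to
  \<open>label_set S\<close> keeps it in the space of the product measure, which consists of
  extensional functions.\<close>

definition subtree :: "real set \<Rightarrow> real \<times> nat \<Rightarrow> (particle \<times> real \<Rightarrow> nat) \<Rightarrow> particle \<times> real \<Rightarrow> nat" where
  "subtree S a N = (\<lambda>j\<in>label_set S. N (a # fst j, snd j))"

text \<open>Weight of the generations before the \<open>d\<close>-th, counting only lines of descent inside \<open>T\<close>.\<close>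

primrec trunc_weight ::
  "real set \<Rightarrow> (real \<Rightarrow> real) \<Rightarrow> real set \<Rightarrow> nat \<Rightarrow> real \<Rightarrow> (particle \<times> real \<Rightarrow> nat) \<Rightarrow> real" where
  "trunc_weight S \<psi> T 0 x N = 0"
| "trunc_weight S \<psi> T (Suc d) x N =
     \<psi> x + (\<Sum>y\<in>T. \<Sum>i<N ([], y). trunc_weight S \<psi> T d y (subtree S (y, i) N))"

definition trunc_produced :: "real set \<Rightarrow> real set \<Rightarrow> nat \<Rightarrow> (particle \<times> real \<Rightarrow> nat) \<Rightarrow> particle set" where
  "trunc_produced S T d N = {p \<in> produced S N. length p < d \<and> p \<in> lists (T \<times> UNIV)}"

text \<open>The branching property in terms of labels: it turns the explicit description of
  \<open>produced\<close> into a recursion along the ancestor in the first generation.\<close>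

lemma Cons_in_produced:
  "(y, i) # q \<in> produced S N \<longleftrightarrow> y \<in> S \<and> i < N ([], y) \<and> q \<in> produced S (subtree S (y, i) N)"
proof (cases "y \<in> S \<and> q \<in> lists (S \<times> UNIV)")
  case True
  have eq: "subtree S (y, i) N (take m q, fst (q ! m)) = N ((y, i) # take m q, fst (q ! m))"
    if "m < length q" for m
  proof -
    have "take m q \<in> lists (S \<times> UNIV)" "fst (q ! m) \<in> S"
      using True that by (auto dest: in_set_takeD nth_mem simp: in_lists_conv_set split: prod.splits)
        (metis SigmaE fst_conv nth_mem)
    then show ?thesis by (simp add: subtree_def)
  qed
  show ?thesis
    using True eq by (auto simp: produced_def All_less_Suc2)
qed (auto simp: produced_def)

lemma trunc_produced_0 [simp]: "trunc_produced S T 0 N = {}"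
  by (simp add: trunc_produced_def)

lemma trunc_produced_Suc:
  assumes "T \<subseteq> S"
  shows "trunc_produced S T (Suc d) N =
    insert [] (\<Union>a\<in>(SIGMA y:T. {..<N ([], y)}). (#) a ` trunc_produced S T d (subtree S a N))"
proof (rule set_eqI)
  fix p
  show "p \<in> trunc_produced S T (Suc d) N \<longleftrightarrow>
    p \<in> insert [] (\<Union>a\<in>(SIGMA y:T. {..<N ([], y)}). (#) a ` trunc_produced S T d (subtree S a N))"
  proof (cases p)
    case Nil
    then show ?thesis by (simp add: trunc_produced_def produced_def)
  next
    case (Cons a q)
    obtain y i where "a = (y, i)" by fastforce
    then show ?thesis
      using Cons assms by (auto simp: trunc_produced_def Cons_in_produced)
  qed
qed

lemma trunc_weight_eq:
  assumes "T \<subseteq> S" "finite T"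
  shows "finite (trunc_produced S T d N) \<and>
    (\<Sum>p\<in>trunc_produced S T d N. \<psi> (particle_type x p)) = trunc_weight S \<psi> T d x N"
proof (induction d arbitrary: N x)
  case (Suc d)
  let ?A = "SIGMA y:T. {..<N ([], y)}"
  let ?B = "\<lambda>a. (#) a ` trunc_produced S T d (subtree S a N)"
  have finA: "finite ?A" using assms by auto
  have finB: "finite (?B a)" for a using Suc by auto
  have type: "particle_type x (a # q) = particle_type (fst a) q" for a q
    by (auto simp: particle_type_def)
  have "(\<Sum>p\<in>trunc_produced S T (Suc d) N. \<psi> (particle_type x p)) =
    \<psi> (particle_type x []) + (\<Sum>p\<in>(\<Union>a\<in>?A. ?B a). \<psi> (particle_type x p))"
    unfolding trunc_produced_Suc[OF assms(1)] using finA finB by (subst sum.insert) auto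
  also have "(\<Sum>p\<in>(\<Union>a\<in>?A. ?B a). \<psi> (particle_type x p)) =
      (\<Sum>a\<in>?A. \<Sum>p\<in>?B a. \<psi> (particle_type x p))"
    using finA finB by (intro sum.UNION_disjoint) auto
  also have "\<dots> = (\<Sum>a\<in>?A. trunc_weight S \<psi> T d (fst a) (subtree S a N))"
    by (intro sum.cong refl) (auto simp: sum.reindex type Suc)
  also have "\<dots> = (\<Sum>y\<in>T. \<Sum>i<N ([], y). trunc_weight S \<psi> T d y (subtree S (y, i) N))"
    using assms by (subst sum.Sigma) (auto simp: case_prod_unfold)
  finally show ?case
    using finA finB by (auto simp: particle_type_def trunc_produced_Suc[OF assms(1)])
qed simp

lemma particle_type_in: "x \<in> S \<Longrightarrow> p \<in> lists (S \<times> UNIV) \<Longrightarrow> particle_type x p \<in> S"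
  by (cases p rule: rev_cases) (auto simp: particle_type_def)

lemma trunc_weight_mono:
  assumes "T \<subseteq> T'" "T' \<subseteq> S" "finite T'" "d \<le> d'" "x \<in> S" "\<And>u. u \<in> S \<Longrightarrow> \<psi> u > 0"
  shows "trunc_weight S \<psi> T d x N \<le> trunc_weight S \<psi> T' d' x N"
proof -
  have T: "T \<subseteq> S" "finite T" using assms by (auto intro: finite_subset)
  have pos: "\<psi> (particle_type x p) > 0" if "p \<in> trunc_produced S T' d' N" for p
  proof -
    have "particle_type x p \<in> S"
      using that assms(5) by (intro particle_type_in) (auto simp: trunc_produced_def produced_def)
    then show ?thesis by (rule assms)
  qed
  have "(\<Sum>p\<in>trunc_produced S T d N. \<psi> (particle_type x p)) \<le>
    (\<Sum>p\<in>trunc_produced S T' d' N. \<psi> (particle_type x p))"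
  proof (rule sum_mono2)
    have "lists (T \<times> (UNIV :: nat set)) \<subseteq> lists (T' \<times> UNIV)"
      using assms by (intro lists_mono) auto
    then show "trunc_produced S T d N \<subseteq> trunc_produced S T' d' N"
      using assms by (auto simp: trunc_produced_def)
  qed (use trunc_weight_eq[OF assms(2,3)] pos in \<open>auto intro: less_imp_le\<close>)
  then show ?thesis
    using trunc_weight_eq[OF T] trunc_weight_eq[OF assms(2,3)] by metis
qed

text \<open>Finitely many particles involve finitely many types and generations, so a single index
  \<open>d\<close> can bound both at once.\<close>

lemma total_weight_eq_SUP:
  assumes "incseq Ts" "\<And>d. finite (Ts d)" "(\<Union>d. Ts d) = S" "x \<in> S" "\<And>u. u \<in> S \<Longrightarrow> \<psi> u > 0"
  shows "total_weight S \<psi> x N = (SUP d. ennreal (trunc_weight S \<psi> (Ts d) d x N))"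
proof -
  have Ts: "Ts d \<subseteq> S" for d using assms by auto
  have pos: "\<psi> (particle_type x p) > 0" if "p \<in> produced S N" for p
  proof -
    have "particle_type x p \<in> S"
      using that assms(4) by (intro particle_type_in) (auto simp: produced_def)
    then show ?thesis by (rule assms)
  qed
  have tw: "ennreal (trunc_weight S \<psi> (Ts d) d x N) =
      (\<Sum>p\<in>trunc_produced S (Ts d) d N. ennreal (\<psi> (particle_type x p)))" for d
  proof -
    have "(\<Sum>p\<in>trunc_produced S (Ts d) d N. ennreal (\<psi> (particle_type x p))) =
       ennreal (\<Sum>p\<in>trunc_produced S (Ts d) d N. \<psi> (particle_type x p))"
      using pos by (intro sum_ennreal) (auto simp: trunc_produced_def intro: less_imp_le)
    then show ?thesis using trunc_weight_eq[OF Ts assms(2)] by metis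
  qed
  have exh: "\<exists>d. F \<subseteq> trunc_produced S (Ts d) d N" if "finite F" "F \<subseteq> produced S N" for F
    using that
  proof (induction F rule: finite_induct)
    case (insert p F)
    then obtain d where d: "F \<subseteq> trunc_produced S (Ts d) d N" by auto
    have fin: "finite (fst ` set p)" by simp
    have "\<exists>e. P \<subseteq> Ts e" if "finite P" "P \<subseteq> S" for P
      using that
    proof (induction P rule: finite_induct)
      case (insert a P)
      then obtain e where "P \<subseteq> Ts e" by auto
      moreover obtain e' where "a \<in> Ts e'" using insert assms(3) by auto
      moreover have "Ts e \<subseteq> Ts (max e e')" "Ts e' \<subseteq> Ts (max e e')"
        by (rule incseqD[OF assms(1)]; simp)+
      ultimately show ?case by (intro exI[of _ "max e e'"]) auto
    qed auto
    moreover have "fst ` set p \<subseteq> S" using insert.prems by (auto simp: produced_def in_lists_conv_set)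
    ultimately obtain e where e: "fst ` set p \<subseteq> Ts e" using fin by blast
    define d' where "d' = max (max d e) (Suc (length p))"
    have T: "Ts d \<subseteq> Ts d'" "Ts e \<subseteq> Ts d'" by (rule incseqD[OF assms(1)]; simp add: d'_def)+
    have "lists (Ts d \<times> (UNIV :: nat set)) \<subseteq> lists (Ts d' \<times> UNIV)"
      using T by (intro lists_mono) auto
    then have "F \<subseteq> trunc_produced S (Ts d') d' N"
      using d by (auto simp: trunc_produced_def d'_def subset_iff)
    moreover have "p \<in> trunc_produced S (Ts d') d' N"
      using subset_trans[OF e T(2)] insert.prems
      by (force simp: trunc_produced_def d'_def in_lists_conv_set)
    ultimately show ?case by blast
  qed auto
  have "total_weight S \<psi> x N =
    (SUP F\<in>{F. finite F \<and> F \<subseteq> produced S N}. \<Sum>p\<in>F. ennreal (\<psi> (particle_type x p)))"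
    unfolding total_weight_def by (rule nonneg_infsum_complete) simp
  also have "\<dots> = (SUP d. ennreal (trunc_weight S \<psi> (Ts d) d x N))"
  proof (rule antisym)
    show "(SUP F\<in>{F. finite F \<and> F \<subseteq> produced S N}. \<Sum>p\<in>F. ennreal (\<psi> (particle_type x p)))
      \<le> (SUP d. ennreal (trunc_weight S \<psi> (Ts d) d x N))"
    proof (rule SUP_least)
      fix F assume "F \<in> {F. finite F \<and> F \<subseteq> produced S N}"
      then obtain d where d: "F \<subseteq> trunc_produced S (Ts d) d N" using exh by blast
      have "(\<Sum>p\<in>F. ennreal (\<psi> (particle_type x p))) \<le> ennreal (trunc_weight S \<psi> (Ts d) d x N)"
        unfolding tw using trunc_weight_eq[OF Ts assms(2)] d by (intro sum_mono2) auto
      also have "\<dots> \<le> (SUP d. ennreal (trunc_weight S \<psi> (Ts d) d x N))" by (rule SUP_upper) simp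
      finally show "(\<Sum>p\<in>F. ennreal (\<psi> (particle_type x p))) \<le> (SUP d. ennreal (trunc_weight S \<psi> (Ts d) d x N))" .
    qed
    show "(SUP d. ennreal (trunc_weight S \<psi> (Ts d) d x N)) \<le>
      (SUP F\<in>{F. finite F \<and> F \<subseteq> produced S N}. \<Sum>p\<in>F. ennreal (\<psi> (particle_type x p)))"
      unfolding tw using trunc_weight_eq[OF Ts assms(2)]
      by (intro SUP_least SUP_upper) (auto simp: trunc_produced_def)
  qed
  finally show ?thesis .
qed

text \<open>Continuity from below of the power, including the exponent \<infinity>, where
  \<open>pow_ennreal\<close> takes the limit as its value.\<close>

lemma pow_ennreal_SUP:
  assumes z: "z > 1" and a: "incseq a" "\<And>d. 0 \<le> a d"
  shows "pow_ennreal z (SUP d. ennreal (a d)) = (SUP d. ennreal (z powr a d))"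
proof -
  have inc: "incseq (\<lambda>d. ennreal (a d))" "incseq (\<lambda>d. ennreal (z powr a d))"
    using a z by (auto simp: incseq_def intro!: ennreal_leI powr_mono)
  have lim: "(\<lambda>d. ennreal (a d)) \<longlonglongrightarrow> (SUP d. ennreal (a d))"
    "(\<lambda>d. ennreal (z powr a d)) \<longlonglongrightarrow> (SUP d. ennreal (z powr a d))"
    using LIMSEQ_SUP[OF inc(1)] LIMSEQ_SUP[OF inc(2)] by auto
  show ?thesis
  proof (cases "(SUP d. ennreal (a d)) = \<infinity>")
    case True
    then have "(\<lambda>d. ennreal (a d)) \<longlonglongrightarrow> top" using lim(1) by (metis infinity_ennreal_def)
    then have "filterlim a at_top sequentially"
      by (simp only: ennreal_tendsto_top_eq_at_top)
    then have "filterlim (\<lambda>d. ln z * a d) at_top sequentially"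
      using z by (intro filterlim_tendsto_pos_mult_at_top[OF tendsto_const]) auto
    then have "filterlim (\<lambda>d. exp (ln z * a d)) at_top sequentially"
      by (rule filterlim_compose[OF exp_at_top])
    then have "filterlim (\<lambda>d. z powr a d) at_top sequentially"
      using z by (simp add: powr_def mult.commute)
    then have "(\<lambda>d. ennreal (z powr a d)) \<longlonglongrightarrow> \<infinity>"
      by (simp add: ennreal_tendsto_top_eq_at_top)
    then have "(SUP d. ennreal (z powr a d)) = \<infinity>" using lim(2) LIMSEQ_unique by blast
    then show ?thesis using True z by (simp only: pow_ennreal_def if_True if_False) simp
  next
    case False
    then obtain r where r: "0 \<le> r" "(SUP d. ennreal (a d)) = ennreal r"
      by (cases "SUP d. ennreal (a d)") auto
    then have "a \<longlonglongrightarrow> r" using lim(1) a by (simp add: tendsto_ennreal_iff)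
    then have "(\<lambda>d. ennreal (z powr a d)) \<longlonglongrightarrow> ennreal (z powr r)"
      using z by (intro tendsto_ennrealI tendsto_powr tendsto_const) auto
    then have "(SUP d. ennreal (z powr a d)) = ennreal (z powr r)" using lim(2) LIMSEQ_unique by blast
    then show ?thesis using r z by (simp add: pow_ennreal_def)
  qed
qed

lemma branching_space_eq:
  "branching_space S \<mu> \<kappa> x =
     PiM (label_set S) (\<lambda>j. measure_pmf (Po (\<kappa> (particle_type x (fst j)) (snd j) * measure \<mu> {snd j})))"
  by (simp add: branching_space_def case_prod_unfold)

lemma sets_branching_space:
  "sets (branching_space S \<mu> \<kappa> x) = sets (PiM (label_set S) (\<lambda>_. count_space UNIV))"
  unfolding branching_space_eq by (rule sets_PiM_pmf)

lemma measurable_subtree: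
  assumes "a \<in> S \<times> UNIV"
  shows "subtree S a \<in> measurable (PiM (label_set S) (\<lambda>_. count_space UNIV)) (PiM (label_set S) (\<lambda>_. count_space UNIV))"
  unfolding subtree_def[abs_def]
  using assms by (intro measurable_restrict measurable_component_singleton) auto

text \<open>Prefixing labels with \<open>a\<close> is an injective reindexing of independent
  coordinates, and it turns the root type into \<open>fst a\<close>. So the descendants of a child
  form a copy of the process started from the type of that child.\<close>

lemma distr_subtree:
  assumes "a \<in> S \<times> UNIV"
  shows "distr (branching_space S \<mu> \<kappa> x) (branching_space S \<mu> \<kappa> (fst a)) (subtree S a) = branching_space S \<mu> \<kappa> (fst a)"
proof -
  let ?f = "\<lambda>j. (a # fst j, snd j)"
  let ?p = "\<lambda>x j. measure_pmf (Po (\<kappa> (particle_type x (fst j)) (snd j) * measure \<mu> {snd j}))"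
  have "branching_space S \<mu> \<kappa> (fst a) = PiM (label_set S) (\<lambda>j. ?p x (?f j))"
    unfolding branching_space_eq by (intro PiM_cong) (auto simp: particle_type_def)
  moreover have "distr (PiM (label_set S) (?p x)) (PiM (label_set S) (\<lambda>j. ?p x (?f j))) (\<lambda>\<omega>. \<lambda>n\<in>label_set S. \<omega> (?f n)) =
     PiM (label_set S) (\<lambda>j. ?p x (?f j))"
    using assms by (intro distr_PiM_reindex measure_pmf.prob_space_axioms) (auto simp: inj_on_def)
  ultimately show ?thesis
    by (simp add: branching_space_eq[of _ _ _ x] subtree_def[abs_def])
qed

lemma measurable_trunc_weight:
  assumes "T \<subseteq> S"
  shows "trunc_weight S \<psi> T d x \<in> borel_measurable (PiM (label_set S) (\<lambda>_. count_space UNIV))"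
proof (induction d arbitrary: x)
  case 0
  have "trunc_weight S \<psi> T 0 x = (\<lambda>_. 0)" by (simp add: fun_eq_iff)
  then show ?case by simp
next
  case (Suc d)
  let ?M = "PiM (label_set S) (\<lambda>_. count_space UNIV) :: (particle \<times> real \<Rightarrow> nat) measure"
  have "(\<lambda>N. \<Sum>i<N ([], y). trunc_weight S \<psi> T d y (subtree S (y, i) N)) \<in> borel_measurable ?M" if "y \<in> T" for y
  proof (rule measurable_compose_countable[where f = "\<lambda>k N. \<Sum>i<k. trunc_weight S \<psi> T d y (subtree S (y, i) N)"])
    show "(\<lambda>N. \<Sum>i<k. trunc_weight S \<psi> T d y (subtree S (y, i) N)) \<in> borel_measurable ?M" for k
      using that assms by (intro borel_measurable_sum measurable_compose[OF measurable_subtree Suc]) auto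
    show "(\<lambda>N. N ([], y)) \<in> measurable ?M (count_space UNIV)"
      using that assms by (intro measurable_component_singleton) auto
  qed
  then show ?case
    by (simp add: borel_measurable_sum)
qed

text \<open>Children of different types, and the subtrees of different children, read disjoint sets
  of coordinates. Independence turns the expectation into a product over types, and the Poisson
  generating function makes every factor an exponential, as in the recursion of
  \<open>gen_fun\<close>.\<close>

lemma nn_integral_trunc_weight:
  fixes c :: real and \<psi> :: "real \<Rightarrow> real"
  defines "\<kappa> \<equiv> rank1_kernel c \<psi>"
  assumes T: "T \<subseteq> S" "finite T" and c: "c > 0" and \<psi>: "\<And>u. u \<in> S \<Longrightarrow> \<psi> u > 0" and z: "z \<ge> 1" and x: "x \<in> S"
  shows "(\<integral>\<^sup>+N. ennreal (z powr trunc_weight S \<psi> T d x N) \<partial>branching_space S \<mu> \<kappa> x) =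
     ennreal (gen_fun \<psi> (\<lambda>y. measure \<mu> {y}) c z T d x)"
  using x
proof (induction d arbitrary: x)
  case 0
  have "prob_space (branching_space S \<mu> \<kappa> x)"
    unfolding branching_space_eq by (rule prob_space_PiM_pmf)
  then show ?case using z by (simp add: prob_space.emeasure_space_1)
next
  case (Suc d)
  let ?M = "branching_space S \<mu> \<kappa> x"
  let ?J = "label_set S"
  let ?p = "\<lambda>j. Po (\<kappa> (particle_type x (fst j)) (snd j) * measure \<mu> {snd j})"
  let ?g = "gen_fun \<psi> (\<lambda>y. measure \<mu> {y}) c z T d"
  have M: "?M = PiM ?J (\<lambda>j. measure_pmf (?p j))" by (rule branching_space_eq)
  have J: "?J \<noteq> {}" using Suc.prems by auto
  define Y where "Y a N = ennreal (z powr trunc_weight S \<psi> T d (fst a) (subtree S a N))" for a N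
  define Q where "Q y N = (\<Prod>i<N ([], y). Y (y, i) N)" for y N
  \<comment> \<open>\<open>K a\<close> consists of the coordinates read by the subtree of the child
    \<open>a\<close>; \<open>B y\<close> consists of those for all possible children of type
    \<open>y\<close>, together with the coordinate giving their number.\<close>
  define K where "K a = {(a # q, y') | q y'. q \<in> lists (S \<times> UNIV) \<and> y' \<in> S}" for a :: "real \<times> nat"
  define B where "B y = insert ([], y) (\<Union>i. K (y, i))" for y :: real
  have KJ: "K a \<subseteq> ?J" if "a \<in> S \<times> UNIV" for a using that by (auto simp: K_def)
  have sub: "subtree S a (\<lambda>j\<in>?J. if j \<in> C then N j else 0) = subtree S a N" if "K a \<subseteq> C" "a \<in> S \<times> UNIV" for a C N
    using that by (force simp: subtree_def K_def fun_eq_iff)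
  have Ymeas: "Y a \<in> borel_measurable ?M" if "a \<in> S \<times> UNIV" for a
  proof -
    have "Y a \<in> borel_measurable (PiM ?J (\<lambda>_. count_space UNIV))"
      unfolding Y_def[abs_def]
      using measurable_compose[OF measurable_subtree[OF that] measurable_trunc_weight[OF T(1)]] by simp
    then show ?thesis by (simp add: measurable_cong_sets[OF sets_branching_space refl])
  qed
  have coord: "(\<lambda>N. N ([], y)) \<in> measurable ?M (count_space UNIV)" if "y \<in> S" for y
  proof -
    have "(\<lambda>N. N ([], y)) \<in> measurable (PiM ?J (\<lambda>_. count_space UNIV)) (count_space UNIV)"
      using that by (intro measurable_component_singleton) auto
    then show ?thesis by (simp add: measurable_cong_sets[OF sets_branching_space refl])
  qed
  have Qmeas: "Q y \<in> borel_measurable ?M" if "y \<in> S" for y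
    unfolding Q_def[abs_def] using that
    by (intro measurable_compose_countable[where f = "\<lambda>k N. \<Prod>i<k. Y (y, i) N", OF _ coord]
        borel_measurable_prod_ennreal Ymeas) auto
  have EY: "(\<integral>\<^sup>+N. Y (y, i) N \<partial>?M) = ennreal (?g y)" if "y \<in> S" for y i
  proof -
    let ?M' = "branching_space S \<mu> \<kappa> y"
    have "(\<integral>\<^sup>+N. ennreal (z powr trunc_weight S \<psi> T d y N) \<partial>distr ?M ?M' (subtree S (y, i))) = (\<integral>\<^sup>+N. Y (y, i) N \<partial>?M)"
    proof (subst nn_integral_distr)
      show "subtree S (y, i) \<in> measurable ?M ?M'"
        using measurable_subtree[of "(y, i)" S] that
        by (simp add: measurable_cong_sets[OF sets_branching_space sets_branching_space])
      have "trunc_weight S \<psi> T d y \<in> borel_measurable ?M'"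
        using measurable_trunc_weight[OF T(1)] by (simp add: measurable_cong_sets[OF sets_branching_space refl])
      then show "(\<lambda>N. ennreal (z powr trunc_weight S \<psi> T d y N)) \<in> borel_measurable (distr ?M ?M' (subtree S (y, i)))"
        by simp
    qed (simp add: Y_def[abs_def])
    then show ?thesis
      using distr_subtree[of "(y, i)" S \<mu> \<kappa> x] Suc.IH[OF that] that by simp
  qed
  have EQ: "(\<integral>\<^sup>+N. Q y N \<partial>?M) = ennreal (exp (c * \<psi> x * (\<psi> y * measure \<mu> {y} * (?g y - 1))))" if y: "y \<in> S" for y
  proof -
    define r where "r = \<kappa> x y * measure \<mu> {y}"
    have r: "r \<ge> 0" using c \<psi>[OF y] \<psi>[OF Suc.prems] by (simp add: r_def \<kappa>_def rank1_kernel_def)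
    have g0: "?g y \<ge> 0"
      using gen_fun_ge_1[OF z c, of T \<psi> "\<lambda>y. measure \<mu> {y}" y d] T \<psi> y by (force intro: order_trans[OF zero_le_one])
    \<comment> \<open>The index \<open>i = k\<close> carries the event of exactly \<open>k\<close>
      children of type \<open>y\<close>. The number of children and their subtrees thereby become
      one finite family of independent factors.\<close>
    define f where "f k i N = (if i = k then of_bool (N ([], y) = k) else Y (y, i) N)" for k i :: nat and N
    have "(\<integral>\<^sup>+N. Q y N \<partial>?M) = (\<integral>\<^sup>+N. (\<Sum>k. \<Prod>i\<in>{..k}. f k i N) \<partial>?M)"
    proof (intro nn_integral_cong)
      fix N
      have "(\<Prod>i\<in>{..k}. f k i N) = of_bool (N ([], y) = k) * (\<Prod>i<k. Y (y, i) N)" for k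
        by (simp add: lessThan_Suc_atMost[symmetric] f_def mult.commute)
      then have "(\<Sum>k. \<Prod>i\<in>{..k}. f k i N) = (\<Sum>k. if k = N ([], y) then Q y N else 0)"
        by (intro suminf_cong) (auto simp: Q_def)
      also have "\<dots> = Q y N"
        using sums_single[of "N ([], y)" "\<lambda>_. Q y N"] by (simp add: sums_iff)
      finally show "Q y N = (\<Sum>k. \<Prod>i\<in>{..k}. f k i N)" by simp
    qed
    also have "\<dots> = (\<Sum>k. \<integral>\<^sup>+N. (\<Prod>i\<in>{..k}. f k i N) \<partial>?M)"
    proof (rule nn_integral_suminf)
      fix k
      have "f k i \<in> borel_measurable ?M" for i
        using Ymeas[of "(y, i)"] y coord[OF y] by (cases "i = k") (auto simp: f_def[abs_def])
      then show "(\<lambda>N. \<Prod>i\<in>{..k}. f k i N) \<in> borel_measurable ?M" by (intro borel_measurable_prod_ennreal)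
    qed
    also have "\<dots> = (\<Sum>k. ennreal (pmf (Po r) k) * ennreal (?g y) ^ k)"
    proof (intro suminf_cong)
      fix k
      define C where "C i = (if i = k then {([], y)} else K (y, i))" for i
      have "(\<integral>\<^sup>+N. (\<Prod>i\<in>{..k}. f k i N) \<partial>?M) = (\<Prod>i\<in>{..k}. \<integral>\<^sup>+N. f k i N \<partial>?M)"
        unfolding M
      proof (rule nn_integral_prod_blocks[OF J, where B = C])
        show "disjoint_family_on C {..k}" by (auto simp: disjoint_family_on_def C_def K_def)
        show "C i \<subseteq> ?J" for i using KJ[of "(y, i)"] y by (auto simp: C_def)
        show "f k i \<in> borel_measurable (PiM ?J (\<lambda>j. measure_pmf (?p j)))" for i
          unfolding M[symmetric] using Ymeas[of "(y, i)"] y coord[OF y]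
          by (cases "i = k") (auto simp: f_def[abs_def])
        show "f k i (\<lambda>j\<in>?J. if j \<in> C i then N j else 0) = f k i N" for i N
          using y sub[of "(y, i)" "C i" N] by (auto simp: f_def C_def Y_def)
      qed simp
      also have "\<dots> = (\<Prod>i<k. \<integral>\<^sup>+N. Y (y, i) N \<partial>?M) * (\<integral>\<^sup>+N. of_bool (N ([], y) = k) \<partial>?M)"
        by (simp add: lessThan_Suc_atMost[symmetric] f_def)
      also have "(\<integral>\<^sup>+N. of_bool (N ([], y) = k) \<partial>?M) = ennreal (pmf (Po r) k)"
      proof -
        have "(\<integral>\<^sup>+N. of_bool (N ([], y) = k) \<partial>?M) =
          (\<integral>\<^sup>+j. of_bool (j = k) \<partial>distr ?M (measure_pmf (?p ([], y))) (\<lambda>N. N ([], y)))"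
          using coord[OF y] by (subst nn_integral_distr) (auto cong: measurable_cong_sets)
        also have "distr ?M (measure_pmf (?p ([], y))) (\<lambda>N. N ([], y)) = measure_pmf (?p ([], y))"
          unfolding M using y by (intro distr_PiM_component measure_pmf.prob_space_axioms) auto
        also have "?p ([], y) = Po r" by (simp add: r_def particle_type_def)
        also have "(\<integral>\<^sup>+j. of_bool (j = k) \<partial>measure_pmf (Po r)) = (\<integral>\<^sup>+j. indicator {k} j \<partial>measure_pmf (Po r))"
          by (intro nn_integral_cong) (auto simp: indicator_def)
        also have "\<dots> = ennreal (pmf (Po r) k)" by (simp add: emeasure_pmf_single)
        finally show ?thesis .
      qed
      finally show "(\<integral>\<^sup>+N. (\<Prod>i\<in>{..k}. f k i N) \<partial>?M) = ennreal (pmf (Po r) k) * ennreal (?g y) ^ k"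
        by (simp add: EY[OF y] mult.commute)
    qed
    also have "\<dots> = ennreal (exp (r * (?g y - 1)))"
      by (rule nn_integral_pgf_Po[OF r g0])
    finally show ?thesis
      by (simp add: r_def \<kappa>_def rank1_kernel_def mult_ac)
  qed
  have "(\<integral>\<^sup>+N. ennreal (z powr trunc_weight S \<psi> T (Suc d) x N) \<partial>?M) =
     (\<integral>\<^sup>+N. ennreal (z powr \<psi> x) * (\<Prod>y\<in>T. Q y N) \<partial>?M)"
  proof (intro nn_integral_cong)
    fix N
    have "z powr trunc_weight S \<psi> T (Suc d) x N = z powr \<psi> x *
      (\<Prod>y\<in>T. \<Prod>i<N ([], y). z powr trunc_weight S \<psi> T d y (subtree S (y, i) N))"
      using z by (simp add: powr_add powr_sum)
    then show "ennreal (z powr trunc_weight S \<psi> T (Suc d) x N) = ennreal (z powr \<psi> x) * (\<Prod>y\<in>T. Q y N)"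
      by (simp add: Q_def Y_def prod_ennreal prod_nonneg ennreal_mult')
  qed
  also have "\<dots> = ennreal (z powr \<psi> x) * (\<integral>\<^sup>+N. (\<Prod>y\<in>T. Q y N) \<partial>?M)"
    using Qmeas T by (intro nn_integral_cmult borel_measurable_prod_ennreal) auto
  also have "(\<integral>\<^sup>+N. (\<Prod>y\<in>T. Q y N) \<partial>?M) = (\<Prod>y\<in>T. \<integral>\<^sup>+N. Q y N \<partial>?M)"
    unfolding M
  proof (rule nn_integral_prod_blocks[OF J T(2), where B = B])
    show "disjoint_family_on B T" by (auto simp: disjoint_family_on_def B_def K_def)
    fix y assume "y \<in> T"
    then have y: "y \<in> S" using T by auto
    have "K (y, i) \<subseteq> ?J" for i using KJ[of "(y, i)"] y by simp
    moreover have "([], y) \<in> ?J" using y by simp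
    ultimately show "B y \<subseteq> ?J" unfolding B_def by blast
    show "Q y \<in> borel_measurable (PiM ?J (\<lambda>j. measure_pmf (?p j)))"
      unfolding M[symmetric] by (rule Qmeas[OF y])
    fix N
    have "subtree S (y, i) (\<lambda>j\<in>?J. if j \<in> B y then N j else 0) = subtree S (y, i) N" for i
      using y by (intro sub) (auto simp: B_def)
    then show "Q y (\<lambda>j\<in>?J. if j \<in> B y then N j else 0) = Q y N"
      using y by (simp add: Q_def Y_def B_def)
  qed
  also have "\<dots> = (\<Prod>y\<in>T. ennreal (exp (c * \<psi> x * (\<psi> y * measure \<mu> {y} * (?g y - 1)))))"
    using T by (intro prod.cong refl EQ) auto
  also have "\<dots> = ennreal (exp (c * \<psi> x * (\<Sum>y\<in>T. \<psi> y * measure \<mu> {y} * (?g y - 1))))"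
    using T by (simp add: prod_ennreal exp_sum sum_distrib_left)
  finally show ?case by (simp add: ennreal_mult')
qed

lemma nn_integral_pow_total_weight:
  assumes "incseq Ts" "\<And>d. finite (Ts d)" "(\<Union>d. Ts d) = S" "x \<in> S" "\<And>u. u \<in> S \<Longrightarrow> \<psi> u > 0" "c > 0" "z > 1"
  shows "(\<integral>\<^sup>+N. pow_ennreal z (total_weight S \<psi> x N) \<partial>branching_space S \<mu> (rank1_kernel c \<psi>) x) =
    (SUP d. ennreal (gen_fun \<psi> (\<lambda>y. measure \<mu> {y}) c z (Ts d) d x))"
proof -
  let ?M = "branching_space S \<mu> (rank1_kernel c \<psi>) x"
  let ?w = "\<lambda>d. trunc_weight S \<psi> (Ts d) d x"
  have Ts: "Ts d \<subseteq> S" for d using assms by auto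
  have mono: "?w d N \<le> ?w d' N" if "d \<le> d'" for d d' N
    using that incseqD[OF assms(1) that] Ts assms by (intro trunc_weight_mono) auto
  have "?w d N \<ge> 0" for d N
    using mono[of 0 d N] by simp
  then have "pow_ennreal z (total_weight S \<psi> x N) = (SUP d. ennreal (z powr ?w d N))" for N
    using total_weight_eq_SUP[OF assms(1-3) assms(4) assms(5)] mono
    by (subst pow_ennreal_SUP[symmetric, OF assms(7)]) (auto simp: incseq_def)
  then have "(\<integral>\<^sup>+N. pow_ennreal z (total_weight S \<psi> x N) \<partial>?M) = (\<integral>\<^sup>+N. (SUP d. ennreal (z powr ?w d N)) \<partial>?M)"
    by simp
  also have "\<dots> = (SUP d. \<integral>\<^sup>+N. ennreal (z powr ?w d N) \<partial>?M)"
  proof (rule nn_integral_monotone_convergence_SUP)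
    show "incseq (\<lambda>d N. ennreal (z powr ?w d N))"
      using mono assms by (auto simp: incseq_def le_fun_def intro!: ennreal_leI powr_mono)
    show "(\<lambda>N. ennreal (z powr ?w d N)) \<in> borel_measurable ?M" for d
    proof -
      have "?w d \<in> borel_measurable ?M"
        using measurable_trunc_weight[OF Ts] by (simp add: measurable_cong_sets[OF sets_branching_space refl])
      then show ?thesis by simp
    qed
  qed
  also have "\<dots> = (SUP d. ennreal (gen_fun \<psi> (\<lambda>y. measure \<mu> {y}) c z (Ts d) d x))"
    using nn_integral_trunc_weight[OF Ts assms(2,6,5)] assms by simp
  finally show ?thesis .
qed

section \<open>The radius \<open>\<alpha>(c)\<close>\<close>

lemma exp_minus_one_le: "exp y - 1 \<le> y * exp (y :: real)"
proof -
  have "(1 - y) * exp y \<le> exp (- y) * exp y"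
    using exp_ge_add_one_self[of "- y"] by (intro mult_right_mono) auto
  then show ?thesis by (simp add: algebra_simps exp_minus)
qed

lemma exp_ge_cube: "(y::real) \<ge> 0 \<Longrightarrow> y ^ 3 / 27 \<le> exp y"
proof -
  assume y: "y \<ge> 0"
  have "y / 3 \<le> exp (y / 3)" using exp_ge_add_one_self[of "y / 3"] by linarith
  then have "(y / 3) ^ 3 \<le> exp (y / 3) ^ 3" using y by (intro power_mono) auto
  then show ?thesis by (simp add: exp_of_nat_mult[symmetric] power_divide)
qed

lemma gen_fun_mono:
  assumes z: "z \<ge> 1" and c: "c > 0" and T: "T \<subseteq> T'" "finite T'"
    and pos: "\<And>y. y \<in> T' \<Longrightarrow> \<psi> y > 0" "\<And>y. m y \<ge> 0" and u: "\<psi> u > 0"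
  shows "gen_fun \<psi> m c z T d u \<le> gen_fun \<psi> m c z T' d u"
  using u
proof (induction d arbitrary: u)
  case (Suc d)
  have "(\<Sum>y\<in>T. \<psi> y * m y * (gen_fun \<psi> m c z T d y - 1)) \<le> (\<Sum>y\<in>T. \<psi> y * m y * (gen_fun \<psi> m c z T' d y - 1))"
    using Suc T pos by (intro sum_mono mult_left_mono diff_right_mono mult_nonneg_nonneg) (auto intro: less_imp_le)
  also have "\<dots> \<le> (\<Sum>y\<in>T'. \<psi> y * m y * (gen_fun \<psi> m c z T' d y - 1))"
    using T pos gen_fun_ge_1[OF z c, of T' \<psi> m] by (intro sum_mono2) (auto intro!: mult_nonneg_nonneg intro: less_imp_le)
  finally show ?case
    using Suc c by (auto intro!: mult_left_mono)
qed simp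

lemma gen_fun_Suc_mono:
  assumes z: "z \<ge> 1" and c: "c > 0"
    and pos: "\<And>y. y \<in> T \<Longrightarrow> \<psi> y > 0" "\<And>y. m y \<ge> 0" and u: "\<psi> u > 0"
  shows "gen_fun \<psi> m c z T d u \<le> gen_fun \<psi> m c z T (Suc d) u"
  using u
proof (induction d arbitrary: u)
  case 0
  then show ?case using gen_fun_ge_1[OF z c, of T \<psi> m u "Suc 0"] pos by simp
next
  case (Suc d)
  have "(\<Sum>y\<in>T. \<psi> y * m y * (gen_fun \<psi> m c z T d y - 1)) \<le> (\<Sum>y\<in>T. \<psi> y * m y * (gen_fun \<psi> m c z T (Suc d) y - 1))"
    using Suc.IH pos by (intro sum_mono mult_left_mono diff_right_mono mult_nonneg_nonneg) (auto intro: less_imp_le)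
  then show ?case
    unfolding gen_fun.simps(2)[of _ _ _ _ _ "Suc d"] gen_fun.simps(2)[of _ _ _ _ _ d u]
    using Suc.prems c by (intro mult_left_mono) auto
qed

locale type_space =
  fixes S :: "real set" and \<mu> :: "real measure" and \<psi> :: "real \<Rightarrow> real" and c a :: real and k0 :: real
  assumes countable_S: "countable S" and \<psi>_pos: "\<And>u. u \<in> S \<Longrightarrow> \<psi> u > 0" and c_pos: "c > 0"
    and k0: "k0 \<in> S" "measure \<mu> {k0} > 0"
    and a_pos: "a > 0" and exp_moment: "(\<lambda>u. exp (a * \<psi> u) * measure \<mu> {u}) summable_on S"
begin

abbreviation m :: "real \<Rightarrow> real" where "m u \<equiv> measure \<mu> {u}"

definition E :: real where "E = (\<Sum>\<^sub>\<infinity>u\<in>S. exp (a * \<psi> u) * m u)"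

lemma exp_sum_le: "finite F \<Longrightarrow> F \<subseteq> S \<Longrightarrow> (\<Sum>u\<in>F. exp (a * \<psi> u) * m u) \<le> E"
  unfolding E_def by (intro finite_sum_le_infsum exp_moment) auto

lemma mean_sum_le: "finite F \<Longrightarrow> F \<subseteq> S \<Longrightarrow> (\<Sum>u\<in>F. \<psi> u * m u) \<le> E / a"
proof -
  assume F: "finite F" "F \<subseteq> S"
  have "(\<Sum>u\<in>F. \<psi> u * m u) \<le> (\<Sum>u\<in>F. exp (a * \<psi> u) * m u / a)"
  proof (intro sum_mono)
    fix u
    have "a * \<psi> u \<le> exp (a * \<psi> u)" using exp_ge_add_one_self[of "a * \<psi> u"] by linarith
    then have "a * \<psi> u * m u \<le> exp (a * \<psi> u) * m u" by (intro mult_right_mono) auto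
    then show "\<psi> u * m u \<le> exp (a * \<psi> u) * m u / a" using a_pos by (simp add: field_simps)
  qed
  also have "\<dots> \<le> E / a"
    unfolding sum_divide_distrib[symmetric] using exp_sum_le[OF F] a_pos by (intro divide_right_mono) auto
  finally show ?thesis .
qed

abbreviation Ephi :: "real \<Rightarrow> real \<Rightarrow> ennreal" where
  "Ephi z x \<equiv> \<integral>\<^sup>+N. pow_ennreal z (total_weight S \<psi> x N) \<partial>branching_space S \<mu> (rank1_kernel c \<psi>) x"

definition I :: "real \<Rightarrow> ennreal" where
  "I z = (\<Sum>\<^sub>\<infinity>x\<in>S. ennreal (\<psi> x) * Ephi z x * ennreal (m x))"

text \<open>
  Says that \<open>u \<mapsto> z powr \<psi> u * exp (c * \<psi> u * s)\<close> is a supersolution of the recursion for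
  \<open>u \<mapsto> Ephi z u\<close>.
\<close>

definition super :: "real \<Rightarrow> real \<Rightarrow> bool" where
  "super z s \<longleftrightarrow> (\<forall>F. finite F \<longrightarrow> F \<subseteq> S \<longrightarrow>
     (\<Sum>u\<in>F. \<psi> u * m u * (z powr \<psi> u * exp (c * \<psi> u * s) - 1)) \<le> s)"

definition Ts :: "nat \<Rightarrow> real set" where "Ts d = {u\<in>S. to_nat_on S u < d}"

lemma Ts: "incseq Ts" "finite (Ts d)" "(\<Union>d. Ts d) = S" "Ts d \<subseteq> S"
proof -
  show "incseq Ts" by (auto simp: incseq_def Ts_def)
  have "inj_on (to_nat_on S) (Ts d)"
    using inj_on_to_nat_on[OF countable_S] by (rule inj_on_subset) (auto simp: Ts_def)
  moreover have "to_nat_on S ` Ts d \<subseteq> {..<d}" by (auto simp: Ts_def)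
  ultimately show "finite (Ts d)" by (meson finite_imageD finite_lessThan finite_subset)
  show "(\<Union>d. Ts d) = S" by (auto simp: Ts_def)
  show "Ts d \<subseteq> S" by (auto simp: Ts_def)
qed

lemma Ts_pos: "u \<in> Ts d \<Longrightarrow> \<psi> u > 0"
  using Ts(4) \<psi>_pos by blast

lemma finite_subset_Ts:
  assumes "finite F" "F \<subseteq> S"
  obtains d0 where "\<And>d. d \<ge> d0 \<Longrightarrow> F \<subseteq> Ts d"
proof (rule that)
  fix d assume d: "d \<ge> Suc (Max (insert 0 (to_nat_on S ` F)))"
  have "u \<in> Ts d" if "u \<in> F" for u
  proof -
    have "to_nat_on S u \<le> Max (insert 0 (to_nat_on S ` F))"
      using that assms by (intro Max_ge) auto
    then have "to_nat_on S u < d" using d by linarith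
    then show ?thesis using that assms by (auto simp: Ts_def)
  qed
  then show "F \<subseteq> Ts d" by auto
qed

abbreviation g where "g z d u \<equiv> gen_fun \<psi> m c z (Ts d) d u"

lemma g_mono: 
  assumes "z \<ge> 1" "u \<in> S" "d \<le> d'"
  shows "g z d u \<le> g z d' u"
proof -
  have "g z d u \<le> g z (Suc d) u" for d
  proof -
    have "g z d u \<le> gen_fun \<psi> m c z (Ts (Suc d)) d u"
      using assms Ts(2) incseqD[OF Ts(1), of d "Suc d"] c_pos \<psi>_pos Ts_pos by (intro gen_fun_mono) auto
    also have "\<dots> \<le> g z (Suc d) u"
      using assms c_pos \<psi>_pos Ts_pos by (intro gen_fun_Suc_mono) (auto simp del: gen_fun.simps)
    finally show ?thesis .
  qed
  then have "incseq (\<lambda>d. g z d u)" by (intro incseq_SucI)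
  then show ?thesis using assms by (auto dest: incseqD)
qed

lemma g_ge_1: "z \<ge> 1 \<Longrightarrow> u \<in> S \<Longrightarrow> g z d u \<ge> 1"
  using Ts(4) c_pos \<psi>_pos by (intro gen_fun_ge_1) auto

text \<open>The right-hand side is the sum in the exponent of the recursion for
  \<open>g z (Suc d)\<close>. Comparing it with a fixed finite \<open>F\<close> permits the passage
  to the limit in \<open>d\<close>.\<close>

lemma partial_sum_le:
  assumes z: "z \<ge> 1" and F: "F \<subseteq> Ts (Suc d)"
  shows "(\<Sum>u\<in>F. \<psi> u * m u * (g z d u - 1)) \<le>
    (\<Sum>u\<in>Ts (Suc d). \<psi> u * m u * (gen_fun \<psi> m c z (Ts (Suc d)) d u - 1))"
proof -
  have mono: "g z d u \<le> gen_fun \<psi> m c z (Ts (Suc d)) d u" if "u \<in> F" for u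
    using z that F Ts(2) incseqD[OF Ts(1), of d "Suc d"] c_pos Ts_pos by (intro gen_fun_mono) auto
  have "(\<Sum>u\<in>F. \<psi> u * m u * (g z d u - 1)) \<le> (\<Sum>u\<in>F. \<psi> u * m u * (gen_fun \<psi> m c z (Ts (Suc d)) d u - 1))"
    using F Ts_pos mono by (intro sum_mono mult_left_mono diff_right_mono mult_nonneg_nonneg) (auto intro: less_imp_le)
  also have "\<dots> \<le> (\<Sum>u\<in>Ts (Suc d). \<psi> u * m u * (gen_fun \<psi> m c z (Ts (Suc d)) d u - 1))"
    using gen_fun_ge_1[of z c "Ts (Suc d)" \<psi> m _ d] z c_pos Ts_pos
    by (intro sum_mono2 F Ts mult_nonneg_nonneg) (auto intro: less_imp_le)
  finally show ?thesis .
qed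

lemma Ephi_eq: "z > 1 \<Longrightarrow> x \<in> S \<Longrightarrow> Ephi z x = (SUP d. ennreal (g z d x))"
  using Ts \<psi>_pos c_pos by (intro nn_integral_pow_total_weight) auto

lemma g_tendsto:
  assumes z: "z > 1" and x: "x \<in> S" and fin: "Ephi z x < \<infinity>"
  shows "(\<lambda>d. g z d x) \<longlonglongrightarrow> enn2real (Ephi z x)" "Ephi z x = ennreal (enn2real (Ephi z x))"
    "g z d x \<le> enn2real (Ephi z x)"
proof -
  show eq: "Ephi z x = ennreal (enn2real (Ephi z x))" using fin by (simp add: less_top)
  have inc: "incseq (\<lambda>d. ennreal (g z d x))"
    using g_mono[of z x] z x by (auto simp: incseq_def intro!: ennreal_leI)
  have "(\<lambda>d. ennreal (g z d x)) \<longlonglongrightarrow> ennreal (enn2real (Ephi z x))"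
    using LIMSEQ_SUP[OF inc] Ephi_eq[OF z x] eq by simp
  then show "(\<lambda>d. g z d x) \<longlonglongrightarrow> enn2real (Ephi z x)"
    using g_ge_1[of z x] z x
    by (subst (asm) tendsto_ennreal_iff) (auto intro!: always_eventually order_trans[OF zero_le_one])
  have "ennreal (g z d x) \<le> Ephi z x" unfolding Ephi_eq[OF z x] by (rule SUP_upper) simp
  then show "g z d x \<le> enn2real (Ephi z x)"
    by (subst (asm) eq) (simp add: ennreal_le_iff)
qed

lemma I_eq_SUP: "I z = (SUP F\<in>{F. finite F \<and> F \<subseteq> S}. \<Sum>x\<in>F. ennreal (\<psi> x) * Ephi z x * ennreal (m x))"
  unfolding I_def by (rule nonneg_infsum_complete) simp

text \<open>\<open>h\<close> is the limit of the truncated generating functions, and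
  \<open>s\<close>, the total of \<open>\<psi> u * m u * (h u - 1)\<close>, is finite because
  \<open>I z\<close> is. The recursion passes to the limit as
  \<open>h x \<ge> z powr \<psi> x * exp (c * \<psi> x * s)\<close> at types of positive measure;
  inserted into the sum for \<open>s\<close>, this is the claim. For a rank-one kernel a single
  number \<open>s\<close> thus replaces an unknown function.\<close>

lemma super_if_I_finite:
  assumes z: "z > 1" and I: "I z < \<infinity>"
  shows "\<exists>s\<ge>0. super z s"
proof -
  \<comment> \<open>At types of measure 0 the expectation may be infinite, and \<open>h\<close> is
    then 0; such types enter all sums with the factor 0.\<close>
  define h where "h x = enn2real (Ephi z x)" for x
  have fin: "Ephi z x < \<infinity>" if x: "x \<in> S" "m x > 0" for x
  proof -
    have "(\<Sum>x\<in>{x}. ennreal (\<psi> x) * Ephi z x * ennreal (m x)) \<le> I z"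
      unfolding I_eq_SUP using x by (intro SUP_upper) auto
    then have "ennreal (\<psi> x) * Ephi z x * ennreal (m x) < \<infinity>" using I by (simp add: le_less_trans)
    then show ?thesis using \<psi>_pos[OF x(1)] x(2)
      by (auto simp: ennreal_mult_less_top less_top[symmetric] ennreal_mult_eq_top_iff ennreal_eq_0_iff)
  qed
  have h1: "h x \<ge> 1" if "x \<in> S" "m x > 0" for x
    using g_tendsto(3)[OF z that(1) fin[OF that], of 0] by (simp add: h_def)
  define f where "f F = (\<Sum>u\<in>F. \<psi> u * m u * (h u - 1))" for F
  have term_nonneg: "\<psi> u * m u * (h u - 1) \<ge> 0" if "u \<in> S" for u
  proof (cases "m u = 0")
    case False
    then have "m u > 0" by (simp add: zero_less_measure_iff less_le)
    then show ?thesis using h1[OF that] \<psi>_pos[OF that] by simp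
  qed simp
  have "f F \<le> enn2real (I z)" if F: "finite F" "F \<subseteq> S" for F
  proof -
    have "ennreal (\<Sum>u\<in>F. \<psi> u * m u * h u) = (\<Sum>u\<in>F. ennreal (\<psi> u * m u * h u))"
      using F \<psi>_pos by (intro sum_ennreal[symmetric]) (auto simp: h_def intro!: mult_nonneg_nonneg intro: less_imp_le)
    also have "\<dots> \<le> (\<Sum>x\<in>F. ennreal (\<psi> x) * Ephi z x * ennreal (m x))"
    proof (intro sum_mono)
      fix u assume "u \<in> F"
      then have "\<psi> u > 0" "u \<in> S" using F \<psi>_pos by auto
      then show "ennreal (\<psi> u * m u * h u) \<le> ennreal (\<psi> u) * Ephi z u * ennreal (m u)"
      proof (cases "m u = 0")
        case False
        then have "m u > 0" by (simp add: less_le)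
        then have "Ephi z u = ennreal (h u)" using g_tendsto(2)[OF z \<open>u \<in> S\<close> fin] \<open>u \<in> S\<close> by (simp add: h_def)
        moreover have "0 \<le> h u" by (simp add: h_def)
        ultimately show ?thesis using \<open>\<psi> u > 0\<close> by (simp add: ennreal_mult mult_ac)
      qed simp
    qed
    also have "\<dots> \<le> I z" unfolding I_eq_SUP using F by (intro SUP_upper) auto
    finally have "(\<Sum>u\<in>F. \<psi> u * m u * h u) \<le> enn2real (I z)"
      using I by (cases "I z") (auto simp: ennreal_le_iff)
    moreover have "f F \<le> (\<Sum>u\<in>F. \<psi> u * m u * h u)"
      unfolding f_def using F \<psi>_pos by (intro sum_mono mult_left_mono mult_nonneg_nonneg) (auto intro: less_imp_le)
    ultimately show ?thesis by linarith
  qed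
  then have bdd: "bdd_above (f ` {F. finite F \<and> F \<subseteq> S})" by (auto intro!: bdd_aboveI2)
  define s where "s = (SUP F\<in>{F. finite F \<and> F \<subseteq> S}. f F)"
  have fs: "f F \<le> s" if "finite F" "F \<subseteq> S" for F
    unfolding s_def using bdd that by (intro cSUP_upper) auto
  have s0: "s \<ge> 0" using fs[of "{}"] by (simp add: f_def)
  have hx: "z powr \<psi> x * exp (c * \<psi> x * s) \<le> h x" if x: "x \<in> S" "m x > 0" for x
  proof -
    have fx: "z powr \<psi> x * exp (c * \<psi> x * f F) \<le> h x" if F: "finite F" "F \<subseteq> S" for F
    proof -
      let ?G = "{u\<in>F. m u > 0}"
      have "f F = (\<Sum>u\<in>?G. \<psi> u * m u * (h u - 1))"
        unfolding f_def using F by (intro sum.mono_neutral_right) (auto simp: less_le)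
      moreover obtain d0 where d0: "\<And>d. d \<ge> d0 \<Longrightarrow> F \<subseteq> Ts d" using finite_subset_Ts[OF F] by blast
      have "(\<lambda>d. z powr \<psi> x * exp (c * \<psi> x * (\<Sum>u\<in>?G. \<psi> u * m u * (g z d u - 1)))) \<longlonglongrightarrow>
        z powr \<psi> x * exp (c * \<psi> x * (\<Sum>u\<in>?G. \<psi> u * m u * (h u - 1)))"
        unfolding h_def using F by (intro tendsto_intros g_tendsto(1)[OF z] fin) auto
      moreover have "z powr \<psi> x * exp (c * \<psi> x * (\<Sum>u\<in>?G. \<psi> u * m u * (g z d u - 1))) \<le> h x" if "d \<ge> d0" for d
      proof -
        have G: "?G \<subseteq> Ts (Suc d)" using d0[OF that] incseqD[OF Ts(1), of d "Suc d"] by auto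
        have "(\<Sum>u\<in>?G. \<psi> u * m u * (g z d u - 1)) \<le>
          (\<Sum>u\<in>Ts (Suc d). \<psi> u * m u * (gen_fun \<psi> m c z (Ts (Suc d)) d u - 1))"
          using z by (intro partial_sum_le G) auto
        then have "z powr \<psi> x * exp (c * \<psi> x * (\<Sum>u\<in>?G. \<psi> u * m u * (g z d u - 1))) \<le> g z (Suc d) x"
          using c_pos \<psi>_pos[OF x(1)] by (auto intro!: mult_left_mono)
        also have "\<dots> \<le> h x" unfolding h_def by (rule g_tendsto(3)[OF z x(1) fin[OF x]])
        finally show ?thesis .
      qed
      ultimately show ?thesis by (auto intro!: LIMSEQ_le_const2)
    qed
    \<comment> \<open>Solved for \<open>f F\<close>, the inequality allows the supremum over
      \<open>F\<close> to be taken.\<close>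
    have "f F \<le> (ln (h x) - \<psi> x * ln z) / (c * \<psi> x)" if F: "finite F" "F \<subseteq> S" for F
    proof -
      have "ln (z powr \<psi> x * exp (c * \<psi> x * f F)) \<le> ln (h x)"
        using fx[OF F] z h1[OF x] by (intro ln_mono) auto
      then have "\<psi> x * ln z + c * \<psi> x * f F \<le> ln (h x)" using z by (simp add: ln_mult ln_powr)
      then show ?thesis using c_pos \<psi>_pos[OF x(1)] by (simp add: field_simps)
    qed
    then have "s \<le> (ln (h x) - \<psi> x * ln z) / (c * \<psi> x)" unfolding s_def by (intro cSUP_least) auto
    then have "\<psi> x * ln z + c * \<psi> x * s \<le> ln (h x)" using c_pos \<psi>_pos[OF x(1)] by (simp add: field_simps)
    then have "exp (\<psi> x * ln z + c * \<psi> x * s) \<le> h x" using h1[OF x] by (simp add: ln_ge_iff)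
    then show ?thesis using z by (simp add: exp_add powr_def)
  qed
  have "super z s"
    unfolding super_def
  proof (intro allI impI)
    fix F assume F: "finite F" "F \<subseteq> S"
    have "(\<Sum>u\<in>F. \<psi> u * m u * (z powr \<psi> u * exp (c * \<psi> u * s) - 1)) \<le> f F"
      unfolding f_def
    proof (intro sum_mono)
      fix u assume u: "u \<in> F"
      show "\<psi> u * m u * (z powr \<psi> u * exp (c * \<psi> u * s) - 1) \<le> \<psi> u * m u * (h u - 1)"
      proof (cases "m u = 0")
        case False
        then have "m u > 0" by (simp add: less_le)
        then show ?thesis using hx[of u] u F \<psi>_pos[of u]
          by (intro mult_left_mono) auto
      qed simp
    qed
    then show "(\<Sum>u\<in>F. \<psi> u * m u * (z powr \<psi> u * exp (c * \<psi> u * s) - 1)) \<le> s" using fs[OF F] by linarith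
  qed
  then show ?thesis using s0 by auto
qed

text \<open>Dropping the subtracted 1 from these sums adds only the mean of \<psi>, which is at most
  \<open>E / a\<close>.\<close>

lemma I_finite_if_bounded:
  assumes "\<And>F. finite F \<Longrightarrow> F \<subseteq> S \<Longrightarrow> (\<Sum>u\<in>F. \<psi> u * m u * (h u - 1)) \<le> s"
    and h: "\<And>u. u \<in> S \<Longrightarrow> m u > 0 \<Longrightarrow> Ephi z u \<le> ennreal (h u)"
    and h0: "\<And>u. u \<in> S \<Longrightarrow> h u \<ge> 0"
  shows "I z < \<infinity>"
proof -
  have "I z \<le> ennreal (s + E / a)"
    unfolding I_eq_SUP
  proof (intro SUP_least)
    fix F assume "F \<in> {F. finite F \<and> F \<subseteq> S}"
    then have F: "finite F" "F \<subseteq> S" by auto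
    have "(\<Sum>x\<in>F. ennreal (\<psi> x) * Ephi z x * ennreal (m x)) \<le> (\<Sum>x\<in>F. ennreal (\<psi> x * m x * h x))"
    proof (intro sum_mono)
      fix u assume "u \<in> F"
      then have u: "u \<in> S" using F by auto
      show "ennreal (\<psi> u) * Ephi z u * ennreal (m u) \<le> ennreal (\<psi> u * m u * h u)"
      proof (cases "m u = 0")
        case False
        then have "m u > 0" by (simp add: less_le)
        then have "ennreal (\<psi> u) * Ephi z u * ennreal (m u) \<le> ennreal (\<psi> u) * ennreal (h u) * ennreal (m u)"
          using h[OF u] by (intro mult_right_mono mult_left_mono) auto
        also have "\<dots> = ennreal (\<psi> u * m u * h u)"
          using \<psi>_pos[OF u] h0[OF u] by (simp add: ennreal_mult' ennreal_mult'' mult_ac)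
        finally show ?thesis .
      qed simp
    qed
    also have "\<dots> = ennreal (\<Sum>x\<in>F. \<psi> x * m x * h x)"
      using F \<psi>_pos h0 by (intro sum_ennreal mult_nonneg_nonneg) (auto intro: less_imp_le)
    also have "\<dots> \<le> ennreal (s + E / a)"
      using assms(1)[OF F] mean_sum_le[OF F]
      by (intro ennreal_leI) (simp add: right_diff_distrib sum_subtractf)
    finally show "(\<Sum>x\<in>F. ennreal (\<psi> x) * Ephi z x * ennreal (m x)) \<le> ennreal (s + E / a)" .
  qed
  then show ?thesis by (simp add: le_less_trans)
qed

lemma I_finite_if_super:
  assumes z: "z > 1" and s: "super z s"
  shows "I z < \<infinity>"
proof (rule I_finite_if_bounded)
  show "(\<Sum>u\<in>F. \<psi> u * m u * (z powr \<psi> u * exp (c * \<psi> u * s) - 1)) \<le> s" if "finite F" "F \<subseteq> S" for F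
    using s that by (simp add: super_def)
  have s0: "s \<ge> 0" using s[unfolded super_def, rule_format, of "{}"] by simp
  have "g z d x \<le> z powr \<psi> x * exp (c * \<psi> x * s)" if "x \<in> S" for x d
  proof -
    \<comment> \<open>The set of types stays fixed during the induction on generations, as it does
      in the recursion of \<open>gen_fun\<close>, whereas \<open>g\<close> changes both with
      \<open>d\<close>.\<close>
    have "gen_fun \<psi> m c z (Ts d') d x \<le> z powr \<psi> x * exp (c * \<psi> x * s)" for d'
      using that
    proof (induction d arbitrary: x)
      case 0
      have "1 * 1 \<le> z powr \<psi> x * exp (c * \<psi> x * s)"
        using z \<psi>_pos[OF 0] c_pos s0 by (intro mult_mono) (auto intro!: ge_one_powr_ge_zero)
      then show ?case by simp
    next
      case (Suc d)
      have "(\<Sum>y\<in>Ts d'. \<psi> y * m y * (gen_fun \<psi> m c z (Ts d') d y - 1)) \<le>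
        (\<Sum>y\<in>Ts d'. \<psi> y * m y * (z powr \<psi> y * exp (c * \<psi> y * s) - 1))"
        using Suc.IH Ts(4) Ts_pos by (intro sum_mono mult_left_mono diff_right_mono mult_nonneg_nonneg) (auto intro: less_imp_le)
      also have "\<dots> \<le> s" using s Ts by (simp add: super_def)
      finally show ?case using c_pos \<psi>_pos[OF Suc.prems] by (auto intro!: mult_left_mono)
    qed
    then show ?thesis .
  qed
  then show "Ephi z x \<le> ennreal (z powr \<psi> x * exp (c * \<psi> x * s))" if "x \<in> S" for x
    unfolding Ephi_eq[OF z that] using that by (intro SUP_least ennreal_leI) auto
qed simp

lemma I_one_finite: "I 1 < \<infinity>"
proof (rule I_finite_if_bounded)
  show "(\<Sum>u\<in>F. \<psi> u * m u * (1 - 1)) \<le> 0" if "finite F" "F \<subseteq> S" for F by simp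
  have "prob_space (branching_space S \<mu> (rank1_kernel c \<psi>) x)" for x
    unfolding branching_space_eq by (rule prob_space_PiM_pmf)
  then show "Ephi 1 x \<le> ennreal 1" for x
    by (simp add: pow_ennreal_def prob_space.emeasure_space_1)
qed simp

text \<open>
  If the truncations \<open>g z d k0\<close> were bounded, then so would be the exponents in the recursion for
  \<open>g\<close>, hence all \<open>g z d x\<close> for each \<open>x\<close>, and \<open>I z\<close> would be finite.
\<close>

lemma gen_fun_large_if_I_infinite:
  assumes z: "z > 1" and I: "I z = \<infinity>"
  shows "\<exists>d. k0 \<in> Ts d \<and> B < gen_fun \<psi> m c z (Ts d) d k0"
proof (rule ccontr)
  assume neg: "\<not> ?thesis"
  obtain d0 where d0: "\<And>d. d \<ge> d0 \<Longrightarrow> {k0} \<subseteq> Ts d" using finite_subset_Ts[of "{k0}"] k0 by blast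
  have bound: "g z d k0 \<le> B" if "d \<ge> d0" for d using neg d0[OF that] by (auto simp: not_less)
  have B1: "B \<ge> 1" using bound[of d0] g_ge_1[of z k0 d0] z k0 by simp
  define s where "s = ln B / (c * \<psi> k0)"
  have s: "(\<Sum>u\<in>Ts (Suc d). \<psi> u * m u * (gen_fun \<psi> m c z (Ts (Suc d)) d u - 1)) \<le> s" if "d \<ge> d0" for d
  proof -
    let ?x = "c * \<psi> k0 * (\<Sum>u\<in>Ts (Suc d). \<psi> u * m u * (gen_fun \<psi> m c z (Ts (Suc d)) d u - 1))"
    have "exp ?x \<le> z powr \<psi> k0 * exp ?x"
      using z \<psi>_pos[OF k0(1)] mult_right_mono[of 1 "z powr \<psi> k0" "exp ?x"] by (simp add: ge_one_powr_ge_zero)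
    also have "\<dots> \<le> B" using bound[of "Suc d"] that by simp
    finally have "?x \<le> ln B" using B1 by (simp add: ln_ge_iff)
    then show ?thesis using c_pos \<psi>_pos[OF k0(1)] by (simp add: s_def field_simps)
  qed
  have gb: "g z d x \<le> z powr \<psi> x * exp (c * \<psi> x * s)" if x: "x \<in> S" for x d
  proof -
    have "g z d x \<le> g z (Suc (max d d0)) x" using z x by (intro g_mono) auto
    also have "\<dots> \<le> z powr \<psi> x * exp (c * \<psi> x * s)"
      using s[of "max d d0"] c_pos \<psi>_pos[OF x] by (auto intro!: mult_left_mono)
    finally show ?thesis .
  qed
  have fin: "Ephi z x < \<infinity>" if "x \<in> S" for x
  proof -
    have "Ephi z x \<le> ennreal (z powr \<psi> x * exp (c * \<psi> x * s))"
      unfolding Ephi_eq[OF z that] using gb[OF that] by (intro SUP_least ennreal_leI)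
    then show ?thesis by (simp add: le_less_trans)
  qed
  have "I z < \<infinity>"
  proof (rule I_finite_if_bounded)
    fix F assume F: "finite F" "F \<subseteq> S"
    obtain d1 where d1: "\<And>d. d \<ge> d1 \<Longrightarrow> F \<subseteq> Ts d" using finite_subset_Ts[OF F] by blast
    have "(\<lambda>d. \<Sum>u\<in>F. \<psi> u * m u * (g z d u - 1)) \<longlonglongrightarrow> (\<Sum>u\<in>F. \<psi> u * m u * (enn2real (Ephi z u) - 1))"
      using F by (intro tendsto_intros g_tendsto(1)[OF z] fin) auto
    moreover have "(\<Sum>u\<in>F. \<psi> u * m u * (g z d u - 1)) \<le> s" if "d \<ge> max d0 d1" for d
    proof -
      have G: "F \<subseteq> Ts (Suc d)" using d1[of "Suc d"] that by simp
      have "(\<Sum>u\<in>F. \<psi> u * m u * (g z d u - 1)) \<le>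
        (\<Sum>u\<in>Ts (Suc d). \<psi> u * m u * (gen_fun \<psi> m c z (Ts (Suc d)) d u - 1))"
        using z by (intro partial_sum_le G) auto
      also have "\<dots> \<le> s" using s that by simp
      finally show ?thesis .
    qed
    ultimately show "(\<Sum>u\<in>F. \<psi> u * m u * (enn2real (Ephi z u) - 1)) \<le> s"
      by (intro LIMSEQ_le_const2) blast+
  qed (use fin in \<open>auto simp: less_top[symmetric]\<close>)
  then show False using I by simp
qed

section \<open>Position of the radius relative to 1\<close>

lemma alpha_eq: "alpha S \<mu> \<psi> c = Sup (ereal ` {z. z \<ge> 1 \<and> I z < \<infinity>})"
  by (simp add: alpha_def I_def)

lemma alpha_ge_1: "alpha S \<mu> \<psi> c \<ge> 1"
proof -
  have "ereal 1 \<le> alpha S \<mu> \<psi> c"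
    unfolding alpha_eq using I_one_finite by (intro Sup_upper) auto
  then show ?thesis by (simp only: one_ereal_def)
qed

lemma less_alpha:
  assumes "ereal z < alpha S \<mu> \<psi> c" "z \<ge> 1"
  shows "\<exists>z1>z. \<exists>s\<ge>0. super z1 s"
proof -
  obtain z1 where "z < z1" "I z1 < \<infinity>" using assms(1) by (auto simp: alpha_eq less_Sup_iff)
  then show ?thesis using super_if_I_finite[of z1] assms(2) by auto
qed

lemma greater_alpha:
  assumes "alpha S \<mu> \<psi> c < ereal z"
  shows "z > 1" "I z = \<infinity>"
proof -
  have "1 < ereal z" using alpha_ge_1 assms by (rule le_less_trans)
  then show z: "z > 1" by simp
  show "I z = \<infinity>"
  proof (rule ccontr)
    assume "I z \<noteq> \<infinity>"
    then have "I z < \<infinity>" by (simp add: less_top)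
    then have "ereal z \<le> alpha S \<mu> \<psi> c" unfolding alpha_eq using z by (intro Sup_upper) auto
    then show False using assms by simp
  qed
qed

definition D :: real where "D = (\<Sum>\<^sub>\<infinity>u\<in>S. (\<psi> u)\<^sup>2 * m u)"

lemma D: "D > 0" "\<And>F. finite F \<Longrightarrow> F \<subseteq> S \<Longrightarrow> (\<Sum>u\<in>F. (\<psi> u)\<^sup>2 * m u) \<le> D"
  "\<And>x. (\<And>F. finite F \<Longrightarrow> F \<subseteq> S \<Longrightarrow> (\<Sum>u\<in>F. (\<psi> u)\<^sup>2 * m u) \<le> x) \<Longrightarrow> D \<le> x"
proof -
  have "(\<lambda>u. (\<psi> u)\<^sup>2 * m u) summable_on S"
  proof (rule summable_on_comparison_test)
    show "(\<lambda>u. 2 / a\<^sup>2 * (exp (a * \<psi> u) * m u)) summable_on S"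
      by (intro summable_on_cmult_right exp_moment)
    fix u assume u: "u \<in> S"
    have "(a * \<psi> u)\<^sup>2 / 2 \<le> exp (a * \<psi> u)"
      using exp_lower_Taylor_quadratic[of "a * \<psi> u"] a_pos \<psi>_pos[OF u] mult_pos_pos[OF a_pos \<psi>_pos[OF u]] by linarith
    then have "(\<psi> u)\<^sup>2 \<le> 2 / a\<^sup>2 * exp (a * \<psi> u)" using a_pos by (simp add: power_mult_distrib field_simps)
    then have "(\<psi> u)\<^sup>2 * m u \<le> 2 / a\<^sup>2 * exp (a * \<psi> u) * m u" by (intro mult_right_mono) auto
    then show "(\<psi> u)\<^sup>2 * m u \<le> 2 / a\<^sup>2 * (exp (a * \<psi> u) * m u)" by (simp add: mult_ac)
  qed simp
  note summ = this
  show le: "\<And>F. finite F \<Longrightarrow> F \<subseteq> S \<Longrightarrow> (\<Sum>u\<in>F. (\<psi> u)\<^sup>2 * m u) \<le> D"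
    unfolding D_def by (intro finite_sum_le_infsum summ) auto
  have "0 < (\<psi> k0)\<^sup>2 * m k0" using k0 \<psi>_pos[OF k0(1)] by simp
  then show "D > 0" using le[of "{k0}"] k0 by simp
  show "\<And>x. (\<And>F. finite F \<Longrightarrow> F \<subseteq> S \<Longrightarrow> (\<Sum>u\<in>F. (\<psi> u)\<^sup>2 * m u) \<le> x) \<Longrightarrow> D \<le> x"
    unfolding D_def by (rule infsum_le_finite_sums[OF summ])
qed

lemma c_cr_eq: "c_cr S \<mu> \<psi> = inverse D"
  by (simp add: c_cr_def D_def)

text \<open>Linearisation at \<open>z = 1\<close>. For \<open>z = exp \<tau>\<close> and
  \<open>s = \<tau> * \<sigma>\<close> the supersolution is \<open>exp (u * \<psi>)\<close> with
  \<open>u = \<tau> * (1 + c * \<sigma>)\<close>, and to first order in \<open>u\<close> its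
  inequality reads \<open>(1 + c * \<sigma>) * D \<le> \<sigma>\<close>, solvable with
  \<open>\<sigma> \<ge> 0\<close> exactly if \<open>c * D < 1\<close>. A slightly larger
  \<open>D'\<close>, still below \<open>1 / c\<close>, leaves room for the error.\<close>

lemma alpha_gt_1_if_subcritical:
  assumes "c < c_cr S \<mu> \<psi>"
  shows "alpha S \<mu> \<psi> c > 1"
proof -
  have cD: "D < 1 / c" using assms D(1) c_pos by (simp add: c_cr_eq field_simps)
  define D' where "D' = (D + 1 / c) / 2"
  have D': "D < D'" "D' < 1 / c" "D' > 0" using cD D(1) by (auto simp: D'_def)
  then have cD': "c * D' < 1" using c_pos by (simp add: field_simps)
  \<comment> \<open>Bounds the remainder of the linearisation: for \<open>u \<le> a / 2\<close> one
    has \<open>\<psi>^3 * exp (u * \<psi>) \<le> 216 / a^3 * exp (a * \<psi>)\<close>, where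
    \<open>216 = 27 * 2^3\<close> stems from \<open>exp_ge_cube\<close> at
    \<open>a / 2 * \<psi>\<close>.\<close>
  define C where "C = 216 / a ^ 3 * E"
  have "exp (a * \<psi> k0) * m k0 \<le> E" using exp_sum_le[of "{k0}"] k0 by simp
  moreover have "0 < exp (a * \<psi> k0) * m k0" using k0 by simp
  ultimately have "E > 0" by linarith
  then have C: "C > 0" using a_pos by (simp add: C_def)
  define u where "u = min (a / 2) ((D' - D) / C)"
  have u: "u > 0" "u \<le> a / 2" "u * C \<le> D' - D"
  proof -
    show "u > 0" using a_pos D' C by (simp add: u_def)
    show "u \<le> a / 2" unfolding u_def by (rule min.cobounded1)
    have "u \<le> (D' - D) / C" by (simp add: u_def)
    then show "u * C \<le> D' - D" using C by (simp add: field_simps)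
  qed
  define \<sigma> where "\<sigma> = D' / (1 - c * D')"
  have \<sigma>: "\<sigma> \<ge> 0" "(1 + c * \<sigma>) * D' = \<sigma>" using cD' D' by (auto simp: \<sigma>_def field_simps)
  define \<tau> where "\<tau> = u / (1 + c * \<sigma>)"
  have pos: "1 + c * \<sigma> > 0" using \<sigma> c_pos by (simp add: add_pos_nonneg)
  have \<tau>: "\<tau> > 0" "\<tau> * (1 + c * \<sigma>) = u" using u pos by (auto simp: \<tau>_def)
  have "super (exp \<tau>) (\<tau> * \<sigma>)"
    unfolding super_def
  proof (intro allI impI)
    fix F assume F: "finite F" "F \<subseteq> S"
    have eq: "exp \<tau> powr \<psi> x * exp (c * \<psi> x * (\<tau> * \<sigma>)) = exp (u * \<psi> x)" for x
      by (simp add: powr_def exp_add[symmetric] \<tau>(2)[symmetric] algebra_simps)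
    have "(\<Sum>x\<in>F. \<psi> x * m x * (exp \<tau> powr \<psi> x * exp (c * \<psi> x * (\<tau> * \<sigma>)) - 1)) \<le>
      (\<Sum>x\<in>F. u * (((\<psi> x)\<^sup>2 * m x) + u * (216 / a ^ 3 * (exp (a * \<psi> x) * m x))))"
      unfolding eq
    proof (intro sum_mono)
      fix x assume "x \<in> F"
      then have x: "\<psi> x > 0" using F \<psi>_pos by auto
      let ?e = "exp (u * \<psi> x)"
      have e1: "?e - 1 \<le> u * \<psi> x * ?e" by (rule exp_minus_one_le)
      have "(a / 2 * \<psi> x) ^ 3 / 27 \<le> exp (a / 2 * \<psi> x)" using a_pos x by (intro exp_ge_cube) auto
      then have "\<psi> x ^ 3 \<le> 216 / a ^ 3 * exp (a / 2 * \<psi> x)"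
        using a_pos by (simp add: power_mult_distrib power_divide field_simps)
      moreover have "?e \<le> exp (a / 2 * \<psi> x)" using u x by (simp add: mult_right_mono)
      ultimately have "\<psi> x ^ 3 * ?e \<le> (216 / a ^ 3 * exp (a / 2 * \<psi> x)) * exp (a / 2 * \<psi> x)"
        using x a_pos by (intro mult_mono) auto
      also have "\<dots> = 216 / a ^ 3 * exp (a * \<psi> x)" by (simp add: exp_add[symmetric] mult.assoc)
      finally have cube: "\<psi> x ^ 3 * ?e \<le> 216 / a ^ 3 * exp (a * \<psi> x)" .
      have "(\<psi> x)\<^sup>2 * ?e \<le> (\<psi> x)\<^sup>2 * (1 + u * \<psi> x * ?e)" using e1 by (intro mult_left_mono) auto
      also have "\<dots> = (\<psi> x)\<^sup>2 + u * (\<psi> x ^ 3 * ?e)" by (simp add: power2_eq_square power3_eq_cube algebra_simps)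
      also have "\<dots> \<le> (\<psi> x)\<^sup>2 + u * (216 / a ^ 3 * exp (a * \<psi> x))"
        using cube u by (intro add_left_mono mult_left_mono) auto
      finally have sq: "(\<psi> x)\<^sup>2 * ?e \<le> (\<psi> x)\<^sup>2 + u * (216 / a ^ 3 * exp (a * \<psi> x))" .
      have "\<psi> x * m x * (?e - 1) \<le> \<psi> x * m x * (u * \<psi> x * ?e)"
        using e1 x by (intro mult_left_mono) auto
      also have "\<dots> = u * m x * ((\<psi> x)\<^sup>2 * ?e)" by (simp add: power2_eq_square mult_ac)
      also have "\<dots> \<le> u * m x * ((\<psi> x)\<^sup>2 + u * (216 / a ^ 3 * exp (a * \<psi> x)))"
        using sq u by (intro mult_left_mono) auto
      finally show "\<psi> x * m x * (?e - 1) \<le> u * (((\<psi> x)\<^sup>2 * m x) + u * (216 / a ^ 3 * (exp (a * \<psi> x) * m x)))"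
        by (simp add: algebra_simps)
    qed
    also have "\<dots> = u * ((\<Sum>x\<in>F. (\<psi> x)\<^sup>2 * m x) + u * (216 / a ^ 3 * (\<Sum>x\<in>F. exp (a * \<psi> x) * m x)))"
      by (simp add: sum_distrib_left sum.distrib distrib_left)
    also have "\<dots> \<le> u * (D + u * C)"
      unfolding C_def using D(2)[OF F] exp_sum_le[OF F] u a_pos by (intro mult_left_mono add_mono) auto
    also have "\<dots> \<le> u * D'" using u by (intro mult_left_mono) auto
    also have "\<dots> = \<tau> * ((1 + c * \<sigma>) * D')" by (simp add: \<tau>(2)[symmetric] mult_ac)
    also have "\<dots> = \<tau> * \<sigma>" by (simp only: \<sigma>(2))
    finally show "(\<Sum>x\<in>F. \<psi> x * m x * (exp \<tau> powr \<psi> x * exp (c * \<psi> x * (\<tau> * \<sigma>)) - 1)) \<le> \<tau> * \<sigma>" .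
  qed
  then have "I (exp \<tau>) < \<infinity>" using \<tau> by (intro I_finite_if_super) auto
  then have "ereal (exp \<tau>) \<le> alpha S \<mu> \<psi> c" unfolding alpha_eq using \<tau> by (intro Sup_upper) auto
  moreover have "1 < ereal (exp \<tau>)" using \<tau> by simp
  ultimately show ?thesis by (rule less_le_trans[rotated])
qed

text \<open>\<open>exp y - 1 \<ge> y\<close> turns a supersolution into
  \<open>D * (ln z + c * s) \<le> s\<close>, which is impossible when \<open>c * D \<ge> 1\<close>
  and \<open>ln z > 0\<close>.\<close>

lemma alpha_eq_1_if_supercritical:
  assumes "c_cr S \<mu> \<psi> \<le> c"
  shows "alpha S \<mu> \<psi> c = 1"
proof (rule antisym[OF _ alpha_ge_1])
  have cD: "c * D \<ge> 1" using assms D(1) by (simp add: c_cr_eq field_simps)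
  show "alpha S \<mu> \<psi> c \<le> 1"
    unfolding alpha_eq
  proof (rule Sup_least)
    fix y assume "y \<in> ereal ` {z. z \<ge> 1 \<and> I z < \<infinity>}"
    then obtain z where z: "y = ereal z" "z \<ge> 1" "I z < \<infinity>" by auto
    have "\<not> z > 1"
    proof
      assume "z > 1"
      then obtain s where s: "s \<ge> 0" "super z s" using super_if_I_finite z by blast
      define L where "L = ln z + c * s"
      have L: "L > 0" using \<open>z > 1\<close> s c_pos by (simp add: L_def add_pos_nonneg)
      have "D \<le> s / L"
      proof (rule D(3))
        fix F assume F: "finite F" "F \<subseteq> S"
        have "(\<Sum>u\<in>F. (\<psi> u)\<^sup>2 * m u) * L = (\<Sum>u\<in>F. \<psi> u * m u * (\<psi> u * L))"
          unfolding sum_distrib_right by (intro sum.cong) (auto simp: power2_eq_square)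
        also have "\<dots> \<le> (\<Sum>u\<in>F. \<psi> u * m u * (z powr \<psi> u * exp (c * \<psi> u * s) - 1))"
        proof (intro sum_mono mult_left_mono)
          fix u assume u: "u \<in> F"
          have "z powr \<psi> u * exp (c * \<psi> u * s) = exp (\<psi> u * L)"
            using \<open>z > 1\<close> by (simp add: L_def powr_def exp_add[symmetric] algebra_simps)
          then show "\<psi> u * L \<le> z powr \<psi> u * exp (c * \<psi> u * s) - 1"
            using exp_ge_add_one_self[of "\<psi> u * L"] by linarith
          show "0 \<le> \<psi> u * m u" using u F \<psi>_pos[of u] by auto
        qed
        also have "\<dots> \<le> s" using s F by (simp add: super_def)
        finally show "(\<Sum>u\<in>F. (\<psi> u)\<^sup>2 * m u) \<le> s / L" using L by (simp add: field_simps)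
      qed
      then have "D * ln z + c * D * s \<le> s" using L by (simp add: L_def field_simps)
      moreover have "s \<le> c * D * s" using cD s mult_right_mono[of 1 "c * D" s] by simp
      moreover have "D * ln z > 0" using D(1) \<open>z > 1\<close> by simp
      ultimately show False by linarith
    qed
    then show "y \<le> 1" using z by simp
  qed
qed

end

section \<open>Bounds given the types\<close>

context type_space
begin

definition close_types :: "real \<Rightarrow> real \<Rightarrow> nat \<Rightarrow> (nat \<Rightarrow> real) \<Rightarrow> bool" where
  "close_types \<epsilon> q n t \<longleftrightarrow>
     (\<forall>k\<in>S. \<bar>card {i\<in>{1..n}. t i = k} / n - m k\<bar> \<le> \<epsilon> * exp (q * \<psi> k) * m k)"

text \<open>The tolerances \<epsilon> and \<open>q\<close> are fixed before the bound \<epsilon>',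
  so one notion of typical types serves all bounds; on typical types the estimate is uniform in
  \<open>t\<close>.\<close>

definition unlikely :: "(nat \<Rightarrow> (nat \<Rightarrow> real) \<Rightarrow> nat set set \<Rightarrow> bool) \<Rightarrow> bool" where
  "unlikely B \<longleftrightarrow> (\<exists>\<epsilon>>0. \<exists>q>0. \<forall>\<epsilon>'>0. \<exists>n0. \<forall>n\<ge>n0. \<forall>t\<in>{1..n} \<rightarrow> S. close_types \<epsilon> q n t \<longrightarrow>
     bern (pairs {1..n}) (eprob c \<psi> n t) (\<lambda>H. of_bool (B n t H)) \<le> \<epsilon>')"

text \<open>
  Shrinking the base from \<open>z1\<close> to \<open>z\<close> leaves room in the supersolution to absorb the factor
  \<open>1 + \<epsilon> e\<^sup>q\<^sup>\<psi>\<close> by which the empirical distribution may exceed \<open>\<mu>\<close>.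
\<close>

lemma heavy_unlikely:
  assumes z: "1 < z" "z < z1" and s: "s \<ge> 0" "super z1 s"
  shows "unlikely (\<lambda>n t H. \<exists>v\<in>{1..n}. ln n / ln z < (\<Sum>i\<in>reach H {v}. \<psi> (t i)))"
proof -
  \<comment> \<open>The exponent for which \<open>exp (q * \<psi> u) * h u = h1 u\<close> holds
    exactly.\<close>
  define q where "q = ln z1 - ln z"
  have q: "q > 0" using z by (simp add: q_def)
  define h1 where "h1 u = z1 powr \<psi> u * exp (c * \<psi> u * s)" for u
  define h where "h u = z powr \<psi> u * exp (c * \<psi> u * s)" for u
  have hh: "1 \<le> h u" "h u < h1 u" "exp (q * \<psi> u) * (h u - 1) \<le> h1 u - 1" if "u \<in> S" for u
  proof -
    have "1 * 1 \<le> h u"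
      unfolding h_def using z \<psi>_pos[OF that] c_pos s by (intro mult_mono) (auto intro!: ge_one_powr_ge_zero)
    then show h1': "1 \<le> h u" by simp
    show "h u < h1 u" unfolding h_def h1_def using z \<psi>_pos[OF that] by (simp add: powr_less_mono2)
    have "exp (q * \<psi> u) * h u = h1 u"
      using z by (simp add: h_def h1_def q_def powr_def exp_add[symmetric] algebra_simps)
    moreover have "1 \<le> exp (q * \<psi> u)" using q \<psi>_pos[OF that] by simp
    ultimately show "exp (q * \<psi> u) * (h u - 1) \<le> h1 u - 1" by (simp add: right_diff_distrib)
  qed
  \<comment> \<open>What is gained at the atom \<open>k0\<close> by passing from \<open>h1\<close>
    to \<open>h\<close>; the errors of size \<epsilon> in the type counts may use up this
    much.\<close>
  define \<Delta> where "\<Delta> = \<psi> k0 * m k0 * (h1 k0 - h k0)"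
  have \<Delta>: "\<Delta> > 0" using k0 \<psi>_pos[OF k0(1)] hh(2)[OF k0(1)] by (simp add: \<Delta>_def)
  define \<epsilon> where "\<epsilon> = \<Delta> / (s + 1)"
  have \<epsilon>: "\<epsilon> > 0" "\<epsilon> * s \<le> \<Delta>" using \<Delta> s by (auto simp: \<epsilon>_def field_simps)
  have sumF: "(\<Sum>k\<in>F. \<psi> k * m k * (h1 k - 1)) \<le> s" if "finite F" "F \<subseteq> S" for F
    using s(2) that by (simp add: super_def h1_def)
  have main: "(\<Sum>k\<in>F. \<psi> k * (m k * (1 + \<epsilon> * exp (q * \<psi> k))) * (h k - 1)) \<le> s" if F: "finite F" "F \<subseteq> S" for F
  proof -
    have nonneg: "0 \<le> \<psi> k * m k * (h k - 1)" "0 \<le> \<psi> k * m k * (h1 k - h k)" "0 \<le> \<psi> k * m k" if "k \<in> S" for k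
      using \<psi>_pos[OF that] hh(1,2)[OF that] by auto
    have "(\<Sum>k\<in>F. \<psi> k * m k * (h k - 1)) \<le> (\<Sum>k\<in>insert k0 F. \<psi> k * m k * (h k - 1))"
      using F nonneg k0 by (intro sum_mono2) auto
    also have "\<dots> = (\<Sum>k\<in>insert k0 F. \<psi> k * m k * (h1 k - 1)) - (\<Sum>k\<in>insert k0 F. \<psi> k * m k * (h1 k - h k))"
      unfolding sum_subtractf[symmetric] by (intro sum.cong) (auto simp: algebra_simps)
    also have "\<dots> \<le> s - (\<Sum>k\<in>{k0}. \<psi> k * m k * (h1 k - h k))"
      using F k0 nonneg by (intro diff_mono sumF sum_mono2) auto
    also have "\<dots> = s - \<Delta>" by (simp add: \<Delta>_def)
    finally have 1: "(\<Sum>k\<in>F. \<psi> k * m k * (h k - 1)) \<le> s - \<Delta>" .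
    have "(\<Sum>k\<in>F. \<psi> k * m k * (exp (q * \<psi> k) * (h k - 1))) \<le> (\<Sum>k\<in>F. \<psi> k * m k * (h1 k - 1))"
      using F hh nonneg by (intro sum_mono mult_left_mono) auto
    also have "\<dots> \<le> s" by (rule sumF[OF F])
    finally have "\<epsilon> * (\<Sum>k\<in>F. \<psi> k * m k * (exp (q * \<psi> k) * (h k - 1))) \<le> \<epsilon> * s"
      using \<epsilon> by (intro mult_left_mono) auto
    with 1 \<epsilon> have "(\<Sum>k\<in>F. \<psi> k * m k * (h k - 1)) + \<epsilon> * (\<Sum>k\<in>F. \<psi> k * m k * (exp (q * \<psi> k) * (h k - 1))) \<le> s"
      by linarith
    then show ?thesis
      by (simp add: sum_distrib_left sum.distrib[symmetric] algebra_simps)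
  qed
  show ?thesis
    unfolding unlikely_def
  proof (rule exI[of _ \<epsilon>], intro conjI \<epsilon>, rule exI[of _ q], intro conjI q allI impI)
    fix \<epsilon>' :: real assume \<epsilon>': "\<epsilon>' > 0"
    \<comment> \<open>At the level \<open>x = ln n / ln z\<close> the power \<open>z powr x\<close>
      equals \<open>n\<close> and cancels the number of vertices; the remaining factor
      \<open>1 / x\<close> makes the bound vanish.\<close>
    have "((\<lambda>n::nat. 2 * s * ln z / ln n) \<longlongrightarrow> 0) sequentially" by real_asymp
    then have "\<forall>\<^sub>F n :: nat in sequentially. 2 * s * ln z / ln n < \<epsilon>'" using \<epsilon>' by (rule order_tendstoD(2))
    then have "\<forall>\<^sub>F n in sequentially. \<forall>t\<in>{1..n} \<rightarrow> S. close_types \<epsilon> q n t \<longrightarrow>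
      bern (pairs {1..n}) (eprob c \<psi> n t)
      (\<lambda>H. of_bool (\<exists>v\<in>{1..n}. ln n / ln z < (\<Sum>i\<in>reach H {v}. \<psi> (t i)))) \<le> \<epsilon>'"
      using eventually_ge_at_top[of 2]
    proof (eventually_elim, intro ballI impI)
      fix n t assume small: "2 * s * ln z / ln n < \<epsilon>'" and n: "2 \<le> n" and t: "t \<in> {1..n} \<rightarrow> S"
        and close: "close_types \<epsilon> q n t"
      have tS: "t i \<in> S" if "i \<in> {1..n}" for i using t that by auto
      have n0: "real n > 0" "ln n > 0" using n by auto
      have sum_le: "(\<Sum>i\<in>{1..n}. \<psi> (t i) * (h (t i) - 1)) \<le> n * s"
      proof -
        let ?F = "t ` {1..n}"
        have F: "finite ?F" "?F \<subseteq> S" using tS by auto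
        have "(\<Sum>i\<in>{1..n}. \<psi> (t i) * (h (t i) - 1)) = (\<Sum>k\<in>?F. \<Sum>i\<in>{i\<in>{1..n}. t i = k}. \<psi> (t i) * (h (t i) - 1))"
          by (intro sum.group[symmetric]) auto
        also have "\<dots> = (\<Sum>k\<in>?F. real (card {i\<in>{1..n}. t i = k}) * (\<psi> k * (h k - 1)))"
          by (intro sum.cong) auto
        also have "\<dots> \<le> (\<Sum>k\<in>?F. (real n * (m k * (1 + \<epsilon> * exp (q * \<psi> k)))) * (\<psi> k * (h k - 1)))"
        proof (intro sum_mono mult_right_mono)
          fix k assume "k \<in> ?F"
          then have k: "k \<in> S" using F by auto
          have "card {i\<in>{1..n}. t i = k} / n \<le> m k * (1 + \<epsilon> * exp (q * \<psi> k))"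
            using close k by (auto simp: close_types_def algebra_simps abs_le_iff)
          then show "real (card {i\<in>{1..n}. t i = k}) \<le> real n * (m k * (1 + \<epsilon> * exp (q * \<psi> k)))"
            using n0 by (simp add: field_simps)
          show "0 \<le> \<psi> k * (h k - 1)" using \<psi>_pos[OF k] hh(1)[OF k] by simp
        qed
        also have "\<dots> = n * (\<Sum>k\<in>?F. \<psi> k * (m k * (1 + \<epsilon> * exp (q * \<psi> k))) * (h k - 1))"
          by (simp add: sum_distrib_left mult_ac)
        also have "\<dots> \<le> n * s" using main[OF F] by (intro mult_left_mono) auto
        finally show ?thesis .
      qed
      define x where "x = ln n / ln z"
      have x: "x > 0" "z powr x = n" using n z by (auto simp: x_def powr_def)
      have "bern (pairs {1..n}) (eprob c \<psi> n t) (\<lambda>H. of_bool (\<exists>v\<in>{1..n}. x < (\<Sum>i\<in>reach H {v}. \<psi> (t i))))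
        \<le> (\<Sum>v\<in>{1..n}. \<psi> (t v) * (h (t v) - 1)) / (x * (z powr x - 1))"
      proof (rule bern_exists_heavy_le[OF _ z(1) x(1)])
        show "0 \<le> eprob c \<psi> n t e \<and> eprob c \<psi> n t e \<le> 1" if "e \<in> pairs {1..n}" for e
          using that tS \<psi>_pos by (intro eprob_bounds[OF c_pos]) auto
        fix i assume i: "i \<in> {1..n}"
        show "0 \<le> \<psi> (t i)" using \<psi>_pos[OF tS[OF i]] by simp
        show "1 \<le> h (t i)" using hh(1)[OF tS[OF i]] .
        have "(\<Prod>j\<in>{1..n} - {i}. 1 + eprob c \<psi> n t {i, j} * (h (t j) - 1))
          \<le> (\<Prod>j\<in>{1..n} - {i}. exp (c * \<psi> (t i) / n * (\<psi> (t j) * (h (t j) - 1))))"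
        proof (intro prod_mono conjI)
          fix j assume "j \<in> {1..n} - {i}"
          then have j: "t j \<in> S" using tS by auto
          have p: "0 \<le> eprob c \<psi> n t {i, j}" "eprob c \<psi> n t {i, j} \<le> c * \<psi> (t i) * \<psi> (t j) / n"
            using c_pos \<psi>_pos[OF j] \<psi>_pos[OF tS[OF i]] by (auto simp: eprob_pair)
          show "0 \<le> 1 + eprob c \<psi> n t {i, j} * (h (t j) - 1)" using p hh(1)[OF j] by simp
          have "eprob c \<psi> n t {i, j} * (h (t j) - 1) \<le> c * \<psi> (t i) * \<psi> (t j) / n * (h (t j) - 1)"
            using p hh(1)[OF j] by (intro mult_right_mono) auto
          then show "1 + eprob c \<psi> n t {i, j} * (h (t j) - 1) \<le> exp (c * \<psi> (t i) / n * (\<psi> (t j) * (h (t j) - 1)))"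
            using exp_ge_add_one_self[of "c * \<psi> (t i) / n * (\<psi> (t j) * (h (t j) - 1))"]
            by (simp only: times_divide_eq_left mult.assoc)
        qed
        also have "\<dots> = exp (c * \<psi> (t i) / n * (\<Sum>j\<in>{1..n} - {i}. \<psi> (t j) * (h (t j) - 1)))"
          by (simp add: exp_sum sum_distrib_left)
        also have "\<dots> \<le> exp (c * \<psi> (t i) / n * (n * s))"
        proof -
          have "(\<Sum>j\<in>{1..n} - {i}. \<psi> (t j) * (h (t j) - 1)) \<le> (\<Sum>j\<in>{1..n}. \<psi> (t j) * (h (t j) - 1))"
            using hh(1) tS \<psi>_pos by (intro sum_mono2) (auto intro!: mult_nonneg_nonneg intro: less_imp_le)
          then have "(\<Sum>j\<in>{1..n} - {i}. \<psi> (t j) * (h (t j) - 1)) \<le> n * s" using sum_le by linarith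
          then show ?thesis
            unfolding exp_le_cancel_iff using c_pos \<psi>_pos[OF tS[OF i]] by (intro mult_left_mono) auto
        qed
        also have "\<dots> = exp (c * \<psi> (t i) * s)" using n0 by simp
        finally show "z powr \<psi> (t i) * (\<Prod>j\<in>{1..n} - {i}. 1 + eprob c \<psi> n t {i, j} * (h (t j) - 1)) \<le> h (t i)"
          unfolding h_def by (intro mult_left_mono) auto
      qed simp
      also have "\<dots> \<le> (n * s) / (x * (real n / 2))"
      proof (intro frac_le sum_le)
        show "x * (real n / 2) \<le> x * (z powr x - 1)" using x n by (intro mult_left_mono) auto
      qed (use x n0 s in auto)
      also have "\<dots> = 2 * s * ln z / ln n" using n0 by (simp add: x_def)
      finally show "bern (pairs {1..n}) (eprob c \<psi> n t)
        (\<lambda>H. of_bool (\<exists>v\<in>{1..n}. ln n / ln z < (\<Sum>i\<in>reach H {v}. \<psi> (t i)))) \<le> \<epsilon>'"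
        using small by (simp add: x_def)
    qed
    then show "\<exists>n0. \<forall>n\<ge>n0. \<forall>t\<in>{1..n} \<rightarrow> S. close_types \<epsilon> q n t \<longrightarrow>
      bern (pairs {1..n}) (eprob c \<psi> n t)
      (\<lambda>H. of_bool (\<exists>v\<in>{1..n}. ln n / ln z < (\<Sum>i\<in>reach H {v}. \<psi> (t i)))) \<le> \<epsilon>'"
      by (simp add: eventually_sequentially)
  qed
qed

text \<open>A base \<open>z0\<close> strictly between the radius and \<open>z\<close> gives both
  arbitrarily large generating functions and a ratio \<open>z0 / z < 1\<close>. Discarding the
  vertices with types outside a finite set \<open>Ts d\<close> only makes clusters lighter, so the
  bound for finitely many types carries over.\<close>

lemma light_unlikely:
  assumes \<alpha>: "alpha S \<mu> \<psi> c < ereal z" and \<beta>: "\<beta> > 0" "\<beta> * ln z < 1"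
  shows "unlikely (\<lambda>n t H. \<forall>v\<in>{1..n}. (\<Sum>i\<in>reach H {v}. \<psi> (t i)) < \<beta> * ln n)"
proof -
  obtain z0 where z0: "alpha S \<mu> \<psi> c < ereal z0" "z0 < z"
  proof -
    obtain y where y: "alpha S \<mu> \<psi> c < y" "y < ereal z" using dense[OF \<alpha>] by auto
    then obtain z0 where "y = ereal z0" using alpha_ge_1 by (cases y) auto
    then show thesis using that y by auto
  qed
  have z1: "1 < z0" "I z0 = \<infinity>" using greater_alpha[OF z0(1)] by auto
  define b where "b = (1 - exp (- (c * \<psi> k0 * \<psi> k0 * m k0 / 8)))\<^sup>2"
  obtain d where d: "k0 \<in> Ts d" "z0 * (1 + 1 / (b * (1 - z0 / z))) < gen_fun \<psi> m c z0 (Ts d) d k0"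
    using gen_fun_large_if_I_infinite[OF z1] by blast
  interpret ft: finite_types \<psi> m c "Ts d"
    by unfold_locales (auto simp: Ts(2) c_pos Ts_pos)
  obtain \<eta> where \<eta>: "\<eta> > 0" and light: "\<And>\<epsilon>. \<epsilon> > 0 \<Longrightarrow> \<exists>n0. \<forall>n\<ge>n0. \<forall>V t. ft.many \<eta> 0 n V t \<longrightarrow>
    bern (pairs V) (eprob c \<psi> n t) (\<lambda>H. of_bool (all_light (\<lambda>i. \<psi> (t i)) (\<beta> * ln n) V H)) \<le> \<epsilon>"
    using finite_types.light_unlikely[OF ft.finite_types_axioms d(1) k0(2) z1(1) z0(2) d(2)[unfolded b_def] \<beta>] by blast
  \<comment> \<open>On finitely many types the weighted error in the frequencies becomes an additive
    one of at most \<open>\<epsilon> * B = \<eta>\<close>.\<close>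
  obtain B where B: "B \<ge> 1" "\<And>k. k \<in> Ts d \<Longrightarrow> exp (1 * \<psi> k) * m k \<le> B"
    using ft.bounded_on_types[where f = "\<lambda>k. exp (1 * \<psi> k) * m k"] by blast
  define \<epsilon> where "\<epsilon> = \<eta> / B"
  have \<epsilon>: "\<epsilon> > 0" using \<eta> B by (simp add: \<epsilon>_def)
  show ?thesis
    unfolding unlikely_def
  proof (rule exI[of _ \<epsilon>], intro conjI \<epsilon>, rule exI[of _ 1], intro conjI allI impI)
    fix \<epsilon>' :: real assume "\<epsilon>' > 0"
    from light[OF this] obtain n0 where n0: "\<forall>n\<ge>n0. \<forall>V t. ft.many \<eta> 0 n V t \<longrightarrow>
      bern (pairs V) (eprob c \<psi> n t) (\<lambda>H. of_bool (all_light (\<lambda>i. \<psi> (t i)) (\<beta> * ln n) V H)) \<le> \<epsilon>'" by blast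
    show "\<exists>n0. \<forall>n\<ge>n0. \<forall>t\<in>{1..n} \<rightarrow> S. close_types \<epsilon> 1 n t \<longrightarrow>
      bern (pairs {1..n}) (eprob c \<psi> n t)
        (\<lambda>H. of_bool (\<forall>v\<in>{1..n}. (\<Sum>i\<in>reach H {v}. \<psi> (t i)) < \<beta> * ln n)) \<le> \<epsilon>'"
    proof (rule exI[of _ "max 1 n0"], intro allI ballI impI)
      fix n t assume n: "max 1 n0 \<le> n" and t: "t \<in> {1..n} \<rightarrow> S" and close: "close_types \<epsilon> 1 n t"
      have tS: "t i \<in> S" if "i \<in> {1..n}" for i using t that by auto
      define V where "V = {i\<in>{1..n}. t i \<in> Ts d}"
      have "ft.many \<eta> 0 n V t"
        unfolding ft.many_def
      proof (intro conjI ballI)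
        fix k assume k: "k \<in> Ts d"
        then have "k \<in> S" using Ts(4) by auto
        then have "\<bar>card {i\<in>{1..n}. t i = k} / n - m k\<bar> \<le> \<epsilon> * exp (1 * \<psi> k) * m k"
          using close unfolding close_types_def by blast
        also have "\<dots> \<le> \<epsilon> * B" using B(2)[OF k] \<epsilon> by (simp add: mult.assoc)
        also have "\<dots> = \<eta>" using B by (simp add: \<epsilon>_def)
        finally have "m k - \<eta> \<le> card {i\<in>{1..n}. t i = k} / n" by (simp add: abs_le_iff)
        moreover have "{i\<in>V. t i = k} = {i\<in>{1..n}. t i = k}" using k by (auto simp: V_def)
        ultimately show "real n * (m k - \<eta>) + 0 \<le> card {i\<in>V. t i = k}"
          using n by (simp add: field_simps)
      qed (auto simp: V_def)
      have edge: "0 \<le> eprob c \<psi> n t e \<and> eprob c \<psi> n t e \<le> 1" if "e \<in> pairs {1..n}" for e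
        using that tS \<psi>_pos by (intro eprob_bounds[OF c_pos]) auto
      have "bern (pairs {1..n}) (eprob c \<psi> n t) (\<lambda>H. of_bool (\<forall>v\<in>{1..n}. (\<Sum>i\<in>reach H {v}. \<psi> (t i)) < \<beta> * ln n))
        \<le> bern (pairs {1..n}) (eprob c \<psi> n t) (\<lambda>H. of_bool (all_light (\<lambda>i. \<psi> (t i)) (\<beta> * ln n) V (H \<inter> pairs V)))"
      proof (intro bern_mono edge)
        fix H assume H: "H \<subseteq> pairs {1..n}"
        have le: "(\<Sum>i\<in>reach (H \<inter> pairs V) {v}. \<psi> (t i)) \<le> (\<Sum>i\<in>reach H {v}. \<psi> (t i))" if "v \<in> {1..n}" for v
        proof (rule sum_mono2)
          have "reach H {v} \<subseteq> {1..n}" using H that by (intro reach_subset) auto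
          then show "finite (reach H {v})" "\<And>i. i \<in> reach H {v} - reach (H \<inter> pairs V) {v} \<Longrightarrow> 0 \<le> \<psi> (t i)"
            using tS \<psi>_pos by (auto intro: finite_subset intro!: less_imp_le)
        qed (intro reach_mono; simp)
        have "all_light (\<lambda>i. \<psi> (t i)) (\<beta> * ln n) V (H \<inter> pairs V)"
          if light: "\<forall>v\<in>{1..n}. (\<Sum>i\<in>reach H {v}. \<psi> (t i)) < \<beta> * ln n"
          unfolding all_light_def
        proof
          fix v assume "v \<in> V"
          then have "v \<in> {1..n}" by (simp add: V_def)
          then show "(\<Sum>i\<in>reach (H \<inter> pairs V) {v}. \<psi> (t i)) < \<beta> * ln n"
            using le light by (meson le_less_trans)
        qed
        then show "of_bool (\<forall>v\<in>{1..n}. (\<Sum>i\<in>reach H {v}. \<psi> (t i)) < \<beta> * ln n) \<le>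
          (of_bool (all_light (\<lambda>i. \<psi> (t i)) (\<beta> * ln n) V (H \<inter> pairs V)) :: real)"
          by auto
      qed
      also have "\<dots> = bern (pairs V) (eprob c \<psi> n t) (\<lambda>H. of_bool (all_light (\<lambda>i. \<psi> (t i)) (\<beta> * ln n) V H))"
        by (intro bern_marginal finite_pairs pairs_mono) (auto simp: V_def)
      also have "\<dots> \<le> \<epsilon>'" using n0 n \<open>ft.many \<eta> 0 n V t\<close> by simp
      finally show "bern (pairs {1..n}) (eprob c \<psi> n t)
        (\<lambda>H. of_bool (\<forall>v\<in>{1..n}. (\<Sum>i\<in>reach H {v}. \<psi> (t i)) < \<beta> * ln n)) \<le> \<epsilon>'" .
    qed
  qed simp
qed

end


section \<open>Conditioning on the types\<close>

text \<open>The restriction to \<open>{1..n}\<close> places the values in a countable set of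
  extensional functions, over which one can sum.\<close>

definition types_at :: "(nat \<Rightarrow> nat \<Rightarrow> 'w \<Rightarrow> real) \<Rightarrow> nat \<Rightarrow> 'w \<Rightarrow> nat \<Rightarrow> real" where
  "types_at x n \<omega> = (\<lambda>i\<in>{1..n}. x n i \<omega>)"

lemma prod_pairs:
  fixes n :: nat
  shows "(\<Prod>(i, j)\<in>{(i, j). i \<in> {1..n} \<and> j \<in> {1..n} \<and> i < j}. f {i, j}) = (\<Prod>e\<in>pairs {1..n}. f e)"
proof -
  let ?D = "{(i, j). i \<in> {1..n} \<and> j \<in> {1..n} \<and> i < j}"
  have "inj_on (\<lambda>(i, j). {i, j}) ?D" by (auto simp: inj_on_def doubleton_eq_iff)
  moreover have "(\<lambda>(i, j). {i, j}) ` ?D = pairs {1..n}"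
  proof
    show "pairs {1..n} \<subseteq> (\<lambda>(i, j). {i, j}) ` ?D"
    proof
      fix e assume "e \<in> pairs {1..n}"
      then obtain i j where e: "e = {i, j}" "i \<in> {1..n}" "j \<in> {1..n}" "i \<noteq> j" by (auto simp: pairs_def)
      then consider "i < j" | "j < i" by linarith
      then show "e \<in> (\<lambda>(i, j). {i, j}) ` ?D"
      proof cases
        case 1 then show ?thesis using e by (intro image_eqI[of _ _ "(i, j)"]) auto
      next
        case 2 then show ?thesis using e by (intro image_eqI[of _ _ "(j, i)"]) auto
      qed
    qed
  qed (auto simp: pairs_def)
  ultimately show ?thesis
    by (subst prod.reindex_cong[of "\<lambda>(i, j). {i, j}" ?D "pairs {1..n}" f "\<lambda>(i, j). f {i, j}"]) auto
qed

lemma vertex_pairs_eq: "vertex_pairs n = pairs {1..n}"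
  by (simp add: vertex_pairs_def pairs_def)

locale random_graph =
  fixes S :: "real set" and \<mu> :: "real measure" and \<psi> :: "real \<Rightarrow> real" and c :: real
    and M :: "nat \<Rightarrow> 'w measure" and x :: "nat \<Rightarrow> nat \<Rightarrow> 'w \<Rightarrow> real" and G :: "nat \<Rightarrow> 'w \<Rightarrow> nat set set"
  assumes count_S: "countable S" and vs: "vertex_space S \<mu> M x"
    and rg: "inhom_random_graph S (rank1_kernel c \<psi>) M x G"
begin

lemma prob: "prob_space (M n)"
  using vs by (simp add: vertex_space_def)

lemma space_\<mu>: "space \<mu> = S"
  using vs sets_eq_imp_space_eq[of \<mu> "restrict_space borel S"] by (simp add: vertex_space_def space_restrict_space)

lemma singleton_\<mu>: "u \<in> S \<Longrightarrow> {u} \<in> sets \<mu>"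
  using vs by (auto simp: vertex_space_def sets_restrict_space intro!: image_eqI[of _ _ "{u}"])

lemma types_at: "\<omega> \<in> space (M n) \<Longrightarrow> types_at x n \<omega> \<in> {1..n} \<rightarrow>\<^sub>E S"
  using vs measurable_space[of "x n _" "M n" \<mu> \<omega>] by (auto simp: types_at_def vertex_space_def space_\<mu>)

lemma countable_types: "countable ({1..n :: nat} \<rightarrow>\<^sub>E S)"
  using count_S by (intro countable_PiE) auto

lemma G_pairs: "\<omega> \<in> space (M n) \<Longrightarrow> G n \<omega> \<subseteq> pairs {1..n}"
  using rg measurable_space[of "G n" "M n" "count_space (Pow (vertex_pairs n))" \<omega>]
  by (auto simp: inhom_random_graph_def vertex_pairs_eq)

definition cell :: "nat \<Rightarrow> (nat \<Rightarrow> real) \<Rightarrow> 'w set" where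
  "cell n t = {\<omega>\<in>space (M n). \<forall>i\<in>{1..n}. x n i \<omega> = t i}"

lemma cell_iff: "t \<in> {1..n} \<rightarrow>\<^sub>E S \<Longrightarrow> \<omega> \<in> cell n t \<longleftrightarrow> \<omega> \<in> space (M n) \<and> types_at x n \<omega> = t"
  by (auto simp: cell_def types_at_def fun_eq_iff PiE_def extensional_def restrict_def)

lemma sets_cell: "t \<in> {1..n} \<rightarrow>\<^sub>E S \<Longrightarrow> cell n t \<in> sets (M n)"
proof -
  assume t: "t \<in> {1..n} \<rightarrow>\<^sub>E S"
  have "{\<omega>\<in>space (M n). x n i \<omega> = t i} \<in> sets (M n)" if "i \<in> {1..n}" for i
  proof -
    have "x n i \<in> measurable (M n) \<mu>" using vs that by (simp add: vertex_space_def)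
    from measurable_sets[OF this singleton_\<mu>[of "t i"]] show ?thesis
      using PiE_mem[OF t that] by (simp add: vimage_def Int_def conj_commute)
  qed
  then show ?thesis unfolding cell_def by (intro sets.sets_Collect_finite_All) auto
qed

lemma sets_G: "H \<subseteq> pairs {1..n} \<Longrightarrow> {\<omega>\<in>space (M n). G n \<omega> = H} \<in> sets (M n)"
proof -
  assume H: "H \<subseteq> pairs {1..n}"
  have "G n \<in> measurable (M n) (count_space (Pow (pairs {1..n})))"
    using rg by (simp add: inhom_random_graph_def vertex_pairs_eq)
  from measurable_sets[OF this, of "{H}"] show ?thesis
    using H by (auto simp: vimage_def Int_def conj_commute)
qed

text \<open>Types and graph together take only countably many values, so arbitrary predicates of
  them define events.\<close>

lemma event_in_sets: "{\<omega>\<in>space (M n). Q (types_at x n \<omega>) (G n \<omega>)} \<in> sets (M n)"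
proof -
  have "{\<omega>\<in>space (M n). Q (types_at x n \<omega>) (G n \<omega>)} =
    (\<Union>(t, H)\<in>{(t, H) \<in> ({1..n} \<rightarrow>\<^sub>E S) \<times> Pow (pairs {1..n}). Q t H}. cell n t \<inter> {\<omega>\<in>space (M n). G n \<omega> = H})"
  proof (intro equalityI subsetI)
    fix \<omega> assume "\<omega> \<in> {\<omega>\<in>space (M n). Q (types_at x n \<omega>) (G n \<omega>)}"
    then show "\<omega> \<in> (\<Union>(t, H)\<in>{(t, H) \<in> ({1..n} \<rightarrow>\<^sub>E S) \<times> Pow (pairs {1..n}). Q t H}. cell n t \<inter> {\<omega>\<in>space (M n). G n \<omega> = H})"
      using types_at[of \<omega> n] G_pairs[of \<omega> n]
      by (intro UN_I[of "(types_at x n \<omega>, G n \<omega>)"]) (auto simp: cell_iff)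
  qed (auto simp: cell_iff)
  also have "\<dots> \<in> sets (M n)"
  proof (intro sets.countable_UN')
    have "countable (({1..n} \<rightarrow>\<^sub>E S) \<times> Pow (pairs {1..n}))"
      by (intro countable_SIGMA countable_types countable_finite) (auto intro: finite_pairs)
    then show "countable {(t, H) \<in> ({1..n} \<rightarrow>\<^sub>E S) \<times> Pow (pairs {1..n}). Q t H}"
      by (rule countable_subset[rotated]) auto
  qed (auto intro!: sets.Int sets_cell sets_G)
  finally show ?thesis .
qed

text \<open>The link between the sample space and the finite sums: on a cell of constant types, the
  product over \<open>i < j\<close> in the law of the graph is the weight in
  \<open>bern\<close>.\<close>

lemma measure_cell_graph:
  assumes t: "t \<in> {1..n} \<rightarrow>\<^sub>E S"
  shows "measure (M n) {\<omega>\<in>cell n t. B (G n \<omega>)} =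
    measure (M n) (cell n t) * bern (pairs {1..n}) (eprob c \<psi> n t) (\<lambda>H. of_bool (B H))"
proof -
  interpret prob_space "M n" by (rule prob)
  let ?P = "pairs {1..n}"
  let ?C = "\<lambda>H. {\<omega>\<in>space (M n). (\<forall>i\<in>{1..n}. x n i \<omega> = t i) \<and> G n \<omega> = H}"
  have C: "?C H = cell n t \<inter> {\<omega>\<in>space (M n). G n \<omega> = H}" for H by (auto simp: cell_def)
  have one: "measure (M n) (?C H) = measure (M n) (cell n t) * ((\<Prod>e\<in>H. eprob c \<psi> n t e) * (\<Prod>e\<in>?P - H. 1 - eprob c \<psi> n t e))"
    if H: "H \<subseteq> ?P" for H
  proof -
    have "measure (M n) (?C H) = measure (M n) (cell n t) *
      (\<Prod>(i, j)\<in>{(i, j). i \<in> {1..n} \<and> j \<in> {1..n} \<and> i < j}.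
        if {i, j} \<in> H then edge_prob (rank1_kernel c \<psi>) n (t i) (t j) else 1 - edge_prob (rank1_kernel c \<psi>) n (t i) (t j))"
      using rg t H by (auto simp: inhom_random_graph_def vertex_pairs_eq cell_def PiE_def)
    also have "(\<Prod>(i, j)\<in>{(i, j). i \<in> {1..n} \<and> j \<in> {1..n} \<and> i < j}.
        if {i, j} \<in> H then edge_prob (rank1_kernel c \<psi>) n (t i) (t j) else 1 - edge_prob (rank1_kernel c \<psi>) n (t i) (t j))
      = (\<Prod>(i, j)\<in>{(i, j). i \<in> {1..n} \<and> j \<in> {1..n} \<and> i < j}.
        if {i, j} \<in> H then eprob c \<psi> n t {i, j} else 1 - eprob c \<psi> n t {i, j})"
      by (intro prod.cong refl) (auto simp: eprob_def)
    also have "\<dots> = (\<Prod>e\<in>?P. if e \<in> H then eprob c \<psi> n t e else 1 - eprob c \<psi> n t e)"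
      by (rule prod_pairs)
    also have "\<dots> = (\<Prod>e\<in>?P \<inter> H. eprob c \<psi> n t e) * (\<Prod>e\<in>?P \<inter> - H. 1 - eprob c \<psi> n t e)"
      by (subst prod.If_cases) (auto simp: finite_pairs)
    also have "?P \<inter> H = H" using H by auto
    also have "?P \<inter> - H = ?P - H" by auto
    finally show ?thesis .
  qed
  have "{\<omega>\<in>cell n t. B (G n \<omega>)} = (\<Union>H\<in>{H\<in>Pow ?P. B H}. ?C H)"
    using G_pairs by (auto simp: cell_def)
  also have "measure (M n) \<dots> = (\<Sum>H\<in>{H\<in>Pow ?P. B H}. measure (M n) (?C H))"
  proof (rule finite_measure_finite_Union)
    show "finite {H\<in>Pow ?P. B H}" by (simp add: finite_pairs)
    show "?C ` {H\<in>Pow ?P. B H} \<subseteq> sets (M n)"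
      unfolding C using t by (auto intro!: sets.Int sets_cell sets_G)
    show "disjoint_family_on ?C {H\<in>Pow ?P. B H}" by (auto simp: disjoint_family_on_def)
  qed
  also have "\<dots> = (\<Sum>H\<in>{H\<in>Pow ?P. B H}. measure (M n) (cell n t) * ((\<Prod>e\<in>H. eprob c \<psi> n t e) * (\<Prod>e\<in>?P - H. 1 - eprob c \<psi> n t e)))"
    by (intro sum.cong refl one) auto
  also have "\<dots> = (\<Sum>H\<in>Pow ?P. measure (M n) (cell n t) * ((\<Prod>e\<in>H. eprob c \<psi> n t e) * (\<Prod>e\<in>?P - H. 1 - eprob c \<psi> n t e) * of_bool (B H)))"
    by (intro sum.mono_neutral_cong_left) (auto simp: finite_pairs)
  also have "\<dots> = measure (M n) (cell n t) * bern ?P (eprob c \<psi> n t) (\<lambda>H. of_bool (B H))"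
    by (simp add: bern_def sum_distrib_left)
  finally show ?thesis .
qed

lemma measure_event_le:
  assumes "\<epsilon> \<ge> 0" and "\<And>t. t \<in> {1..n} \<rightarrow>\<^sub>E S \<Longrightarrow> A t \<Longrightarrow> bern (pairs {1..n}) (eprob c \<psi> n t) (\<lambda>H. of_bool (B t H)) \<le> \<epsilon>"
  shows "measure (M n) {\<omega>\<in>space (M n). A (types_at x n \<omega>) \<and> B (types_at x n \<omega>) (G n \<omega>)} \<le> \<epsilon>"
proof -
  interpret prob_space "M n" by (rule prob)
  define \<Theta> where "\<Theta> = {t \<in> {1..n} \<rightarrow>\<^sub>E S. A t}"
  define C where "C t = {\<omega>\<in>cell n t. B t (G n \<omega>)}" for t
  have \<Theta>: "countable \<Theta>" unfolding \<Theta>_def using countable_types by (rule countable_subset[rotated]) auto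
  have eq: "{\<omega>\<in>space (M n). A (types_at x n \<omega>) \<and> B (types_at x n \<omega>) (G n \<omega>)} = (\<Union>t\<in>\<Theta>. C t)"
    using types_at by (auto simp: \<Theta>_def C_def cell_iff)
  have setsC: "C t \<in> sets (M n)" if "t \<in> \<Theta>" for t
  proof -
    have "C t = {\<omega>\<in>space (M n). types_at x n \<omega> = t \<and> B t (G n \<omega>)}"
      using that by (auto simp: C_def \<Theta>_def cell_iff)
    then show ?thesis using event_in_sets[of n "\<lambda>t' H. t' = t \<and> B t H"] by simp
  qed
  have "emeasure (M n) (\<Union>t\<in>\<Theta>. C t) = (\<integral>\<^sup>+t. emeasure (M n) (C t) \<partial>count_space \<Theta>)"
    using setsC \<Theta> by (intro emeasure_UN_countable) (auto simp: disjoint_family_on_def C_def \<Theta>_def cell_iff)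
  also have "\<dots> \<le> (\<integral>\<^sup>+t. ennreal \<epsilon> * emeasure (M n) (cell n t) \<partial>count_space \<Theta>)"
  proof (intro nn_integral_mono)
    fix t assume "t \<in> space (count_space \<Theta>)"
    then have t: "t \<in> {1..n} \<rightarrow>\<^sub>E S" "A t" by (auto simp: \<Theta>_def)
    have "measure (M n) (C t) \<le> measure (M n) (cell n t) * \<epsilon>"
      unfolding C_def measure_cell_graph[OF t(1)] using assms(2)[OF t] by (intro mult_left_mono) auto
    then show "emeasure (M n) (C t) \<le> ennreal \<epsilon> * emeasure (M n) (cell n t)"
      using assms(1) by (simp add: emeasure_eq_measure ennreal_mult[symmetric] mult.commute ennreal_leI)
  qed
  also have "\<dots> = ennreal \<epsilon> * (\<integral>\<^sup>+t. emeasure (M n) (cell n t) \<partial>count_space \<Theta>)"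
    by (intro nn_integral_cmult) auto
  also have "(\<integral>\<^sup>+t. emeasure (M n) (cell n t) \<partial>count_space \<Theta>) = emeasure (M n) (\<Union>t\<in>\<Theta>. cell n t)"
    using \<Theta> sets_cell[of _ n]
    by (intro emeasure_UN_countable[symmetric]) (auto simp: disjoint_family_on_def \<Theta>_def cell_iff)
  also have "ennreal \<epsilon> * \<dots> \<le> ennreal \<epsilon> * 1" by (intro mult_left_mono measure_le_1) auto
  finally show ?thesis
    using assms(1) by (simp add: eq emeasure_eq_measure ennreal_le_iff)
qed

end

section \<open>Convergence in probability\<close>

lemma conv_in_prob_cong:
  assumes "\<And>n \<omega>. \<omega> \<in> space (M n) \<Longrightarrow> X n \<omega> = Y n \<omega>"
  shows "conv_in_prob M X L \<longleftrightarrow> conv_in_prob M Y L"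
  by (simp add: conv_in_prob_def assms cong: conj_cong split: ereal.split)

lemma (in random_graph) sum_atoms_le_1:
  assumes "finite F" "F \<subseteq> S"
  shows "(\<Sum>u\<in>F. measure \<mu> {u}) \<le> 1"
proof -
  interpret \<mu>: prob_space \<mu> using vs by (simp add: vertex_space_def)
  have "(\<Sum>u\<in>F. measure \<mu> {u}) = measure \<mu> (\<Union>u\<in>F. {u})"
    using assms singleton_\<mu> by (intro \<mu>.finite_measure_finite_Union[symmetric]) (auto simp: disjoint_family_on_def)
  then show ?thesis using \<mu>.prob_le_1 by simp
qed

text \<open>Countably many null singletons cannot carry mass 1. The atom serves as the type
  \<open>k0\<close> at which clusters are renewed.\<close>

lemma (in random_graph) exists_atom: "\<exists>k\<in>S. measure \<mu> {k} > 0"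
proof (rule ccontr)
  assume neg: "\<not> ?thesis"
  interpret \<mu>: prob_space \<mu> using vs by (simp add: vertex_space_def)
  have "{u} \<in> null_sets \<mu>" if "u \<in> S" for u
    using neg that singleton_\<mu>[OF that] by (auto simp: null_sets_def \<mu>.emeasure_eq_measure not_less measure_le_0_iff)
  then have "(\<Union>u\<in>S. {u}) \<in> null_sets \<mu>" using count_S by (intro null_sets_UN') auto
  then have "emeasure \<mu> (space \<mu>) = 0" by (simp add: space_\<mu> null_sets_def)
  then show False using \<mu>.emeasure_space_1 by simp
qed

lemma (in random_graph) tendsto_zero_if_unlikely:
  assumes A: "(\<lambda>n. measure (M n) {\<omega>\<in>space (M n). A n (types_at x n \<omega>)}) \<longlonglongrightarrow> 1"
    and B: "\<And>\<epsilon>. \<epsilon> > 0 \<Longrightarrow> \<exists>n0. \<forall>n\<ge>n0. \<forall>t\<in>{1..n} \<rightarrow> S. A n t \<longrightarrow>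
      bern (pairs {1..n}) (eprob c \<psi> n t) (\<lambda>H. of_bool (B n t H)) \<le> \<epsilon>"
  shows "(\<lambda>n. measure (M n) {\<omega>\<in>space (M n). B n (types_at x n \<omega>) (G n \<omega>)}) \<longlonglongrightarrow> 0"
proof (rule LIMSEQ_I)
  fix r :: real assume r: "r > 0"
  obtain n0 where n0: "\<forall>n\<ge>n0. \<forall>t\<in>{1..n} \<rightarrow> S. A n t \<longrightarrow>
      bern (pairs {1..n}) (eprob c \<psi> n t) (\<lambda>H. of_bool (B n t H)) \<le> r / 2"
    using B[of "r / 2"] r by auto
  obtain n1 where n1: "\<forall>n\<ge>n1. norm (measure (M n) {\<omega>\<in>space (M n). A n (types_at x n \<omega>)} - 1) < r / 2"
    using LIMSEQ_D[OF A, of "r / 2"] r by auto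
  show "\<exists>no. \<forall>n\<ge>no. norm (measure (M n) {\<omega>\<in>space (M n). B n (types_at x n \<omega>) (G n \<omega>)} - 0) < r"
  proof (rule exI[of _ "max n0 n1"], intro allI impI)
    fix n assume n: "max n0 n1 \<le> n"
    interpret prob_space "M n" by (rule prob)
    let ?A = "{\<omega>\<in>space (M n). A n (types_at x n \<omega>)}"
    let ?AB = "{\<omega>\<in>space (M n). A n (types_at x n \<omega>) \<and> B n (types_at x n \<omega>) (G n \<omega>)}"
    let ?B = "{\<omega>\<in>space (M n). B n (types_at x n \<omega>) (G n \<omega>)}"
    have sets: "?A \<in> sets (M n)" "?AB \<in> sets (M n)" "?B \<in> sets (M n)"
      using event_in_sets[of n "\<lambda>t H. A n t"] event_in_sets[of n "\<lambda>t H. A n t \<and> B n t H"]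
        event_in_sets[of n "B n"] by simp_all
    have "prob ?B \<le> prob (?AB \<union> (space (M n) - ?A))"
      using sets by (intro finite_measure_mono) auto
    also have "\<dots> \<le> prob ?AB + prob (space (M n) - ?A)"
      using sets by (intro measure_subadditive) (auto simp: emeasure_eq_measure)
    also have "prob (space (M n) - ?A) = 1 - prob ?A" by (rule prob_compl[OF sets(1)])
    finally have "prob ?B \<le> prob ?AB + (1 - prob ?A)" .
    moreover have "prob ?AB \<le> r / 2"
      using n0 n r by (intro measure_event_le) (auto simp: PiE_def)
    moreover have "1 - prob ?A < r / 2" using n1 n by (auto simp: abs_if split: if_splits)
    ultimately show "norm (prob ?B - 0) < r" by simp
  qed
qed

locale concentrated_graph =
  random_graph S \<mu> \<psi> c M x G + type_space S \<mu> \<psi> c a k0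
  for S :: "real set" and \<mu> \<psi> c and M :: "nat \<Rightarrow> 'w measure" and x G a k0 +
  assumes close: "\<And>\<epsilon> q. \<epsilon> > 0 \<Longrightarrow> q > 0 \<Longrightarrow>
    (\<lambda>n. measure (M n) {\<omega>\<in>space (M n). close_types \<epsilon> q n (types_at x n \<omega>)}) \<longlonglongrightarrow> 1"
begin

definition X :: "nat \<Rightarrow> (nat \<Rightarrow> real) \<Rightarrow> nat set set \<Rightarrow> real" where
  "X n t H = Max ((\<lambda>v. \<Sum>i\<in>reach H {v}. \<psi> (t i)) ` {1..n}) / ln n"

lemma Max_components:
  assumes "\<omega> \<in> space (M n)"
  shows "Max ((\<lambda>L. \<Sum>i\<in>L. \<psi> (x n i \<omega>)) ` components {1..n} (G n \<omega>)) / ln n = X n (types_at x n \<omega>) (G n \<omega>)"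
proof -
  have "(\<Sum>i\<in>{w\<in>{1..n}. (v, w) \<in> {(a, b). {a, b} \<in> G n \<omega>}\<^sup>*}. \<psi> (x n i \<omega>)) =
    (\<Sum>i\<in>reach (G n \<omega>) {v}. \<psi> (types_at x n \<omega> i))" if "v \<in> {1..n}" for v
  proof (rule sum.cong)
    have "reach (G n \<omega>) {v} \<subseteq> {1..n}" using G_pairs[OF assms] that by (intro reach_subset) auto
    then show "{w\<in>{1..n}. (v, w) \<in> {(a, b). {a, b} \<in> G n \<omega>}\<^sup>*} = reach (G n \<omega>) {v}"
      by (auto simp: reach_def)
    fix i assume "i \<in> reach (G n \<omega>) {v}"
    then show "\<psi> (x n i \<omega>) = \<psi> (types_at x n \<omega> i)"
      using \<open>reach (G n \<omega>) {v} \<subseteq> {1..n}\<close> by (auto simp: types_at_def)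
  qed
  then have "(\<lambda>L. \<Sum>i\<in>L. \<psi> (x n i \<omega>)) ` components {1..n} (G n \<omega>) =
     (\<lambda>v. \<Sum>i\<in>reach (G n \<omega>) {v}. \<psi> (types_at x n \<omega> i)) ` {1..n}"
    unfolding components_def image_image by (intro image_cong refl) simp
  then show ?thesis by (simp add: X_def)
qed

lemma X_gt_iff: "n \<ge> 2 \<Longrightarrow> y < X n t H \<longleftrightarrow> (\<exists>v\<in>{1..n}. y * ln n < (\<Sum>i\<in>reach H {v}. \<psi> (t i)))"
  and X_less_iff: "n \<ge> 2 \<Longrightarrow> X n t H < y \<longleftrightarrow> (\<forall>v\<in>{1..n}. (\<Sum>i\<in>reach H {v}. \<psi> (t i)) < y * ln n)"
proof -
  assume n: "n \<ge> 2"
  then have fin: "finite ((\<lambda>v. \<Sum>i\<in>reach H {v}. \<psi> (t i)) ` {1..n})" "(\<lambda>v. \<Sum>i\<in>reach H {v}. \<psi> (t i)) ` {1..n} \<noteq> {}"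
    by auto
  have ln: "ln (real n) > 0" using n by simp
  show "y < X n t H \<longleftrightarrow> (\<exists>v\<in>{1..n}. y * ln n < (\<Sum>i\<in>reach H {v}. \<psi> (t i)))"
    unfolding X_def pos_less_divide_eq[OF ln] Max_gr_iff[OF fin] by simp
  show "X n t H < y \<longleftrightarrow> (\<forall>v\<in>{1..n}. (\<Sum>i\<in>reach H {v}. \<psi> (t i)) < y * ln n)"
    unfolding X_def pos_divide_less_eq[OF ln] Max_less_iff[OF fin] by simp
qed

lemma X_nonneg:
  assumes "n \<ge> 2" "\<omega> \<in> space (M n)"
  shows "0 \<le> X n (types_at x n \<omega>) (G n \<omega>)"
proof -
  have "0 \<le> (\<Sum>i\<in>reach (G n \<omega>) {1}. \<psi> (types_at x n \<omega> i))"
  proof (intro sum_nonneg)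
    fix i assume i: "i \<in> reach (G n \<omega>) {1}"
    have "reach (G n \<omega>) {1} \<subseteq> {1..n}" using G_pairs[OF assms(2)] assms(1) by (intro reach_subset) auto
    then have "types_at x n \<omega> i \<in> S" using i types_at[OF assms(2)] by auto
    then show "0 \<le> \<psi> (types_at x n \<omega> i)" using \<psi>_pos by (auto intro: less_imp_le)
  qed
  then have "\<not> X n (types_at x n \<omega>) (G n \<omega>) < 0"
    using assms(1) X_less_iff[OF assms(1), of "types_at x n \<omega>" "G n \<omega>" 0] by (auto simp: not_less intro!: bexI[of _ 1])
  then show ?thesis by simp
qed

lemma tendsto_zero_dominated:
  assumes "(\<lambda>n. measure (M n) {\<omega>\<in>space (M n). B n (types_at x n \<omega>) (G n \<omega>)}) \<longlonglongrightarrow> 0"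
    and "\<And>n \<omega>. n \<ge> 2 \<Longrightarrow> \<omega> \<in> space (M n) \<Longrightarrow> P n \<omega> \<Longrightarrow> B n (types_at x n \<omega>) (G n \<omega>)"
  shows "(\<lambda>n. measure (M n) {\<omega>\<in>space (M n). P n \<omega>}) \<longlonglongrightarrow> 0"
proof (rule tendsto_sandwich[OF _ _ tendsto_const assms(1)])
  show "\<forall>\<^sub>F n in sequentially. measure (M n) {\<omega>\<in>space (M n). P n \<omega>} \<le>
    measure (M n) {\<omega>\<in>space (M n). B n (types_at x n \<omega>) (G n \<omega>)}"
    using eventually_ge_at_top[of 2]
  proof eventually_elim
    fix n :: nat assume n: "n \<ge> 2"
    interpret prob_space "M n" by (rule prob)
    show "measure (M n) {\<omega>\<in>space (M n). P n \<omega>} \<le> measure (M n) {\<omega>\<in>space (M n). B n (types_at x n \<omega>) (G n \<omega>)}"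
      using assms(2)[OF n] by (intro finite_measure_mono event_in_sets) auto
  qed
qed simp

lemma tendsto_zero_if_unlikely':
  assumes "unlikely B"
  shows "(\<lambda>n. measure (M n) {\<omega>\<in>space (M n). B n (types_at x n \<omega>) (G n \<omega>)}) \<longlonglongrightarrow> 0"
proof -
  obtain \<epsilon> q where eq: "\<epsilon> > 0" "q > 0" and B: "\<forall>\<epsilon>'>0. \<exists>n0. \<forall>n\<ge>n0. \<forall>t\<in>{1..n} \<rightarrow> S. close_types \<epsilon> q n t \<longrightarrow>
    bern (pairs {1..n}) (eprob c \<psi> n t) (\<lambda>H. of_bool (B n t H)) \<le> \<epsilon>'"
    using assms unfolding unlikely_def by blast
  show ?thesis using B by (intro tendsto_zero_if_unlikely[OF close[OF eq]]) auto
qed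

lemma X_above:
  assumes y: "y > 0" "ereal (exp (1 / y)) < alpha S \<mu> \<psi> c"
  shows "(\<lambda>n. measure (M n) {\<omega>\<in>space (M n). y < X n (types_at x n \<omega>) (G n \<omega>)}) \<longlonglongrightarrow> 0"
proof -
  \<comment> \<open>The base for which \<open>ln n / ln z\<close> is
    \<open>y * ln n\<close>.\<close>
  let ?z = "exp (1 / y)"
  have z: "1 < ?z" using y by simp
  obtain z1 s where z1: "?z < z1" "s \<ge> 0" "super z1 s" using less_alpha[OF y(2)] z by auto
  show ?thesis
  proof (rule tendsto_zero_dominated[OF tendsto_zero_if_unlikely'[OF heavy_unlikely[OF z z1]]])
    fix n \<omega> assume "n \<ge> 2" "y < X n (types_at x n \<omega>) (G n \<omega>)"
    then show "\<exists>v\<in>{1..n}. ln n / ln ?z < (\<Sum>i\<in>reach (G n \<omega>) {v}. \<psi> (types_at x n \<omega> i))"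
      using X_gt_iff[of n y] y(1) by (simp add: mult.commute)
  qed
qed

lemma X_below:
  assumes "0 < \<beta>" "\<beta> < y" "alpha S \<mu> \<psi> c < ereal (exp (1 / y))"
  shows "(\<lambda>n. measure (M n) {\<omega>\<in>space (M n). X n (types_at x n \<omega>) (G n \<omega>) < \<beta>}) \<longlonglongrightarrow> 0"
proof -
  have "\<beta> * ln (exp (1 / y)) < 1" using assms by simp
  then show ?thesis
  proof (intro tendsto_zero_dominated[OF tendsto_zero_if_unlikely'[OF light_unlikely[OF assms(3,1)]]])
    fix n \<omega> assume "n \<ge> 2" "X n (types_at x n \<omega>) (G n \<omega>) < \<beta>"
    then show "\<forall>v\<in>{1..n}. (\<Sum>i\<in>reach (G n \<omega>) {v}. \<psi> (types_at x n \<omega> i)) < \<beta> * ln n"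
      using X_less_iff[of n] by simp
  qed
qed

lemma X_converges: "conv_in_prob M (\<lambda>n \<omega>. X n (types_at x n \<omega>) (G n \<omega>)) (recip_log (alpha S \<mu> \<psi> c))"
proof -
  let ?X = "\<lambda>n \<omega>. X n (types_at x n \<omega>) (G n \<omega>)"
  consider "alpha S \<mu> \<psi> c = 1" | "alpha S \<mu> \<psi> c = \<infinity>" | r where "alpha S \<mu> \<psi> c = ereal r" "r > 1"
    using alpha_ge_1 by (cases "alpha S \<mu> \<psi> c") (auto simp: one_ereal_def order_le_less)
  then show ?thesis
  proof cases
    case 1
    have "(\<lambda>n. measure (M n) {\<omega>\<in>space (M n). b < ?X n \<omega>}) \<longlonglongrightarrow> 1" for b
    proof -
      \<comment> \<open>Every positive level \<open>y\<close> qualifies, since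
        \<open>exp (1 / y) > 1\<close>; \<open>\<bar>b\<bar> + 1\<close> and
        \<open>\<bar>b\<bar> + 2\<close> are merely two ordered positive levels above
        \<open>b\<close>.\<close>
      have "(\<lambda>n. measure (M n) {\<omega>\<in>space (M n). ?X n \<omega> < \<bar>b\<bar> + 1}) \<longlonglongrightarrow> 0"
        using 1 by (intro X_below[of _ "\<bar>b\<bar> + 2"]) (auto simp: one_ereal_def)
      then have lim: "(\<lambda>n. measure (M n) {\<omega>\<in>space (M n). \<not> b < ?X n \<omega>}) \<longlonglongrightarrow> 0"
        by (rule tendsto_zero_dominated[where B = "\<lambda>n t H. X n t H < \<bar>b\<bar> + 1"]) auto
      have "measure (M n) {\<omega>\<in>space (M n). b < ?X n \<omega>} = 1 - measure (M n) {\<omega>\<in>space (M n). \<not> b < ?X n \<omega>}" for n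
        using prob_space.prob_neg[OF prob event_in_sets[of n "\<lambda>t H. b < X n t H"]] by simp
      then show ?thesis using tendsto_diff[OF tendsto_const lim, of 1] by simp
    qed
    then show ?thesis using 1 by (simp add: conv_in_prob_def recip_log_def)
  next
    case 2
    have "(\<lambda>n. measure (M n) {\<omega>\<in>space (M n). \<epsilon> < \<bar>?X n \<omega> - 0\<bar>}) \<longlonglongrightarrow> 0" if "\<epsilon> > 0" for \<epsilon>
    proof (rule tendsto_zero_dominated)
      show "(\<lambda>n. measure (M n) {\<omega>\<in>space (M n). \<epsilon> < ?X n \<omega>}) \<longlonglongrightarrow> 0"
        using that 2 by (intro X_above) auto
    qed (use X_nonneg in force)
    then show ?thesis using 2 by (simp add: conv_in_prob_def recip_log_def zero_ereal_def)
  next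
    case 3
    define l where "l = 1 / ln r"
    have l: "l > 0" "ln r = 1 / l" using 3 by (auto simp: l_def)
    have r: "r = exp (1 / l)" using 3 l by (simp flip: l(2))
    have "(\<lambda>n. measure (M n) {\<omega>\<in>space (M n). \<epsilon> < \<bar>?X n \<omega> - l\<bar>}) \<longlonglongrightarrow> 0" if \<epsilon>: "\<epsilon> > 0" for \<epsilon>
    proof -
      have above: "(\<lambda>n. measure (M n) {\<omega>\<in>space (M n). l + \<epsilon> < ?X n \<omega>}) \<longlonglongrightarrow> 0"
      proof (rule X_above)
        have "1 / (l + \<epsilon>) < 1 / l" using l \<epsilon> by (intro divide_strict_left_mono) auto
        then show "ereal (exp (1 / (l + \<epsilon>))) < alpha S \<mu> \<psi> c" using 3 by (simp add: r)
      qed (use l \<epsilon> in auto)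
      have below: "(\<lambda>n. measure (M n) {\<omega>\<in>space (M n). ?X n \<omega> < l - \<epsilon>}) \<longlonglongrightarrow> 0"
      proof (cases "l - \<epsilon> > 0")
        case True
        show ?thesis
        proof (rule X_below[OF True])
          show "l - \<epsilon> < l - \<epsilon> / 2" using \<epsilon> by simp
          have "1 / l < 1 / (l - \<epsilon> / 2)" using l \<epsilon> True by (intro divide_strict_left_mono) auto
          then show "alpha S \<mu> \<psi> c < ereal (exp (1 / (l - \<epsilon> / 2)))" using 3 by (simp add: r)
        qed
      next
        case False
        show ?thesis
        proof (rule tendsto_zero_dominated[where B = "\<lambda>n t H. False"])
          show "(\<lambda>n. measure (M n) {\<omega>\<in>space (M n). False}) \<longlonglongrightarrow> 0" by simp
        qed (use X_nonneg False in force)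
      qed
      have le: "measure (M n) {\<omega>\<in>space (M n). \<epsilon> < \<bar>?X n \<omega> - l\<bar>} \<le>
        measure (M n) {\<omega>\<in>space (M n). l + \<epsilon> < ?X n \<omega>} + measure (M n) {\<omega>\<in>space (M n). ?X n \<omega> < l - \<epsilon>}" for n
      proof -
        interpret prob_space "M n" by (rule prob)
        have sets: "{\<omega>\<in>space (M n). l + \<epsilon> < ?X n \<omega>} \<in> sets (M n)" "{\<omega>\<in>space (M n). ?X n \<omega> < l - \<epsilon>} \<in> sets (M n)"
          by (rule event_in_sets)+
        have "measure (M n) {\<omega>\<in>space (M n). \<epsilon> < \<bar>?X n \<omega> - l\<bar>} \<le>
          measure (M n) ({\<omega>\<in>space (M n). l + \<epsilon> < ?X n \<omega>} \<union> {\<omega>\<in>space (M n). ?X n \<omega> < l - \<epsilon>})"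
          using sets by (intro finite_measure_mono) (auto simp: abs_if split: if_splits)
        also have "\<dots> \<le> measure (M n) {\<omega>\<in>space (M n). l + \<epsilon> < ?X n \<omega>} + measure (M n) {\<omega>\<in>space (M n). ?X n \<omega> < l - \<epsilon>}"
          using sets by (intro measure_subadditive) (auto simp: emeasure_eq_measure)
        finally show ?thesis .
      qed
      have lim: "(\<lambda>n. measure (M n) {\<omega>\<in>space (M n). l + \<epsilon> < ?X n \<omega>} +
          measure (M n) {\<omega>\<in>space (M n). ?X n \<omega> < l - \<epsilon>}) \<longlonglongrightarrow> 0"
        using tendsto_add[OF above below] by simp
      show ?thesis
        by (rule tendsto_sandwich[OF _ _ tendsto_const lim])
          (rule always_eventually, rule allI, rule measure_nonneg le)+
    qed
    then show ?thesis using 3 by (simp add: conv_in_prob_def recip_log_def l_def one_ereal_def)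
  qed
qed

end

theorem theorem1p3:
  fixes S :: "real set" and \<mu> :: "real measure" and \<psi> :: "real \<Rightarrow> real" and c :: real
    and M :: "nat \<Rightarrow> 'w measure" and x :: "nat \<Rightarrow> nat \<Rightarrow> 'w \<Rightarrow> real"
    and G :: "nat \<Rightarrow> 'w \<Rightarrow> nat set set"
  assumes "S \<subseteq> {0..}" and "countable S"
    and "\<And>u. u \<in> S \<Longrightarrow> \<psi> u > 0" and "c > 0"
    and "vertex_space S \<mu> M x"
    and "inhom_random_graph S (rank1_kernel c \<psi>) M x G"
    and "graphical S \<mu> (rank1_kernel c \<psi>) M G"
    and "bdd_above (\<psi> ` S) \<or>
         ((\<exists>\<psi>\<^sub>0 :: real \<Rightarrow> real. \<exists>A\<^sub>1 A\<^sub>2.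
             mono_on {0..} \<psi>\<^sub>0 \<and> \<not> bdd_above (\<psi>\<^sub>0 ` {0..}) \<and> 0 < A\<^sub>1 \<and> A\<^sub>1 \<le> A\<^sub>2 \<and>
             (\<forall>\<^sub>F u in at_top. u \<in> S \<longrightarrow> A\<^sub>1 * \<psi>\<^sub>0 u \<le> \<psi> u \<and> \<psi> u \<le> A\<^sub>2 * \<psi>\<^sub>0 u)) \<and>
          (\<exists>a>0. (\<lambda>u. exp (a * \<psi> u) * measure \<mu> {u}) summable_on S))"
    and "\<And>\<epsilon> q. \<epsilon> > 0 \<Longrightarrow> q > 0 \<Longrightarrow>
         (\<lambda>n. measure (M n) {\<omega> \<in> space (M n). \<forall>k\<in>S.
            \<bar>card {i\<in>{1..n}. x n i \<omega> = k} / n - measure \<mu> {k}\<bar> \<le> \<epsilon> * exp (q * \<psi> k) * measure \<mu> {k}})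
         \<longlonglongrightarrow> 1"
  shows "conv_in_prob M
           (\<lambda>n \<omega>. Max ((\<lambda>L. \<Sum>i\<in>L. \<psi> (x n i \<omega>)) ` components {1..n} (G n \<omega>)) / ln n)
           (recip_log (alpha S \<mu> \<psi> c)) \<and>
         (c < c_cr S \<mu> \<psi> \<longrightarrow> alpha S \<mu> \<psi> c > 1) \<and>
         (c \<ge> c_cr S \<mu> \<psi> \<longrightarrow> alpha S \<mu> \<psi> c = 1)"
proof -
  interpret rg: random_graph S \<mu> \<psi> c M x G
    using assms by unfold_locales auto
  obtain k0 where k0: "k0 \<in> S" "measure \<mu> {k0} > 0" using rg.exists_atom by auto
  \<comment> \<open>If \<psi> is bounded, the exponential moment is finite because the atoms have
    total mass at most 1.\<close>
  have "\<exists>a>0. (\<lambda>u. exp (a * \<psi> u) * measure \<mu> {u}) summable_on S"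
    using assms(8)
  proof
    assume "bdd_above (\<psi> ` S)"
    then obtain B where B: "\<And>u. u \<in> S \<Longrightarrow> \<psi> u \<le> B" by (auto simp: bdd_above_def)
    have "(\<lambda>u. measure \<mu> {u}) summable_on S"
      using rg.sum_atoms_le_1 by (intro nonneg_bdd_above_summable_on bdd_aboveI2) auto
    then have "(\<lambda>u. exp B * measure \<mu> {u}) summable_on S" by (rule summable_on_cmult_right)
    then have "(\<lambda>u. exp (1 * \<psi> u) * measure \<mu> {u}) summable_on S"
      by (rule summable_on_comparison_test) (auto intro!: mult_right_mono B)
    then show ?thesis by (intro exI[of _ 1]) simp
  qed auto
  then obtain a where a: "a > 0" "(\<lambda>u. exp (a * \<psi> u) * measure \<mu> {u}) summable_on S" by auto
  interpret ts: type_space S \<mu> \<psi> c a k0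
    using assms(2-4) k0 a by unfold_locales auto
  interpret concentrated_graph S \<mu> \<psi> c M x G a k0
  proof unfold_locales
    fix \<epsilon> q :: real assume eq: "\<epsilon> > 0" "q > 0"
    have "{i\<in>{1..n}. types_at x n \<omega> i = k} = {i\<in>{1..n}. x n i \<omega> = k}" for n \<omega> k
      by (auto simp: types_at_def)
    then show "(\<lambda>n. measure (M n) {\<omega>\<in>space (M n). ts.close_types \<epsilon> q n (types_at x n \<omega>)}) \<longlonglongrightarrow> 1"
      using assms(9)[OF eq] by (simp add: ts.close_types_def)
  qed
  have "conv_in_prob M (\<lambda>n \<omega>. Max ((\<lambda>L. \<Sum>i\<in>L. \<psi> (x n i \<omega>)) ` components {1..n} (G n \<omega>)) / ln n)
    (recip_log (alpha S \<mu> \<psi> c))"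
    using X_converges by (subst conv_in_prob_cong[OF Max_components])
  then show ?thesis
    by (intro conjI impI ts.alpha_gt_1_if_subcritical ts.alpha_eq_1_if_supercritical)
qed

end
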